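(* Let $A=KQ/I$ be a gentle algebra and let $k$ be any positive integer. (1) For any $(n,m)$ with $n$ a positive integer and $m\in\mathbb N$, we have $$\phi_{A^{(k)}}(n,m)=\sum_{(q,l)\in S_{(k)}(n,m)}\gcd(q,k)\,\phi_A(q,l),$$ where $$S_{(k)}(n,m)=\Big\{(q,l)\in\mathbb N_{>0}\times\mathbb N\ \Big|\ (n,m)=\Big(\tfrac{L}{k},\ \tfrac{L}{q}l+\tfrac{L}{k}(k-1)\Big),\ L=\mathrm{lcm}(q,k)\Big\}.$$ (2) For any positive integer $l$, we have $\phi_{A^{(k)}}(0,l)=k\,\phi_A(0,l)$.
   Context: $K$ is an algebraically closed field; $\mathbb N=\{0,1,2,\dots\}$. A quiver $Q=(Q_0,Q_1,s,t)$ is finite. Paths are composed from left to right: $\alpha_1\cdots\alpha_l$ (arrows $\alpha_i$, $l\ge1$) is a path of length $l$ if $t(\alpha_i)=s(\alpha_{i+1})$; $e_a$ is the path of length $0$ at the vertex $a$. A bound quiver $(Q,I)$ is locally gentle if $I$ is an ideal of $KQ$ generated by a set of paths of length $2$, every vertex $a$ has in-degree $d_{\rm in}(a)\le 2$ and out-degree $d_{\rm out}(a)\le 2$, and for every arrow $\alpha$ there is at most one arrow $\beta$ with $t(\beta)=s(\alpha)$, $\beta\alpha\in I$; at most one with $t(\beta)=s(\alpha)$, $\beta\alpha\notin I$; at most one with $s(\beta)=t(\alpha)$, $\alpha\beta\in I$; at most one with $s(\beta)=t(\alpha)$, $\alpha\beta\notin I$. Put $A=KQ/I$. A path in $A$ is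 a path of $Q$ not in $I$. An antipath in $A$ is a path $\alpha_1\cdots\alpha_l$ ($l\ge 1$) of $Q$ with all $\alpha_i\alpha_{i+1}\in I$. An oriented cycle (resp. anticycle) in $A$ of length $l$ is a sequence $\alpha_1\cdots\alpha_l$ of pairwise distinct arrows, $l\ge1$, with $t(\alpha_i)=s(\alpha_{i+1})$ and $\alpha_i\alpha_{i+1}\notin I$ (resp. $\in I$) for all $i$ modulo $l$; cyclic rotations are identified when counting. $A$ is gentle if it is locally gentle and has no oriented cycle (equivalently $\dim_K A<\infty$). Standing assumptions: $Q$ is connected and $Q_1\ne\emptyset$. Blossoming: $(Q^{\rm bl},I^{\rm bl})$ is obtained by adding, for each $v\in Q_0$, $2-d_{\rm in}(v)$ incoming arrows from new pairwise distinct vertices and $2-d_{\rm out}(v)$ outgoing arrows to new pairwise distinct vertices, and adding length-two relations so that the result is locally gentle and $\alpha\beta\in I\Leftrightarrow\alpha\beta\in I^{\rm bl}$ for $\alpha,\beta\in Q_1$ (unique up to isomorphism). Put $A^{\rm bl}=KQ^{\rm bl}/I^{\rm bl}$ and $d=d_A=2|Q_0|-|Q_1|$. The new vertices are $d$ sources $s_1,\dots,s_d$ and $d$ sinks $t_1,\dots,t_d$; $\sigma_p$ is the unique arrow starting at $s_p$ and $\tau_p$ the unique arrow ending at $t_p$. A (anti)path is maximal if it cannot be extended by an arrow on either side to a longer (anti)path. The labeling is chosen so that for each $p$ there is a maximal path in $A^{\rm bl}$ from $s_p$ to $t_p$. Finite gentle repetition: for $k\ge1$, $A^{(k)}=KQ^{(k)}/I^{(k)}$,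 where $Q^{(k)}$ has vertices $a^{[i]}$ ($a\in Q_0$, $1\le i\le k$), arrows $\alpha^{[i]}:s(\alpha)^{[i]}\to t(\alpha)^{[i]}$ ($\alpha\in Q_1$, $1\le i\le k$), and connecting arrows $\varpi_p^{[i]}: s(\tau_p)^{[i]}\to t(\sigma_p)^{[i+1]}$ ($1\le p\le d$, $1\le i<k$); $I^{(k)}$ is generated by the $\alpha^{[i]}\beta^{[i]}$ with $\alpha\beta\in I$, the $\alpha^{[i]}\varpi_p^{[i]}$ with $\alpha\tau_p\in I^{\rm bl}$, the $\varpi_p^{[i]}\beta^{[i+1]}$ with $\sigma_p\beta\in I^{\rm bl}$, and the $\varpi_p^{[i]}\varpi_{p'}^{[i+1]}$ with $\sigma_p\tau_{p'}\in I^{\rm bl}$ (composable arrows, $\alpha,\beta\in Q_1$). If $A$ is gentle, so is $A^{(k)}$. Avella-Alaminos–Geiss (AG) invariants of gentle $A$: for each $p$ there is a unique maximal antipath in $A^{\rm bl}$ ending at $t_p$; it starts at some $s_{\Phi(p)}$, which defines a permutation $\Phi=\Phi_A$ of $\{1,\dots,d\}$, and it has the form $\sigma_{\Phi(p)}\delta_p\tau_p$ with $\delta_p$ an antipath in $A$ or a trivial path $e_a$ (of length $0$). The AG-orbits are the orbits $\mathcal O$ of $\Phi$ acting on $\{\delta_1,\dots,\delta_d\}$ by $\delta_p\mapsto\delta_{\Phi(p)}$; the type of $\mathcal O$ is $(q,l)$ with $q=|\mathcal O|$ and $l$ the sum of the lengths of the elements of $\mathcal O$. Define $\phi_A:\mathbb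 N\times\mathbb N\to\mathbb N$: $\phi_A(0,l)$ is the number of anticycles of length $l$ in $A$, and for $q\ge1$, $\phi_A(q,l)$ is the number of AG-orbits of type $(q,l)$. *)

theory Defs
  imports
    "HOL-Computational_Algebra.Polynomial"
    "HOL-Library.Poly_Mapping"
    "HOL-Algebra.Ideal"
    "Graph_Theory.Digraph_Component"
begin

section \<open>Path algebras\<close>

text \<open>
  A finite quiver is a directed multigraph satisfying \<^locale>\<open>fin_digraph\<close>; \<^const>\<open>tail\<close> and
  \<^const>\<open>head\<close> are the source and target maps. A path is a pair of its starting vertex and its
  list of arrows, composed from left to right, so the trivial path at \<open>a\<close> is \<open>(a, [])\<close>.
\<close>

type_synonym ('v, 'a) qpath = "'v \<times> 'a list"

definition paths :: "('v, 'a) pre_digraph \<Rightarrow> ('v, 'a) qpath set" where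
  "paths Q = {(u, p). \<exists>v. pre_digraph.awalk Q u p v}"

definition path_end :: "('v, 'a) pre_digraph \<Rightarrow> ('v, 'a) qpath \<Rightarrow> 'v" where
  "path_end Q x = (if snd x = [] then fst x else head Q (last (snd x)))"

definition pa_mult ::
  "('v, 'a) pre_digraph \<Rightarrow> (('v, 'a) qpath \<Rightarrow>\<^sub>0 'k::field) \<Rightarrow> (('v, 'a) qpath \<Rightarrow>\<^sub>0 'k)
    \<Rightarrow> (('v, 'a) qpath \<Rightarrow>\<^sub>0 'k)" where
  "pa_mult Q f g = (\<Sum>x\<in>Poly_Mapping.keys f. \<Sum>y\<in>Poly_Mapping.keys g.
     if path_end Q x = fst y
     then Poly_Mapping.single (fst x, snd x @ snd y)
            (Poly_Mapping.lookup f x * Poly_Mapping.lookup g y)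
     else 0)"

definition path_algebra :: "('v, 'a) pre_digraph \<Rightarrow> (('v, 'a) qpath \<Rightarrow>\<^sub>0 'k::field) ring" where
  "path_algebra Q = \<lparr>carrier = {f. Poly_Mapping.keys f \<subseteq> paths Q},
     monoid.mult = pa_mult Q,
     one = (\<Sum>a\<in>verts Q. Poly_Mapping.single (a, []) 1),
     zero = 0, add = (+)\<rparr>"

subsection \<open>The path algebra of a finite quiver is a ring\<close>

text \<open>
  This is needed for \<^const>\<open>genideal\<close> to have its intended meaning, since \<^locale>\<open>ideal\<close>
  requires the ambient structure to be a ring.
\<close>

lemma pa_mult_superset:
  assumes "finite X" "Poly_Mapping.keys f \<subseteq> X" "finite Y" "Poly_Mapping.keys g \<subseteq> Y"
  shows "pa_mult Q f g = (\<Sum>x\<in>X. \<Sum>y\<in>Y.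
     if path_end Q x = fst y
     then Poly_Mapping.single (fst x, snd x @ snd y)
            (Poly_Mapping.lookup f x * Poly_Mapping.lookup g y)
     else 0)"
  unfolding pa_mult_def
proof (rule sum.mono_neutral_cong_left[OF assms(1,2)])
  show "\<forall>x\<in>X - Poly_Mapping.keys f. (\<Sum>y\<in>Y. if path_end Q x = fst y
     then Poly_Mapping.single (fst x, snd x @ snd y)
            (Poly_Mapping.lookup f x * Poly_Mapping.lookup g y)
     else 0) = 0"
    by (auto simp: in_keys_iff intro!: sum.neutral)
next
  fix x assume "x \<in> Poly_Mapping.keys f"
  show "(\<Sum>y\<in>Poly_Mapping.keys g. if path_end Q x = fst y
     then Poly_Mapping.single (fst x, snd x @ snd y)
            (Poly_Mapping.lookup f x * Poly_Mapping.lookup g y)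
     else 0) = (\<Sum>y\<in>Y. if path_end Q x = fst y
     then Poly_Mapping.single (fst x, snd x @ snd y)
            (Poly_Mapping.lookup f x * Poly_Mapping.lookup g y)
     else 0)"
    by (rule sum.mono_neutral_cong_left[OF assms(3,4)]) (auto simp: in_keys_iff)
qed

lemma pa_mult_add_left: "pa_mult Q (f + f') g = pa_mult Q f g + pa_mult Q f' g"
proof -
  let ?X = "Poly_Mapping.keys f \<union> Poly_Mapping.keys f'" and ?Y = "Poly_Mapping.keys g"
  have sub: "Poly_Mapping.keys (f + f') \<subseteq> ?X" by (rule Poly_Mapping.keys_add)
  show ?thesis
    by (subst (1 2 3) pa_mult_superset[of ?X _ ?Y])
      (use sub in \<open>auto simp: lookup_add algebra_simps single_add sum.distrib[symmetric]
          intro!: sum.cong\<close>)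
qed

lemma pa_mult_add_right: "pa_mult Q g (f + f') = pa_mult Q g f + pa_mult Q g f'"
proof -
  let ?X = "Poly_Mapping.keys f \<union> Poly_Mapping.keys f'" and ?Y = "Poly_Mapping.keys g"
  have sub: "Poly_Mapping.keys (f + f') \<subseteq> ?X" by (rule Poly_Mapping.keys_add)
  show ?thesis
    by (subst (1 2 3) pa_mult_superset[of ?Y _ ?X])
      (use sub in \<open>auto simp: lookup_add algebra_simps single_add sum.distrib[symmetric]
          intro!: sum.cong\<close>)
qed

lemma pa_mult_zero [simp]: "pa_mult Q 0 g = 0" "pa_mult Q g 0 = 0"
  by (simp_all add: pa_mult_def)

lemma pa_mult_sum_left: "pa_mult Q (sum F S) g = (\<Sum>i\<in>S. pa_mult Q (F i) g)"
  by (induction S rule: infinite_finite_induct) (auto simp: pa_mult_add_left)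

lemma pa_mult_sum_right: "pa_mult Q g (sum F S) = (\<Sum>i\<in>S. pa_mult Q g (F i))"
  by (induction S rule: infinite_finite_induct) (auto simp: pa_mult_add_right)

lemma pa_mult_single:
  "pa_mult Q (Poly_Mapping.single x c) (Poly_Mapping.single y d) =
    (if path_end Q x = fst y then Poly_Mapping.single (fst x, snd x @ snd y) (c * d) else 0)"
  by (subst pa_mult_superset[of "{x}" _ "{y}"]) (auto simp: lookup_single)

lemma pa_expand:
  fixes f :: "'x \<Rightarrow>\<^sub>0 'k::field"
  shows "(\<Sum>x\<in>Poly_Mapping.keys f. Poly_Mapping.single x (Poly_Mapping.lookup f x)) = f"
  by (rule poly_mapping_eqI) (auto simp: lookup_sum lookup_single when_def in_keys_iff)

lemma pa_induct:
  fixes f :: "'x \<Rightarrow>\<^sub>0 'k::field"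
  assumes "P 0" "\<And>f g. P f \<Longrightarrow> P g \<Longrightarrow> P (f + g)" "\<And>x c. P (Poly_Mapping.single x c)"
  shows "P f"
proof -
  have "P (\<Sum>x\<in>A. Poly_Mapping.single x (Poly_Mapping.lookup f x))" if "finite A" for A
    using that by induction (auto intro: assms)
  from this[OF finite_keys[of f]] show ?thesis by (simp only: pa_expand)
qed

lemma pa_mult_assoc:
  fixes f g h :: "('v, 'a) qpath \<Rightarrow>\<^sub>0 'k::field"
  shows "pa_mult Q (pa_mult Q f g) h = pa_mult Q f (pa_mult Q g h)"
proof -
  have 1: "pa_mult Q (pa_mult Q (Poly_Mapping.single x a) (Poly_Mapping.single y b))
      (Poly_Mapping.single z c) = pa_mult Q (Poly_Mapping.single x a)
      (pa_mult Q (Poly_Mapping.single y b) (Poly_Mapping.single z c))" for x y z and a b c :: 'k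
    by (auto simp: pa_mult_single path_end_def mult.assoc split: if_splits)
  have 2: "pa_mult Q (pa_mult Q (Poly_Mapping.single x a) (Poly_Mapping.single y b)) h =
      pa_mult Q (Poly_Mapping.single x a) (pa_mult Q (Poly_Mapping.single y b) h)" for x y and a b :: 'k
    by (induction h rule: pa_induct) (simp_all add: pa_mult_add_right 1)
  have 3: "pa_mult Q (pa_mult Q (Poly_Mapping.single x a) g) h =
      pa_mult Q (Poly_Mapping.single x a) (pa_mult Q g h)" for x and a :: 'k
    by (induction g rule: pa_induct) (simp_all add: pa_mult_add_left pa_mult_add_right 2)
  show ?thesis
    by (induction f rule: pa_induct) (simp_all add: pa_mult_add_left 3)
qed

lemma paths_append:
  assumes "fin_digraph Q" "x \<in> paths Q" "y \<in> paths Q" "path_end Q x = fst y"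
  shows "(fst x, snd x @ snd y) \<in> paths Q"
proof -
  interpret fin_digraph Q by fact
  obtain u p v w q z where *: "x = (u, p)" "awalk u p v" "y = (w, q)" "awalk w q z"
    using assms by (auto simp: paths_def)
  have "path_end Q x = v"
    using *(1,2) by (cases p rule: rev_cases) (auto simp: path_end_def awalk_Nil_iff)
  with * assms(4) have "awalk u (p @ q) z" by auto
  with * show ?thesis by (auto simp: paths_def)
qed

lemma pa_mult_closed:
  assumes "fin_digraph Q" "Poly_Mapping.keys f \<subseteq> paths Q" "Poly_Mapping.keys g \<subseteq> paths Q"
  shows "Poly_Mapping.keys (pa_mult Q f g) \<subseteq> paths Q"
proof
  fix z assume "z \<in> Poly_Mapping.keys (pa_mult Q f g)"
  then have "Poly_Mapping.lookup (pa_mult Q f g) z \<noteq> 0" by (simp add: in_keys_iff)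
  then obtain x where x: "x \<in> Poly_Mapping.keys f" "Poly_Mapping.lookup
      (\<Sum>y\<in>Poly_Mapping.keys g. if path_end Q x = fst y
        then Poly_Mapping.single (fst x, snd x @ snd y)
          (Poly_Mapping.lookup f x * Poly_Mapping.lookup g y) else 0) z \<noteq> 0"
    unfolding pa_mult_def lookup_sum by (meson sum.neutral)
  then obtain y where y: "y \<in> Poly_Mapping.keys g" "Poly_Mapping.lookup
      (if path_end Q x = fst y then Poly_Mapping.single (fst x, snd x @ snd y)
          (Poly_Mapping.lookup f x * Poly_Mapping.lookup g y) else 0) z \<noteq> 0"
    unfolding lookup_sum by (meson sum.neutral)
  then have "path_end Q x = fst y" "z = (fst x, snd x @ snd y)"
    by (auto simp: lookup_single when_def split: if_splits)
  with paths_append[OF assms(1), of x y] x(1) y(1) assms show "z \<in> paths Q" by auto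
qed

lemma ring_path_algebra:
  assumes "fin_digraph Q"
  shows "ring (path_algebra Q :: (('v, 'a) qpath \<Rightarrow>\<^sub>0 'k::field) ring)"
proof -
  interpret fin_digraph Q by fact
  let ?one = "\<Sum>a\<in>verts Q. Poly_Mapping.single (a, []) (1 :: 'k)"
  have triv: "(a, []) \<in> paths Q" if "a \<in> verts Q" for a
    using that by (auto simp: paths_def awalk_Nil_iff)
  have ends: "fst x \<in> verts Q" "path_end Q x \<in> verts Q" if x: "x \<in> paths Q" for x
  proof -
    obtain u p v where *: "x = (u, p)" "awalk u p v" using x by (auto simp: paths_def)
    then show "fst x \<in> verts Q" by (auto simp: awalk_def)
    show "path_end Q x \<in> verts Q"
      using * last_in_set[of p] by (cases "p = []") (auto simp: path_end_def awalk_def simp del: last_in_set)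
  qed
  have "Poly_Mapping.keys (\<Sum>a\<in>A. Poly_Mapping.single (a, []) (1 :: 'k)) \<subseteq> paths Q"
    if "finite A" "A \<subseteq> verts Q" for A
    using that
  proof induction
    case (insert a A)
    then show ?case
      using Poly_Mapping.keys_add[of "Poly_Mapping.single (a, []) (1 :: 'k)"
          "\<Sum>a\<in>A. Poly_Mapping.single (a, []) (1 :: 'k)"] triv[of a] by auto
  qed simp
  then have one: "Poly_Mapping.keys ?one \<subseteq> paths Q" by simp
  have unit: "pa_mult Q ?one f = f" "pa_mult Q f ?one = f"
    if f: "Poly_Mapping.keys f \<subseteq> paths Q" for f
  proof -
    have single: "pa_mult Q ?one (Poly_Mapping.single x c) = Poly_Mapping.single x c"
         "pa_mult Q (Poly_Mapping.single x c) ?one = Poly_Mapping.single x c"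
      if "x \<in> Poly_Mapping.keys f" for x and c
      using subsetD[OF f that] ends[of x]
      by (simp_all add: pa_mult_sum_left pa_mult_sum_right pa_mult_single
          path_end_def[of Q "(_, [])"])
    have "pa_mult Q ?one (\<Sum>x\<in>Poly_Mapping.keys f. Poly_Mapping.single x (Poly_Mapping.lookup f x))
        = (\<Sum>x\<in>Poly_Mapping.keys f. Poly_Mapping.single x (Poly_Mapping.lookup f x))"
      by (subst pa_mult_sum_right) (rule sum.cong[OF refl single(1)])
    moreover have "pa_mult Q (\<Sum>x\<in>Poly_Mapping.keys f. Poly_Mapping.single x (Poly_Mapping.lookup f x)) ?one
        = (\<Sum>x\<in>Poly_Mapping.keys f. Poly_Mapping.single x (Poly_Mapping.lookup f x))"
      by (subst pa_mult_sum_left) (rule sum.cong[OF refl single(2)])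
    ultimately show "pa_mult Q ?one f = f" "pa_mult Q f ?one = f" by (simp_all only: pa_expand)
  qed
  have add: "Poly_Mapping.keys (f + g) \<subseteq> paths Q"
    if "Poly_Mapping.keys f \<subseteq> paths Q" "Poly_Mapping.keys g \<subseteq> paths Q"
    for f g :: "('v, 'a) qpath \<Rightarrow>\<^sub>0 'k"
    using that Poly_Mapping.keys_add[of f g] by blast
  have neg: "\<exists>g. Poly_Mapping.keys g \<subseteq> paths Q \<and> g + f = 0"
    if "Poly_Mapping.keys f \<subseteq> paths Q" for f :: "('v, 'a) qpath \<Rightarrow>\<^sub>0 'k"
    using that by (intro exI[of _ "- f"]) auto
  let ?R = "path_algebra Q :: (('v, 'a) qpath \<Rightarrow>\<^sub>0 'k) ring"
  note R = path_algebra_def partial_object.simps monoid.simps ring.simps mem_Collect_eq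
  show ?thesis
  proof (rule ringI)
    show "abelian_group ?R"
    proof (rule abelian_groupI, unfold R)
      show "Poly_Mapping.keys 0 \<subseteq> paths Q" by simp
      show "\<exists>g\<in>{f. Poly_Mapping.keys f \<subseteq> paths Q}. g + f = 0"
        if "Poly_Mapping.keys f \<subseteq> paths Q" for f :: "('v, 'a) qpath \<Rightarrow>\<^sub>0 'k"
        using neg[OF that] by blast
    qed (fact add | simp add: ac_simps)+
    show "Group.monoid ?R"
      by (rule monoidI, unfold R)
        (fact pa_mult_closed[OF assms] one | rule pa_mult_assoc | erule unit)+
  qed (unfold R, (rule pa_mult_add_left pa_mult_add_right)+)
qed

section \<open>Gentle bound quivers\<close>

text \<open>
  Paths of positive length are given by their lists of arrows. For such a list, the following
  is the corresponding basis element of the path algebra.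
\<close>

definition arrows_elem ::
  "('v, 'a) pre_digraph \<Rightarrow> 'a list \<Rightarrow> (('v, 'a) qpath \<Rightarrow>\<^sub>0 'k::field)" where
  "arrows_elem Q p = Poly_Mapping.single (tail Q (hd p), p) 1"

definition arrow_path :: "('v, 'a) pre_digraph \<Rightarrow> 'a list \<Rightarrow> bool" where
  "arrow_path Q p \<longleftrightarrow> p \<noteq> [] \<and> (tail Q (hd p), p) \<in> paths Q"

definition generated_ideal ::
  "('v, 'a) pre_digraph \<Rightarrow> 'a list set \<Rightarrow> (('v, 'a) qpath \<Rightarrow>\<^sub>0 'k::field) set" where
  "generated_ideal Q R = Idl\<^bsub>path_algebra Q\<^esub> (arrows_elem Q ` R)"

definition locally_gentle ::
  "('v, 'a) pre_digraph \<Rightarrow> (('v, 'a) qpath \<Rightarrow>\<^sub>0 'k::field) set \<Rightarrow> bool" where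
  "locally_gentle Q I \<longleftrightarrow>
     fin_digraph Q \<and>
     (\<exists>R \<subseteq> {p. arrow_path Q p \<and> length p = 2}. I = generated_ideal Q R) \<and>
     (\<forall>a \<in> verts Q. in_degree Q a \<le> 2 \<and> out_degree Q a \<le> 2) \<and>
     (\<forall>\<alpha> \<in> arcs Q.
        (\<exists>\<^sub>\<le>\<^sub>1 \<beta>. \<beta> \<in> arcs Q \<and> head Q \<beta> = tail Q \<alpha> \<and> arrows_elem Q [\<beta>, \<alpha>] \<in> I) \<and>
        (\<exists>\<^sub>\<le>\<^sub>1 \<beta>. \<beta> \<in> arcs Q \<and> head Q \<beta> = tail Q \<alpha> \<and> arrows_elem Q [\<beta>, \<alpha>] \<notin> I) \<and>
        (\<exists>\<^sub>\<le>\<^sub>1 \<beta>. \<beta> \<in> arcs Q \<and> tail Q \<beta> = head Q \<alpha> \<and> arrows_elem Q [\<alpha>, \<beta>] \<in> I) \<and>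
        (\<exists>\<^sub>\<le>\<^sub>1 \<beta>. \<beta> \<in> arcs Q \<and> tail Q \<beta> = head Q \<alpha> \<and> arrows_elem Q [\<alpha>, \<beta>] \<notin> I))"

definition path_in ::
  "('v, 'a) pre_digraph \<Rightarrow> (('v, 'a) qpath \<Rightarrow>\<^sub>0 'k::field) set \<Rightarrow> 'a list \<Rightarrow> bool" where
  "path_in Q I p \<longleftrightarrow> arrow_path Q p \<and> arrows_elem Q p \<notin> I"

definition antipath_in ::
  "('v, 'a) pre_digraph \<Rightarrow> (('v, 'a) qpath \<Rightarrow>\<^sub>0 'k::field) set \<Rightarrow> 'a list \<Rightarrow> bool" where
  "antipath_in Q I p \<longleftrightarrow> arrow_path Q p \<and>
     (\<forall>i. Suc i < length p \<longrightarrow> arrows_elem Q [p ! i, p ! Suc i] \<in> I)"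

definition is_maximal :: "('v, 'a) pre_digraph \<Rightarrow> ('a list \<Rightarrow> bool) \<Rightarrow> 'a list \<Rightarrow> bool" where
  "is_maximal Q P p \<longleftrightarrow> P p \<and> \<not> (\<exists>\<alpha> \<in> arcs Q. P (\<alpha> # p) \<or> P (p @ [\<alpha>]))"

definition oriented_cycle_in ::
  "('v, 'a) pre_digraph \<Rightarrow> (('v, 'a) qpath \<Rightarrow>\<^sub>0 'k::field) set \<Rightarrow> 'a list \<Rightarrow> bool" where
  "oriented_cycle_in Q I p \<longleftrightarrow> p \<noteq> [] \<and> distinct p \<and> set p \<subseteq> arcs Q \<and>
     (\<forall>i < length p. let \<alpha> = p ! i; \<beta> = p ! (Suc i mod length p) in
        head Q \<alpha> = tail Q \<beta> \<and> arrows_elem Q [\<alpha>, \<beta>] \<notin> I)"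

definition anticycle_in ::
  "('v, 'a) pre_digraph \<Rightarrow> (('v, 'a) qpath \<Rightarrow>\<^sub>0 'k::field) set \<Rightarrow> 'a list \<Rightarrow> bool" where
  "anticycle_in Q I p \<longleftrightarrow> p \<noteq> [] \<and> distinct p \<and> set p \<subseteq> arcs Q \<and>
     (\<forall>i < length p. let \<alpha> = p ! i; \<beta> = p ! (Suc i mod length p) in
        head Q \<alpha> = tail Q \<beta> \<and> arrows_elem Q [\<alpha>, \<beta>] \<in> I)"

definition gentle ::
  "('v, 'a) pre_digraph \<Rightarrow> (('v, 'a) qpath \<Rightarrow>\<^sub>0 'k::field) set \<Rightarrow> bool" where
  "gentle Q I \<longleftrightarrow> locally_gentle Q I \<and> \<not> (\<exists>p. oriented_cycle_in Q I p)"

section \<open>Blossoming\<close>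

text \<open>
  The quiver of the blossoming is canonical. At each vertex \<open>v\<close> there are arrows
  \<open>InA v i\<close> from the new source \<open>SrcV v i\<close>, for \<open>i < 2 - in_degree Q v\<close>, and arrows \<open>OutA v i\<close>
  to the new sink \<open>SnkV v i\<close>, for \<open>i < 2 - out_degree Q v\<close>. The ideal of the blossoming is
  only unique up to isomorphism and is a parameter \<open>J\<close>; so is the labeling of the new
  sources and sinks by \<open>s\<close> and \<open>t\<close>.
\<close>

datatype 'v bl_vertex = OldV (old_vertex: 'v) | SrcV 'v nat | SnkV 'v nat

datatype ('v, 'a) bl_arrow = OldA 'a | InA 'v nat | OutA 'v nat

definition new_sources :: "('v, 'a) pre_digraph \<Rightarrow> 'v bl_vertex set" where
  "new_sources Q = {SrcV v i | v i. v \<in> verts Q \<and> i < 2 - in_degree Q v}"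

definition new_sinks :: "('v, 'a) pre_digraph \<Rightarrow> 'v bl_vertex set" where
  "new_sinks Q = {SnkV v i | v i. v \<in> verts Q \<and> i < 2 - out_degree Q v}"

definition bl_quiver ::
  "('v, 'a) pre_digraph \<Rightarrow> ('v bl_vertex, ('v, 'a) bl_arrow) pre_digraph" where
  "bl_quiver Q = \<lparr>verts = OldV ` verts Q \<union> new_sources Q \<union> new_sinks Q,
     arcs = OldA ` arcs Q
       \<union> {InA v i | v i. v \<in> verts Q \<and> i < 2 - in_degree Q v}
       \<union> {OutA v i | v i. v \<in> verts Q \<and> i < 2 - out_degree Q v},
     tail = (\<lambda>a. case a of OldA \<alpha> \<Rightarrow> OldV (tail Q \<alpha>) | InA v i \<Rightarrow> SrcV v i | OutA v i \<Rightarrow> OldV v),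
     head = (\<lambda>a. case a of OldA \<alpha> \<Rightarrow> OldV (head Q \<alpha>) | InA v i \<Rightarrow> OldV v | OutA v i \<Rightarrow> SnkV v i)\<rparr>"

definition bl_ideal ::
  "('v, 'a) pre_digraph \<Rightarrow> (('v, 'a) qpath \<Rightarrow>\<^sub>0 'k::field) set
    \<Rightarrow> (('v bl_vertex, ('v, 'a) bl_arrow) qpath \<Rightarrow>\<^sub>0 'k) set \<Rightarrow> bool" where
  "bl_ideal Q I J \<longleftrightarrow> locally_gentle (bl_quiver Q) J \<and>
     (\<forall>\<alpha> \<in> arcs Q. \<forall>\<beta> \<in> arcs Q. head Q \<alpha> = tail Q \<beta> \<longrightarrow>
        (arrows_elem Q [\<alpha>, \<beta>] \<in> I \<longleftrightarrow> arrows_elem (bl_quiver Q) [OldA \<alpha>, OldA \<beta>] \<in> J))"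

definition bl_number :: "('v, 'a) pre_digraph \<Rightarrow> nat" where
  "bl_number Q = 2 * card (verts Q) - card (arcs Q)"

definition bl_labeling ::
  "('v, 'a) pre_digraph \<Rightarrow> (('v bl_vertex, ('v, 'a) bl_arrow) qpath \<Rightarrow>\<^sub>0 'k::field) set
    \<Rightarrow> (nat \<Rightarrow> 'v bl_vertex) \<Rightarrow> (nat \<Rightarrow> 'v bl_vertex) \<Rightarrow> bool" where
  "bl_labeling Q J s t \<longleftrightarrow>
     bij_betw s {1..bl_number Q} (new_sources Q) \<and>
     bij_betw t {1..bl_number Q} (new_sinks Q) \<and>
     (\<forall>p \<in> {1..bl_number Q}. \<exists>w. is_maximal (bl_quiver Q) (path_in (bl_quiver Q) J) w \<and>
        tail (bl_quiver Q) (hd w) = s p \<and> head (bl_quiver Q) (last w) = t p)"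

definition blossoming ::
  "('v, 'a) pre_digraph \<Rightarrow> (('v, 'a) qpath \<Rightarrow>\<^sub>0 'k::field) set
    \<Rightarrow> (('v bl_vertex, ('v, 'a) bl_arrow) qpath \<Rightarrow>\<^sub>0 'k) set
    \<Rightarrow> (nat \<Rightarrow> 'v bl_vertex) \<Rightarrow> (nat \<Rightarrow> 'v bl_vertex) \<Rightarrow> bool" where
  "blossoming Q I J s t \<longleftrightarrow> bl_ideal Q I J \<and> bl_labeling Q J s t"

definition source_arrow ::
  "('v, 'a) pre_digraph \<Rightarrow> (nat \<Rightarrow> 'v bl_vertex) \<Rightarrow> nat \<Rightarrow> ('v, 'a) bl_arrow" where
  "source_arrow Q s p = (THE a. a \<in> arcs (bl_quiver Q) \<and> tail (bl_quiver Q) a = s p)"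

definition sink_arrow ::
  "('v, 'a) pre_digraph \<Rightarrow> (nat \<Rightarrow> 'v bl_vertex) \<Rightarrow> nat \<Rightarrow> ('v, 'a) bl_arrow" where
  "sink_arrow Q t p = (THE a. a \<in> arcs (bl_quiver Q) \<and> head (bl_quiver Q) a = t p)"

section \<open>Finite gentle repetitions\<close>

text \<open>
  \<open>Copy \<alpha> i\<close> is the \<open>i\<close>-th copy of the arrow \<open>\<alpha>\<close>, and \<open>Conn p i\<close> is the connecting arrow with
  label \<open>p\<close> from the \<open>i\<close>-th to the \<open>Suc i\<close>-th copy of the quiver.
\<close>

datatype 'a rep_arrow = Copy 'a nat | Conn nat nat

definition rep_quiver ::
  "('v, 'a) pre_digraph \<Rightarrow> (nat \<Rightarrow> 'v bl_vertex) \<Rightarrow> (nat \<Rightarrow> 'v bl_vertex) \<Rightarrow> nat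
    \<Rightarrow> ('v \<times> nat, 'a rep_arrow) pre_digraph" where
  "rep_quiver Q s t k = \<lparr>verts = verts Q \<times> {1..k},
     arcs = {Copy \<alpha> i | \<alpha> i. \<alpha> \<in> arcs Q \<and> i \<in> {1..k}}
       \<union> {Conn p i | p i. p \<in> {1..bl_number Q} \<and> i \<in> {1..<k}},
     tail = (\<lambda>a. case a of Copy \<alpha> i \<Rightarrow> (tail Q \<alpha>, i)
       | Conn p i \<Rightarrow> (old_vertex (tail (bl_quiver Q) (sink_arrow Q t p)), i)),
     head = (\<lambda>a. case a of Copy \<alpha> i \<Rightarrow> (head Q \<alpha>, i)
       | Conn p i \<Rightarrow> (old_vertex (head (bl_quiver Q) (source_arrow Q s p)), Suc i))\<rparr>"

definition rep_relations ::
  "('v, 'a) pre_digraph \<Rightarrow> (('v, 'a) qpath \<Rightarrow>\<^sub>0 'k::field) set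
    \<Rightarrow> (('v bl_vertex, ('v, 'a) bl_arrow) qpath \<Rightarrow>\<^sub>0 'k) set
    \<Rightarrow> (nat \<Rightarrow> 'v bl_vertex) \<Rightarrow> (nat \<Rightarrow> 'v bl_vertex) \<Rightarrow> nat \<Rightarrow> 'a rep_arrow list set" where
  "rep_relations Q I J s t k =
     (let B = bl_quiver Q; \<sigma> = source_arrow Q s; \<tau> = sink_arrow Q t; D = {1..bl_number Q} in
       {[Copy \<alpha> i, Copy \<beta> i] | \<alpha> \<beta> i. \<alpha> \<in> arcs Q \<and> \<beta> \<in> arcs Q \<and> i \<in> {1..k} \<and>
          head Q \<alpha> = tail Q \<beta> \<and> arrows_elem Q [\<alpha>, \<beta>] \<in> I}
     \<union> {[Copy \<alpha> i, Conn p i] | \<alpha> p i. \<alpha> \<in> arcs Q \<and> p \<in> D \<and> i \<in> {1..<k} \<and>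
          head B (OldA \<alpha>) = tail B (\<tau> p) \<and> arrows_elem B [OldA \<alpha>, \<tau> p] \<in> J}
     \<union> {[Conn p i, Copy \<beta> (Suc i)] | p \<beta> i. \<beta> \<in> arcs Q \<and> p \<in> D \<and> i \<in> {1..<k} \<and>
          head B (\<sigma> p) = tail B (OldA \<beta>) \<and> arrows_elem B [\<sigma> p, OldA \<beta>] \<in> J}
     \<union> {[Conn p i, Conn p' (Suc i)] | p p' i. p \<in> D \<and> p' \<in> D \<and> i \<in> {1..<k} \<and> Suc i \<in> {1..<k} \<and>
          head B (\<sigma> p) = tail B (\<tau> p') \<and> arrows_elem B [\<sigma> p, \<tau> p'] \<in> J})"

definition rep_ideal ::
  "('v, 'a) pre_digraph \<Rightarrow> (('v, 'a) qpath \<Rightarrow>\<^sub>0 'k::field) set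
    \<Rightarrow> (('v bl_vertex, ('v, 'a) bl_arrow) qpath \<Rightarrow>\<^sub>0 'k) set
    \<Rightarrow> (nat \<Rightarrow> 'v bl_vertex) \<Rightarrow> (nat \<Rightarrow> 'v bl_vertex) \<Rightarrow> nat
    \<Rightarrow> (('v \<times> nat, 'a rep_arrow) qpath \<Rightarrow>\<^sub>0 'k) set" where
  "rep_ideal Q I J s t k = generated_ideal (rep_quiver Q s t k) (rep_relations Q I J s t k)"

section \<open>Avella-Alaminos--Geiss invariants\<close>

definition max_antipath_to ::
  "('v, 'a) pre_digraph \<Rightarrow> (('v bl_vertex, ('v, 'a) bl_arrow) qpath \<Rightarrow>\<^sub>0 'k::field) set
    \<Rightarrow> 'v bl_vertex \<Rightarrow> ('v, 'a) bl_arrow list" where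
  "max_antipath_to Q J y = (THE w. is_maximal (bl_quiver Q) (antipath_in (bl_quiver Q) J) w \<and>
     head (bl_quiver Q) (last w) = y)"

definition AG_perm ::
  "('v, 'a) pre_digraph \<Rightarrow> (('v bl_vertex, ('v, 'a) bl_arrow) qpath \<Rightarrow>\<^sub>0 'k::field) set
    \<Rightarrow> (nat \<Rightarrow> 'v bl_vertex) \<Rightarrow> (nat \<Rightarrow> 'v bl_vertex) \<Rightarrow> nat \<Rightarrow> nat" where
  "AG_perm Q J s t p = (THE r. r \<in> {1..bl_number Q} \<and>
     tail (bl_quiver Q) (hd (max_antipath_to Q J (t p))) = s r)"

definition AG_delta ::
  "('v, 'a) pre_digraph \<Rightarrow> (('v bl_vertex, ('v, 'a) bl_arrow) qpath \<Rightarrow>\<^sub>0 'k::field) set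
    \<Rightarrow> (nat \<Rightarrow> 'v bl_vertex) \<Rightarrow> (nat \<Rightarrow> 'v bl_vertex) \<Rightarrow> nat \<Rightarrow> ('v, 'a) qpath" where
  "AG_delta Q J s t p = (THE x. x \<in> paths Q \<and>
     head (bl_quiver Q) (source_arrow Q s (AG_perm Q J s t p)) = OldV (fst x) \<and>
     max_antipath_to Q J (t p) =
       source_arrow Q s (AG_perm Q J s t p) # map OldA (snd x) @ [sink_arrow Q t p])"

definition AG_orbits ::
  "('v, 'a) pre_digraph \<Rightarrow> (('v bl_vertex, ('v, 'a) bl_arrow) qpath \<Rightarrow>\<^sub>0 'k::field) set
    \<Rightarrow> (nat \<Rightarrow> 'v bl_vertex) \<Rightarrow> (nat \<Rightarrow> 'v bl_vertex) \<Rightarrow> ('v, 'a) qpath set set" where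
  "AG_orbits Q J s t =
     {{AG_delta Q J s t ((AG_perm Q J s t ^^ j) p) | j. True} | p. p \<in> {1..bl_number Q}}"

definition AG_type :: "('v, 'a) qpath set \<Rightarrow> nat \<times> nat" where
  "AG_type X = (card X, \<Sum>x\<in>X. length (snd x))"

definition AG_phi ::
  "('v, 'a) pre_digraph \<Rightarrow> (('v, 'a) qpath \<Rightarrow>\<^sub>0 'k::field) set
    \<Rightarrow> (('v bl_vertex, ('v, 'a) bl_arrow) qpath \<Rightarrow>\<^sub>0 'k) set
    \<Rightarrow> (nat \<Rightarrow> 'v bl_vertex) \<Rightarrow> (nat \<Rightarrow> 'v bl_vertex) \<Rightarrow> nat \<Rightarrow> nat \<Rightarrow> nat" where
  "AG_phi Q I J s t q l =
     (if q = 0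
      then card {{rotate i p | i. True} | p. anticycle_in Q I p \<and> length p = l}
      else card {X \<in> AG_orbits Q J s t. AG_type X = (q, l)})"

text \<open>All divisions below are exact.\<close>

definition S_rep :: "nat \<Rightarrow> nat \<Rightarrow> nat \<Rightarrow> (nat \<times> nat) set" where
  "S_rep k n m = {(q, l). 0 < q \<and>
     (let L = lcm q k in (n, m) = (L div k, (L div q) * l + (L div k) * (k - 1)))}"

lemma finite_S_rep:
  assumes "0 < k"
  shows "finite (S_rep k n m)"
proof (rule finite_subset)
  show "S_rep k n m \<subseteq> {..n * k} \<times> {..m}"
  proof
    fix x assume "x \<in> S_rep k n m"
    then obtain q l where x: "x = (q, l)" "0 < q" "n = lcm q k div k"
        "m = (lcm q k div q) * l + (lcm q k div k) * (k - 1)"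
      by (auto simp: S_rep_def Let_def)
    have "n * k = lcm q k" using x(3) by simp
    moreover have "q \<le> lcm q k" using x(2) assms by (intro dvd_imp_le) (auto intro: lcm_pos_nat)
    moreover have "0 < lcm q k div q"
      using x(2) assms \<open>q \<le> lcm q k\<close> by (simp add: div_greater_zero_iff)
    then have "l \<le> (lcm q k div q) * l" by simp
    moreover from this have "l \<le> m" unfolding x(4) by linarith
    ultimately show "x \<in> {..n * k} \<times> {..m}" using x(1) by auto
  qed
qed auto

end

theory Submission
  imports Defs "HOL-Combinatorics.Orbits"
begin

text \<open>
  Everything is encoded in one permutation. Glue each arrow \<open>\<tau>\<^sub>p\<close> of the blossoming to the arrow
  \<open>\<sigma>\<^sub>p\<close>; this leaves the set \<open>X\<close> of the arrows of \<open>Q\<close> together with the labels \<open>1, \<dots>, d\<close>. At every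
  vertex of \<open>Q\<close> two arrows of the blossoming arrive and two leave, and local gentleness forces each
  arriving arrow to have exactly one vanishing and one nonvanishing continuation. The vanishing
  continuations form a permutation \<open>Z\<close> of \<open>X\<close>. A cycle of \<open>Z\<close> without labels is an anticycle of \<open>A\<close>.
  A cycle with labels is cut by them into segments, which are the \<open>\<delta>\<^sub>p\<close>, and \<open>\<Phi>\<close> runs backwards
  through the labels on it; so it is an AG-orbit. Hence \<open>\<phi>\<^sub>A(q, l)\<close> is the number of cycles of \<open>Z\<close>
  with \<open>q\<close> labels and \<open>l\<close> arrows, for \<open>q = 0\<close> as well as for \<open>q > 0\<close>
  (\<open>AG_phi_0\<close> and \<open>AG_phi_pos\<close>).

  For the repetition the permutation is the cyclic cover of \<open>Z\<close> of degree \<open>k\<close>: on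
  \<open>X \<times> {1..k}\<close> it acts as \<open>Z\<close> and raises the level, modulo \<open>k\<close>, when it passes a label. The
  copy of the label \<open>p\<close> at a level \<open>i < k\<close> is the connecting arrow, and the copy at level \<open>k\<close> is a
  label of the repetition. Two choices stand between this picture and a given blossoming of
  \<open>A\<^sup>(\<^sup>k\<^sup>)\<close>. The relations between new arrows are only determined up to isomorphism; at each
  vertex the identification is extended from the old arrows to the new ones, which is possible
  because a partial injection between sets of equal size extends to a bijection
  (\<open>exists_local_isomorphism\<close>). Moreover the source that replaces \<open>\<sigma>\<^sub>p\<close> at level \<open>1\<close> and the
  sink that replaces \<open>\<tau>\<^sub>p\<close> at level \<open>k\<close> must carry the same label. They do because labels are
  matched along nonvanishing paths: the path from \<open>\<sigma>\<^sub>p\<close> to \<open>\<tau>\<^sub>p\<close> lifts to every level, and the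
  connecting arrows concatenate the lifts (\<open>out_copy_label_eq_in_copy\<close>).

  It remains to count. Running once through a cycle with \<open>q\<close> labels raises the level by \<open>q\<close>, so
  the cycle has \<open>g = gcd q k\<close> cycles above it, each of which runs \<open>k / g\<close> times through it. The
  labels met on one of them take all levels equally often, so \<open>q / g\<close> of them are at level \<open>k\<close>
  (\<open>num_cycles_cyclic_cover\<close>). With \<open>L = lcm q k\<close> this is the type
  \<open>(L / k, (L / q) l + (L / k) (k - 1))\<close>.
\<close>

section \<open>Cycles of a permutation\<close>

abbreviation cycles :: "('x \<Rightarrow> 'x) \<Rightarrow> 'x set \<Rightarrow> 'x set set" where
  "cycles f X \<equiv> orbit f ` X"

text \<open>
  Cycles are counted by the numbers of their points inside and outside a distinguished set \<open>L\<close>;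
  below, \<open>L\<close> consists of the labels and the points outside \<open>L\<close> are arrows.
\<close>
definition num_cycles :: "('x \<Rightarrow> 'x) \<Rightarrow> 'x set \<Rightarrow> 'x set \<Rightarrow> nat \<Rightarrow> nat \<Rightarrow> nat" where
  "num_cycles f X L q l = card {C \<in> cycles f X. card (C \<inter> L) = q \<and> card (C - L) = l}"

lemma funpow_fixed_iff_card_orbit_dvd:
  assumes "x \<in> orbit f x"
  shows "(f ^^ n) x = x \<longleftrightarrow> card (orbit f x) dvd n"
proof -
  let ?d = "funpow_dist1 f x x"
  have d: "card (orbit f x) = ?d"
    by (subst orbit_conv_funpow_dist1[OF assms], subst card_image[OF inj_on_funpow_dist1[OF assms]]) simp
  have fix': "(f ^^ ?d) x = x" by (rule funpow_dist1_prop[OF assms])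
  have "(f ^^ (n mod ?d)) x = (f ^^ n) x" by (rule funpow_mod_eq[OF fix'])
  moreover have "(f ^^ (n mod ?d)) x = x \<longleftrightarrow> n mod ?d = 0"
    using funpow_dist1_least[of "n mod ?d" f x x] by (cases "n mod ?d = 0") auto
  ultimately show ?thesis unfolding d by (auto simp: dvd_eq_mod_eq_0)
qed

lemma card_orbit_eqI:
  assumes "\<And>n. (f ^^ n) x = x \<longleftrightarrow> M dvd n" "0 < M"
  shows "x \<in> orbit f x" "card (orbit f x) = M"
proof -
  have "(f ^^ M) x = x" using assms(1)[of M] by simp
  then show x: "x \<in> orbit f x" using assms(2) unfolding orbit_altdef by (intro CollectI exI[of _ M]) simp
  have "M dvd card (orbit f x)" using funpow_fixed_iff_card_orbit_dvd[OF x, of "card (orbit f x)"] assms(1)[of "card (orbit f x)"] by simp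
  moreover have "card (orbit f x) dvd M" using funpow_fixed_iff_card_orbit_dvd[OF x, of M] assms(1)[of M] by simp
  ultimately show "card (orbit f x) = M" by (rule dvd_antisym[rotated])
qed

lemma orbit_eq_if_mem:
  assumes "x \<in> orbit f x" "y \<in> orbit f x"
  shows "orbit f y = orbit f x"
  by (rule orbit_cyclic_eq3[OF cyclic_on_singleI[OF assms(1) refl] assms(2)])

lemma num_cycles_conjugate:
  assumes bij: "bij_betw h Y X" and closed: "\<And>y. y \<in> Y \<Longrightarrow> f y \<in> Y"
    and conj: "\<And>y. y \<in> Y \<Longrightarrow> g (h y) = h (f y)" and self: "\<And>y. y \<in> Y \<Longrightarrow> y \<in> orbit f y"
    and L: "\<And>y. y \<in> Y \<Longrightarrow> h y \<in> L \<longleftrightarrow> y \<in> M"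
  shows "num_cycles g X L q l = num_cycles f Y M q l"
proof -
  have sub: "orbit f y \<subseteq> Y" if "y \<in> Y" for y
  proof
    fix z assume "z \<in> orbit f y" then show "z \<in> Y" by induction (use that closed in auto)
  qed
  have inj: "inj_on h Y" and surj: "h ` Y = X" using bij by (auto simp: bij_betw_def)
  have im: "h ` orbit f y = orbit g (h y)" if "y \<in> Y" for y
    using self[OF that] by (rule orbit_inverse) (use conj sub that in auto)
  have cards: "card (h ` C \<inter> L) = card (C \<inter> M)" "card (h ` C - L) = card (C - M)" if "C \<subseteq> Y" for C
  proof -
    have "h ` C \<inter> L = h ` (C \<inter> M)" "h ` C - L = h ` (C - M)" using that L by auto
    then show "card (h ` C \<inter> L) = card (C \<inter> M)" "card (h ` C - L) = card (C - M)"
      using that by (auto intro!: card_image inj_on_subset[OF inj])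
  qed
  have "{C \<in> cycles g X. card (C \<inter> L) = q \<and> card (C - L) = l}
      = image h ` {C \<in> cycles f Y. card (C \<inter> M) = q \<and> card (C - M) = l}" (is "?A = image h ` ?B")
  proof -
    have "cycles g X = image h ` cycles f Y"
      unfolding surj[symmetric] image_image using im by (auto intro!: image_cong)
    then have "?A = image h ` {C \<in> cycles f Y. card (h ` C \<inter> L) = q \<and> card (h ` C - L) = l}"
      by (simp add: Compr_image_eq)
    moreover have "C \<in> cycles f Y \<Longrightarrow> C \<subseteq> Y" for C using sub by blast
    then have "{C \<in> cycles f Y. card (h ` C \<inter> L) = q \<and> card (h ` C - L) = l}
        = {C \<in> cycles f Y. card (C \<inter> M) = q \<and> card (C - M) = l}"
      by (intro Collect_cong conj_cong refl) (simp_all add: cards)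
    ultimately show ?thesis by simp
  qed
  moreover have "inj_on (image h) ?B"
    by (rule inj_on_subset[OF inj_on_image_Pow[OF inj]]) (use sub in auto)
  ultimately show ?thesis unfolding num_cycles_def by (simp add: card_image)
qed

section \<open>First return maps\<close>

text \<open>
  Here \<open>g\<close> is the first return map of \<open>f\<close> to \<open>L\<close>, and \<open>\<tau>\<close> is the return time.
\<close>
locale first_return =
  fixes f :: "'x \<Rightarrow> 'x" and L :: "'x set" and g :: "'x \<Rightarrow> 'x" and \<tau> :: "'x \<Rightarrow> nat"
  assumes inj: "inj f" and fin: "finite L"
    and g_L: "r \<in> L \<Longrightarrow> g r \<in> L" and pos: "r \<in> L \<Longrightarrow> 0 < \<tau> r"
    and ret: "r \<in> L \<Longrightarrow> (f ^^ \<tau> r) r = g r"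
    and first: "r \<in> L \<Longrightarrow> 0 < j \<Longrightarrow> j < \<tau> r \<Longrightarrow> (f ^^ j) r \<notin> L"
begin

lemma iterate_L: "r \<in> L \<Longrightarrow> (g ^^ j) r \<in> L"
  by (induction j) (auto intro: g_L)

lemma iterate_return: "r \<in> L \<Longrightarrow> \<exists>n. (g ^^ j) r = (f ^^ n) r"
proof (induction j)
  case (Suc j)
  then obtain n where "(g ^^ j) r = (f ^^ n) r" by auto
  then have "(g ^^ Suc j) r = (f ^^ \<tau> ((g ^^ j) r)) ((f ^^ n) r)"
    using ret[OF iterate_L[OF Suc.prems, of j]] by simp
  also have "\<dots> = (f ^^ (\<tau> ((g ^^ j) r) + n)) r" by (simp add: funpow_add)
  finally show ?case by blast
qed (auto intro: exI[of _ 0])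

text \<open>
  Cutting an orbit at its visits to \<open>L\<close>: the point reached after \<open>n\<close> steps lies on the segment that
  starts at the last visit to \<open>L\<close> so far.
\<close>
lemma iterate_decompose:
  "r \<in> L \<Longrightarrow> \<exists>j i. i < \<tau> ((g ^^ j) r) \<and> (f ^^ n) r = (f ^^ i) ((g ^^ j) r)"
proof (induction n arbitrary: r rule: less_induct)
  case (less n)
  show ?case
  proof (cases "n < \<tau> r")
    case True
    then show ?thesis by (intro exI[of _ 0] exI[of _ n]) auto
  next
    case False
    then have n: "n = (n - \<tau> r) + \<tau> r" by simp
    have eq: "(f ^^ n) r = (f ^^ (n - \<tau> r)) (g r)"
      by (subst n) (simp add: funpow_add ret less.prems)
    from False pos[OF less.prems] have "n - \<tau> r < n" by simp
    from less.IH[OF this g_L[OF less.prems]] obtain j i where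
      "i < \<tau> ((g ^^ j) (g r))" "(f ^^ (n - \<tau> r)) (g r) = (f ^^ i) ((g ^^ j) (g r))" by blast
    then show ?thesis
      by (intro exI[of _ "Suc j"] exI[of _ i]) (simp add: eq funpow_swap1)
  qed
qed

lemma inter_iterates:
  assumes "r \<in> L"
  shows "{(f ^^ n) r | n. True} \<inter> L = {(g ^^ j) r | j. True}"
proof (intro equalityI subsetI)
  fix y assume "y \<in> {(f ^^ n) r | n. True} \<inter> L"
  then obtain n where n: "y = (f ^^ n) r" "y \<in> L" by auto
  obtain j i where ji: "i < \<tau> ((g ^^ j) r)" "(f ^^ n) r = (f ^^ i) ((g ^^ j) r)"
    using iterate_decompose[OF assms] by blast
  have "i = 0" using first[OF iterate_L[OF assms, of j] _ ji(1)] ji(2) n by auto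
  then show "y \<in> {(g ^^ j) r | j. True}" using ji n by auto
next
  fix y assume "y \<in> {(g ^^ j) r | j. True}"
  then show "y \<in> {(f ^^ n) r | n. True} \<inter> L" using iterate_return[OF assms] iterate_L[OF assms] by blast
qed

text \<open>
  The segments between successive visits to \<open>L\<close> are disjoint: if two of them met, then by injectivity
  of \<open>f\<close> one starting point would be met strictly inside the other segment.
\<close>
lemma card_iterates:
  assumes "r \<in> L"
  shows "card {(f ^^ n) r | n. True} = (\<Sum>y \<in> {(g ^^ j) r | j. True}. \<tau> y)"
proof -
  let ?S = "{(g ^^ j) r | j. True}"
  let ?P = "SIGMA y:?S. {..<\<tau> y}"
  have sub: "?S \<subseteq> L" using iterate_L[OF assms] by auto
  have key: "i = j \<and> y = z" if "y \<in> L" "z \<in> L" "j < \<tau> z" "i \<le> j" "(f ^^ i) y = (f ^^ j) z" for y z i j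
  proof -
    have "(f ^^ i) y = (f ^^ i) ((f ^^ (j - i)) z)"
      using that(4,5) funpow_add[of i "j - i" f] by simp
    then have y: "y = (f ^^ (j - i)) z" by (rule injD[OF inj_fn[OF inj]])
    have "(f ^^ (j - i)) z \<in> L" using y that(1) by simp
    then have "\<not> 0 < j - i" using first[OF that(2), of "j - i"] less_imp_diff_less[OF that(3), of i] by blast
    then show ?thesis using y that(4) by simp
  qed
  have "inj_on (\<lambda>(y, i). (f ^^ i) y) ?P"
  proof (rule inj_onI, clarsimp)
    fix i j a b assume *: "i < \<tau> ((g ^^ a) r)" "j < \<tau> ((g ^^ b) r)"
      "(f ^^ i) ((g ^^ a) r) = (f ^^ j) ((g ^^ b) r)"
    show "(g ^^ a) r = (g ^^ b) r \<and> i = j"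
      using key[OF iterate_L[OF assms, of a] iterate_L[OF assms, of b] *(2) _ *(3)]
        key[OF iterate_L[OF assms, of b] iterate_L[OF assms, of a] *(1) _ *(3)[symmetric]]
      by (cases "i \<le> j") auto
  qed
  moreover have "(\<lambda>(y, i). (f ^^ i) y) ` ?P = {(f ^^ n) r | n. True}"
  proof (intro equalityI subsetI)
    fix x assume "x \<in> (\<lambda>(y, i). (f ^^ i) y) ` ?P"
    then obtain j i where x: "x = (f ^^ i) ((g ^^ j) r)" by auto
    obtain n where "(g ^^ j) r = (f ^^ n) r" using iterate_return[OF assms] by blast
    then have "x = (f ^^ (i + n)) r" using x by (simp add: funpow_add)
    then show "x \<in> {(f ^^ n) r | n. True}" by blast
  next
    fix x assume "x \<in> {(f ^^ n) r | n. True}"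
    then obtain n where "x = (f ^^ n) r" by blast
    then obtain j i where "i < \<tau> ((g ^^ j) r)" "x = (f ^^ i) ((g ^^ j) r)"
      using iterate_decompose[OF assms, of n] by auto
    then have "((g ^^ j) r, i) \<in> ?P" "x = (\<lambda>(y, i). (f ^^ i) y) ((g ^^ j) r, i)" by auto
    then show "x \<in> (\<lambda>(y, i). (f ^^ i) y) ` ?P" by (rule rev_image_eqI)
  qed
  ultimately have "card {(f ^^ n) r | n. True} = card ?P" by (metis card_image)
  also have "\<dots> = (\<Sum>y \<in> ?S. \<tau> y)"
    using finite_subset[OF sub fin] by simp
  finally show ?thesis .
qed

end

section \<open>Cyclic covers of a permutation\<close>

text \<open>
  The cover of degree \<open>k\<close> of \<open>f\<close> whose level rises, cyclically, on leaving a point of \<open>L\<close>.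
\<close>
definition cyclic_cover :: "nat \<Rightarrow> ('x \<Rightarrow> 'x) \<Rightarrow> 'x set \<Rightarrow> 'x \<times> nat \<Rightarrow> 'x \<times> nat" where
  "cyclic_cover k f L = (\<lambda>(x, i). (f x, if x \<in> L then Suc i mod k else i))"

lemma cyclic_cover_funpow:
  assumes "i < k"
  shows "(cyclic_cover k f L ^^ n) (x, i) = ((f ^^ n) x, (i + card {j. j < n \<and> (f ^^ j) x \<in> L}) mod k)"
proof (induction n)
  case (Suc n)
  have "{j. j < Suc n \<and> (f ^^ j) x \<in> L}
      = (if (f ^^ n) x \<in> L then insert n {j. j < n \<and> (f ^^ j) x \<in> L} else {j. j < n \<and> (f ^^ j) x \<in> L})"
    by (auto simp: less_Suc_eq)
  then have "card {j. j < Suc n \<and> (f ^^ j) x \<in> L}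
      = card {j. j < n \<and> (f ^^ j) x \<in> L} + (if (f ^^ n) x \<in> L then 1 else 0)"
    by auto
  then show ?case using Suc by (simp add: cyclic_cover_def mod_Suc_eq)
qed (use assms in simp)

text \<open>
  Every period visits each point of the cycle once.
\<close>
lemma card_visits_period:
  assumes "x \<in> orbit f x"
  shows "card {j. j < card (orbit f x) * a \<and> (f ^^ j) x \<in> L} = card (orbit f x \<inter> L) * a"
proof (induction a)
  case (Suc a)
  let ?m = "card (orbit f x)"
  have fix': "(f ^^ (?m * a)) x = x" for a
    using funpow_fixed_iff_card_orbit_dvd[OF assms] by auto
  have d: "?m = funpow_dist1 f x x"
    by (subst orbit_conv_funpow_dist1[OF assms], subst card_image[OF inj_on_funpow_dist1[OF assms]]) simp
  have shift: "(f ^^ (?m * a + j)) x = (f ^^ j) x" for j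
    using fix'[of a] funpow_add[of j "?m * a" f] by (simp add: add.commute)
  have split: "{j. j < ?m * Suc a \<and> (f ^^ j) x \<in> L}
      = {j. j < ?m * a \<and> (f ^^ j) x \<in> L} \<union> (+) (?m * a) ` {j. j < ?m \<and> (f ^^ j) x \<in> L}" (is "_ = ?A \<union> ?B")
  proof (intro equalityI subsetI)
    fix j assume j: "j \<in> {j. j < ?m * Suc a \<and> (f ^^ j) x \<in> L}"
    show "j \<in> ?A \<union> ?B"
    proof (cases "j < ?m * a")
      case False
      then have "j = ?m * a + (j - ?m * a)" by simp
      moreover have "j - ?m * a \<in> {j. j < ?m \<and> (f ^^ j) x \<in> L}"
        using j False shift[of "j - ?m * a"] by auto
      ultimately show ?thesis by blast
    qed (use j in auto)
  qed (auto simp: shift)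
  have "card {j. j < ?m \<and> (f ^^ j) x \<in> L} = card (orbit f x \<inter> L)"
  proof -
    have "orbit f x \<inter> L = (\<lambda>n. (f ^^ n) x) ` {j. j < ?m \<and> (f ^^ j) x \<in> L}"
    proof -
      have "orbit f x = (\<lambda>n. (f ^^ n) x) ` {0..<?m}"
        using orbit_conv_funpow_dist1[OF assms] unfolding d[symmetric] .
      then show ?thesis by fastforce
    qed
    moreover have "inj_on (\<lambda>n. (f ^^ n) x) {j. j < ?m \<and> (f ^^ j) x \<in> L}"
      by (rule inj_on_subset[OF inj_on_funpow_dist1[OF assms]]) (auto simp: d)
    ultimately show ?thesis by (simp add: card_image)
  qed
  moreover have "card (?A \<union> ?B) = card ?A + card ?B"
    by (rule card_Un_disjoint) auto
  moreover have "card ?B = card {j. j < ?m \<and> (f ^^ j) x \<in> L}" by (rule card_image) auto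
  ultimately show ?case unfolding split using Suc by simp
qed simp

text \<open>
  The point \<open>(x, i)\<close> recurs at a time \<open>n\<close> only if \<open>x\<close> does, so \<open>n = m a\<close> with \<open>m\<close> the length of the
  cycle of \<open>x\<close>. By then the level has risen by \<open>q a\<close> for \<open>q\<close> the number of points of \<open>L\<close> on the
  cycle, and \<open>k\<close> divides \<open>q a\<close> exactly if \<open>k / gcd q k\<close> divides \<open>a\<close>.
\<close>
lemma cyclic_cover_cycle:
  assumes self: "x \<in> orbit f x" and i: "i < k"
    and g_def: "g = gcd (card (orbit f x \<inter> L)) k"
  shows "(x, i) \<in> orbit (cyclic_cover k f L) (x, i)"
    and "card (orbit (cyclic_cover k f L) (x, i)) = card (orbit f x) * (k div g)"
proof -
  let ?m = "card (orbit f x)" and ?q = "card (orbit f x \<inter> L)"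
  have k: "0 < k" using i by simp
  have g: "0 < g" "g dvd k" "g dvd ?q" using k by (auto simp: g_def)
  have fin: "finite (orbit f x)" by (rule finite_orbit[OF self])
  have m: "0 < ?m" using fin orbit_nonempty[of f x] by (simp add: card_gt_0_iff)
  have iff: "(cyclic_cover k f L ^^ n) (x, i) = (x, i) \<longleftrightarrow> ?m * (k div g) dvd n" for n
  proof (cases "?m dvd n")
    case True
    then obtain a where a: "n = ?m * a" by auto
    have "(f ^^ n) x = x" using funpow_fixed_iff_card_orbit_dvd[OF self] True by simp
    then have "(cyclic_cover k f L ^^ n) (x, i) = (x, i) \<longleftrightarrow> (i + ?q * a) mod k = i"
      using cyclic_cover_funpow[OF i, where f=f and L=L and n=n and x=x] card_visits_period[OF self, of a L] a by simp
    also have "\<dots> \<longleftrightarrow> (i + ?q * a) mod k = (i + 0) mod k" using i by simp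
    also have "\<dots> \<longleftrightarrow> k dvd ?q * a"
      using mod_eq_dvd_iff_nat[of i "i + ?q * a" k] by simp
    also have "\<dots> \<longleftrightarrow> k div g dvd a"
    proof -
      have "coprime (?q div g) (k div g)"
        unfolding g_def by (rule div_gcd_coprime) (use k in auto)
      then have "coprime (k div g) (?q div g)" by (simp add: coprime_commute)
      moreover have "k dvd ?q * a \<longleftrightarrow> k div g dvd (?q div g) * a"
      proof -
        have "g * (k div g) dvd g * ((?q div g) * a) \<longleftrightarrow> k div g dvd (?q div g) * a"
          by (rule nat_mult_dvd_cancel1[OF g(1)])
        moreover have "g * (k div g) = k" using g(2) by simp
        moreover have "g * ((?q div g) * a) = ?q * a"
          using g(3) by (metis dvd_mult_div_cancel mult.assoc)
        ultimately show ?thesis by (simp only:)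
      qed
      ultimately show ?thesis by (simp add: coprime_dvd_mult_right_iff)
    qed
    also have "\<dots> \<longleftrightarrow> ?m * (k div g) dvd n" using m a by simp
    finally show ?thesis .
  next
    case False
    then show ?thesis
      using cyclic_cover_funpow[OF i, where f=f and L=L and n=n and x=x] funpow_fixed_iff_card_orbit_dvd[OF self, of n]
      by (auto dest: dvd_mult_left)
  qed
  have "0 < ?m * (k div g)" using m g k by (simp add: div_greater_zero_iff dvd_imp_le)
  from card_orbit_eqI[OF iff this]
  show "(x, i) \<in> orbit (cyclic_cover k f L) (x, i)"
    and "card (orbit (cyclic_cover k f L) (x, i)) = card (orbit f x) * (k div g)" .
qed


text \<open>
  On a cycle of the cover, all levels contain equally many points over \<open>L\<close>. Indeed, the points at
  level \<open>j + 1\<close> are the images of the points over \<open>L\<close> at level \<open>j\<close> and of the points not over \<open>L\<close> at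
  level \<open>j + 1\<close>; comparing cardinalities gives the claim. The total number of points over \<open>L\<close> is known
  from the length of the cycle, so each level has a \<open>k\<close>-th of it.
\<close>
lemma cyclic_cover_cycle_labels:
  assumes self: "x \<in> orbit f x" and i: "i < k" and j: "j < k"
    and g_def: "g = gcd (card (orbit f x \<inter> L)) k"
  shows "card (orbit (cyclic_cover k f L) (x, i) \<inter> L \<times> {j}) = card (orbit f x \<inter> L) div g"
proof -
  let ?F = "cyclic_cover k f L" and ?m = "card (orbit f x)" and ?q = "card (orbit f x \<inter> L)"
  define U where "U = orbit ?F (x, i)"
  define M where "M = ?m * (k div g)"
  have k: "0 < k" using i by simp
  have g: "0 < g" "g dvd k" "g dvd ?q" using k by (auto simp: g_def)
  have U_self: "(x, i) \<in> U" and card_U: "card U = M"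
    unfolding U_def M_def using cyclic_cover_cycle[OF self i g_def] by auto
  have fin: "finite U" using finite_orbit[of "(x, i)" ?F] U_self by (simp add: U_def)
  have F_U: "?F ` U = U"
  proof (intro equalityI subsetI)
    fix p assume "p \<in> U"
    then show "p \<in> ?F ` U"
      unfolding U_def by (induction rule: orbit.induct) (use U_self U_def in auto)
  qed (auto simp: U_def intro: orbit.step)
  have inj: "inj_on ?F U" by (rule eq_card_imp_inj_on[OF fin]) (simp add: F_U)
  have U_iter: "U = (\<lambda>n. (?F ^^ n) (x, i)) ` {0..<M}" "inj_on (\<lambda>n. (?F ^^ n) (x, i)) {0..<M}"
  proof -
    let ?d = "funpow_dist1 ?F (x, i) (x, i)"
    note * = orbit_conv_funpow_dist1[OF U_self[unfolded U_def]] inj_on_funpow_dist1[OF U_self[unfolded U_def]]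
    have "M = ?d" unfolding card_U[symmetric] U_def by (subst *(1), subst card_image[OF *(2)]) simp
    then show "U = (\<lambda>n. (?F ^^ n) (x, i)) ` {0..<M}" "inj_on (\<lambda>n. (?F ^^ n) (x, i)) {0..<M}"
      using * by (simp_all only: U_def)
  qed
  have level: "snd p < k" if "p \<in> U" for p
    using that unfolding U_iter(1) by (auto simp: cyclic_cover_funpow[OF i] k)
  define c where "c j = card {p \<in> U. fst p \<in> L \<and> snd p = j}" for j
  have step: "c (Suc j mod k) = c j" if "j < k" for j
  proof -
    let ?A = "{p \<in> U. fst p \<in> L \<and> snd p = j}" and ?j = "Suc j mod k"
    let ?B = "{p \<in> U. fst p \<notin> L \<and> snd p = ?j}" and ?D = "{p \<in> U. fst p \<in> L \<and> snd p = ?j}"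
    have "?F ` (?A \<union> ?B) = ?B \<union> ?D"
    proof (intro equalityI subsetI)
      fix p assume "p \<in> ?F ` (?A \<union> ?B)"
      moreover have "?F p \<in> U" if "p \<in> U" for p using that F_U by blast
      ultimately show "p \<in> ?B \<union> ?D" by (auto simp: cyclic_cover_def)
    next
      fix p assume p: "p \<in> ?B \<union> ?D"
      then obtain r where r: "r \<in> U" "p = ?F r" using F_U by blast
      obtain y a where ya: "r = (y, a)" by (cases r)
      have "a = j" if "Suc a mod k = Suc j mod k"
        using that level[OF r(1)] \<open>j < k\<close> ya by (auto simp: mod_Suc split: if_splits)
      then have "r \<in> ?A \<union> ?B" using p r ya by (auto simp: cyclic_cover_def split: if_splits)
      then show "p \<in> ?F ` (?A \<union> ?B)" using r by blast
    qed
    then have "card (?A \<union> ?B) = card (?B \<union> ?D)"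
      by (metis (no_types, lifting) card_image inj_on_subset[OF inj] Un_least mem_Collect_eq subsetI)
    moreover have "card (?A \<union> ?B) = card ?A + card ?B" "card (?B \<union> ?D) = card ?B + card ?D"
      by (rule card_Un_disjoint; use fin in auto)+
    ultimately show ?thesis by (simp add: c_def)
  qed
  have c0: "c j = c 0" if "j < k" for j
    using that
  proof (induction j)
    case (Suc j)
    then show ?case using step[of j] by simp
  qed simp
  have "card {p \<in> U. fst p \<in> L} = (\<Sum>j<k. c j)"
  proof -
    have "{p \<in> U. fst p \<in> L} = (\<Union>j<k. {p \<in> U. fst p \<in> L \<and> snd p = j})" using level by auto
    also have "card \<dots> = (\<Sum>j<k. card {p \<in> U. fst p \<in> L \<and> snd p = j})"
      by (rule card_UN_disjoint) (use fin in auto)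
    finally show ?thesis by (simp add: c_def)
  qed
  also have "\<dots> = (\<Sum>j<k. c 0)" by (intro sum.cong refl c0) simp
  also have "\<dots> = k * c 0" by simp
  finally have tot: "card {p \<in> U. fst p \<in> L} = k * c 0" .
  have "{p \<in> U. fst p \<in> L} = (\<lambda>n. (?F ^^ n) (x, i)) ` {n. n < M \<and> (f ^^ n) x \<in> L}"
    unfolding U_iter(1) Compr_image_eq by (simp add: cyclic_cover_funpow[OF i])
  then have "card {p \<in> U. fst p \<in> L} = card {n. n < M \<and> (f ^^ n) x \<in> L}"
    by (simp only:) (rule card_image, rule inj_on_subset[OF U_iter(2)], auto)
  also have "\<dots> = ?q * (k div g)" unfolding M_def by (rule card_visits_period[OF self])
  also have "\<dots> = k * (?q div g)" using g by (metis dvd_div_mult div_mult_swap mult.commute)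
  finally have "c 0 = ?q div g" using tot k by simp
  moreover have "U \<inter> L \<times> {j} = {p \<in> U. fst p \<in> L \<and> snd p = j}" by auto
  ultimately show ?thesis using c0[OF j] by (simp add: c_def U_def)
qed

text \<open>
  The cycles above \<open>C\<close> partition \<open>C \<times> {..<k}\<close> and all have the same length.
\<close>
lemma num_cycles_over:
  assumes self: "\<And>y. y \<in> C \<Longrightarrow> y \<in> orbit f y" and C: "C = orbit f x" and x: "x \<in> C" and k: "0 < k"
  shows "card (orbit (cyclic_cover k f L) ` (C \<times> {..<k})) = gcd (card (C \<inter> L)) k"
proof -
  let ?F = "cyclic_cover k f L" and ?g = "gcd (card (C \<inter> L)) k"
  let ?P = "orbit ?F ` (C \<times> {..<k})"
  have fin: "finite C" using finite_orbit[of x f] x C by simp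
  have m: "0 < card C" using fin x by (auto simp: card_gt_0_iff)
  have g: "0 < ?g" "?g dvd k" using k by auto
  have orb: "orbit f y = C" if "y \<in> C" for y
    using orbit_eq_if_mem[of x f y] x that C by simp
  have U: "p \<in> orbit ?F p" "card (orbit ?F p) = card C * (k div ?g)" if "p \<in> C \<times> {..<k}" for p
  proof -
    obtain y i where p: "p = (y, i)" by (cases p)
    have "y \<in> C" "i < k" using that p by auto
    then show "p \<in> orbit ?F p" "card (orbit ?F p) = card C * (k div ?g)"
      using cyclic_cover_cycle[of y f i k _ L, OF self[OF \<open>y \<in> C\<close>] \<open>i < k\<close> refl] orb[OF \<open>y \<in> C\<close>] by (simp_all add: p)
  qed
  have sub: "orbit ?F p \<subseteq> C \<times> {..<k}" if "p \<in> C \<times> {..<k}" for p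
  proof
    fix z assume "z \<in> orbit ?F p"
    then show "z \<in> C \<times> {..<k}"
      by induction (use that C k in \<open>auto simp: cyclic_cover_def intro: orbit.step\<close>)
  qed
  have "card (\<Union>?P) = sum card ?P"
  proof (rule card_Union_disjoint)
    show "finite A" if "A \<in> ?P" for A
      using that U(1) finite_orbit by fastforce
    show "pairwise disjnt ?P"
    proof (rule pairwiseI, rule ccontr)
      fix A B assume AB: "A \<in> ?P" "B \<in> ?P" "A \<noteq> B"
      assume "\<not> disjnt A B"
      then obtain z where z: "z \<in> A" "z \<in> B" by (auto simp: disjnt_def)
      have "orbit ?F z = D" if D: "D \<in> ?P" "z \<in> D" for D
      proof -
        obtain p where "p \<in> C \<times> {..<k}" "D = orbit ?F p" using D by auto
        then show ?thesis using orbit_eq_if_mem[OF U(1)] D by metis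
      qed
      then show False using AB z by metis
    qed
  qed
  moreover have "\<Union>?P = C \<times> {..<k}" using U(1) sub by blast
  moreover have "sum card ?P = card ?P * (card C * (k div ?g))"
    using U(2) by (subst sum.cong[OF refl, of _ _ "\<lambda>_. card C * (k div ?g)"]) auto
  ultimately have "card C * k = card ?P * (card C * (k div ?g))" by (simp add: card_cartesian_product)
  also have "\<dots> = card C * (card ?P * (k div ?g))" by simp
  finally have "card ?P * (k div ?g) = k" using m by simp
  also have "\<dots> = ?g * (k div ?g)" using g(2) by simp
  finally have "card ?P * (k div ?g) = ?g * (k div ?g)" .
  moreover have "0 < k div ?g" using g k by (simp add: div_greater_zero_iff dvd_imp_le)
  ultimately show ?thesis by (metis mult_right_cancel not_gr_zero)
qed

text \<open>
  A cycle with \<open>q\<close> points in \<open>L\<close> and \<open>l\<close> outside has \<open>g = gcd q k\<close> cycles above it. Each has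
  \<open>(q + l) k / g\<close> points, of which \<open>q / g\<close> are over \<open>L\<close> at level \<open>j\<close>; the remaining number is
  \<open>(k / g) l + (q / g) (k - 1)\<close>.
\<close>
lemma num_cycles_cyclic_cover:
  assumes fin: "finite X" and closed: "\<And>x. x \<in> X \<Longrightarrow> f x \<in> X"
    and self: "\<And>x. x \<in> X \<Longrightarrow> x \<in> orbit f x" and j: "j < k"
  shows "num_cycles (cyclic_cover k f L) (X \<times> {..<k}) (L \<times> {j}) n m
    = (\<Sum>C | C \<in> cycles f X \<and>
          (let q = card (C \<inter> L); l = card (C - L); g = gcd q k in
             (n, m) = (q div g, (k div g) * l + (q div g) * (k - 1))). gcd (card (C \<inter> L)) k)"
proof -
  let ?F = "cyclic_cover k f L" and ?L = "L \<times> {j}"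
  let ?good = "\<lambda>C. let q = card (C \<inter> L); l = card (C - L); g = gcd q k in
             (n, m) = (q div g, (k div g) * l + (q div g) * (k - 1))"
  let ?P = "\<lambda>C. orbit ?F ` (C \<times> {..<k})"
  have k: "0 < k" using j by simp
  have sub: "C \<subseteq> X" if C: "C \<in> cycles f X" for C
  proof
    fix z assume z: "z \<in> C"
    obtain x where x: "x \<in> X" "C = orbit f x" using C by auto
    show "z \<in> X" using z unfolding x(2) by induction (use x(1) closed in auto)
  qed
  have orb: "orbit f y = C" "y \<in> orbit f y" if C: "C \<in> cycles f X" and y: "y \<in> C" for C y
  proof -
    obtain x where x: "x \<in> X" "C = orbit f x" using C by auto
    show "orbit f y = C" using orbit_eq_if_mem[OF self[OF x(1)]] y x(2) by simp
    show "y \<in> orbit f y" using sub[OF C] y self by blast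
  qed
  have U: "card (U \<inter> ?L) = n \<and> card (U - ?L) = m \<longleftrightarrow> ?good C" "fst ` U \<subseteq> C" "U \<noteq> {}"
    if C: "C \<in> cycles f X" and UP: "U \<in> ?P C" for C U
  proof -
    obtain y i where y: "y \<in> C" "i < k" "U = orbit ?F (y, i)" using UP by auto
    let ?q = "card (C \<inter> L)" let ?g = "gcd ?q k"
    have finC: "finite C" using sub[OF C] fin finite_subset by blast
    have g: "0 < ?g" "?g dvd k" "?g dvd ?q" using k by auto
    note [simp] = orb(1)[OF C y(1)]
    note self_U = cyclic_cover_cycle[OF orb(2)[OF C y(1)] y(2) refl, of L, folded y(3), simplified]
    have lab: "card (U \<inter> ?L) = ?q div ?g"
      using cyclic_cover_cycle_labels[OF orb(2)[OF C y(1)] y(2) j refl, of L] y by simp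
    have finU: "finite U" using self_U(1) unfolding y(3) by (rule finite_orbit)
    have "card U = card (U \<inter> ?L) + card (U - ?L)" using finU by (metis card_Int_Diff)
    then have "card (U - ?L) = card C * (k div ?g) - ?q div ?g" using lab self_U(2) by simp
    also have "card C = ?q + card (C - L)" by (rule card_Int_Diff[OF finC])
    also have "(?q + card (C - L)) * (k div ?g) - ?q div ?g
        = (k div ?g) * card (C - L) + (?q * (k div ?g) - ?q div ?g)"
    proof -
      have "0 < k div ?g" using g k by (simp add: div_greater_zero_iff dvd_imp_le)
      then have "?q div ?g \<le> ?q * (k div ?g)"
        by (metis div_le_dividend le_trans mult_le_mono2 mult.right_neutral Suc_leI One_nat_def)
      then show ?thesis by (simp add: algebra_simps)
    qed
    also have "?q * (k div ?g) = (?q div ?g) * k"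
      using g by (metis dvd_div_mult div_mult_swap)
    also have "\<dots> - ?q div ?g = (?q div ?g) * (k - 1)"
      by (simp add: right_diff_distrib')
    finally have arr: "card (U - ?L) = (k div ?g) * card (C - L) + (?q div ?g) * (k - 1)" .
    show "card (U \<inter> ?L) = n \<and> card (U - ?L) = m \<longleftrightarrow> ?good C"
      unfolding lab arr Let_def by auto
    have "fst p \<in> C" if "p \<in> U" for p
      using that unfolding y(3)
    proof induction
      case base
      then show ?case using orbit.base[of f y] by (simp add: cyclic_cover_def)
    next
      case (step p)
      have "f (fst p) \<in> C" using step.IH orbit.step[of "fst p" f y] by simp
      then show ?case by (simp add: cyclic_cover_def case_prod_beta)
    qed
    then show "fst ` U \<subseteq> C" by auto
    show "U \<noteq> {}" using y orbit_nonempty by metis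
  qed
  have "{U \<in> cycles ?F (X \<times> {..<k}). card (U \<inter> ?L) = n \<and> card (U - ?L) = m}
      = (\<Union>C \<in> {C \<in> cycles f X. ?good C}. ?P C)"
  proof (intro equalityI subsetI)
    fix U assume U': "U \<in> {U \<in> cycles ?F (X \<times> {..<k}). card (U \<inter> ?L) = n \<and> card (U - ?L) = m}"
    then obtain y i where y: "y \<in> X" "i < k" "U = orbit ?F (y, i)" by auto
    have *: "orbit f y \<in> cycles f X" "U \<in> ?P (orbit f y)" using y self by auto
    have "?good (orbit f y)" using U(1)[OF *] U' by blast
    then show "U \<in> (\<Union>C \<in> {C \<in> cycles f X. ?good C}. ?P C)" using * by blast
  next
    fix U assume "U \<in> (\<Union>C \<in> {C \<in> cycles f X. ?good C}. ?P C)"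
    then obtain C where C: "C \<in> cycles f X" "?good C" "U \<in> ?P C" by blast
    then have "U \<in> cycles ?F (X \<times> {..<k})" using sub by blast
    then show "U \<in> {U \<in> cycles ?F (X \<times> {..<k}). card (U \<inter> ?L) = n \<and> card (U - ?L) = m}"
      using U(1)[OF C(1,3)] C(2) by blast
  qed
  then have "num_cycles ?F (X \<times> {..<k}) ?L n m = card (\<Union>C \<in> {C \<in> cycles f X. ?good C}. ?P C)"
    by (simp add: num_cycles_def)
  also have "\<dots> = (\<Sum>C \<in> {C \<in> cycles f X. ?good C}. card (?P C))"
  proof (rule card_UN_disjoint)
    show "finite {C \<in> cycles f X. ?good C}" using fin by simp
    show "\<forall>C\<in>{C \<in> cycles f X. ?good C}. finite (?P C)"
      using finite_subset[OF sub fin] by simp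
    have "C = D" if *: "C \<in> cycles f X" "D \<in> cycles f X" "U \<in> ?P C" "U \<in> ?P D" for C D U
    proof -
      obtain p where "p \<in> U" using U(3)[OF *(1,3)] by blast
      then have "fst p \<in> C" "fst p \<in> D" using U(2)[OF *(1,3)] U(2)[OF *(2,4)] by auto
      then show ?thesis using orb(1)[OF *(1)] orb(1)[OF *(2)] by metis
    qed
    then show "\<forall>C\<in>{C \<in> cycles f X. ?good C}. \<forall>D\<in>{C \<in> cycles f X. ?good C}. C \<noteq> D \<longrightarrow> ?P C \<inter> ?P D = {}"
      by (metis (no_types, lifting) disjoint_iff mem_Collect_eq)
  qed
  also have "\<dots> = (\<Sum>C \<in> {C \<in> cycles f X. ?good C}. gcd (card (C \<inter> L)) k)"
  proof (rule sum.cong[OF refl])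
    fix C assume "C \<in> {C \<in> cycles f X. ?good C}"
    then have C: "C \<in> cycles f X" by simp
    then obtain x where x: "x \<in> X" "C = orbit f x" by auto
    show "card (?P C) = gcd (card (C \<inter> L)) k"
      by (rule num_cycles_over[OF orb(2)[OF C] x(2) _ k]) (use x self in auto)
  qed
  finally show ?thesis .
qed

text \<open>
  For \<open>L = lcm q k\<close> one has \<open>L / k = q / gcd q k\<close> and \<open>L / q = k / gcd q k\<close>, which turns the type found
  above into the condition of \<^const>\<open>S_rep\<close>. Cycles that avoid \<open>L\<close> drop out because \<open>n\<close> is
  positive.
\<close>
corollary num_cycles_cyclic_cover_S_rep:
  assumes fin: "finite X" and closed: "\<And>x. x \<in> X \<Longrightarrow> f x \<in> X"
    and self: "\<And>x. x \<in> X \<Longrightarrow> x \<in> orbit f x" and j: "j < k" and n: "0 < n"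
  shows "num_cycles (cyclic_cover k f L) (X \<times> {..<k}) (L \<times> {j}) n m
    = (\<Sum>(q, l) \<in> S_rep k n m. gcd q k * num_cycles f X L q l)"
proof -
  let ?ty = "\<lambda>C. (card (C \<inter> L), card (C - L))"
  have S: "(q, l) \<in> S_rep k n m \<longleftrightarrow>
      (let g = gcd q k in (n, m) = (q div g, (k div g) * l + (q div g) * (k - 1)))" for q l
  proof (cases "q = 0")
    case False
    have k: "0 < k" using j by simp
    have "lcm q k = q * (k div gcd q k)" "lcm q k = k * (q div gcd q k)"
      by (simp_all add: lcm_nat_def div_mult_swap mult.commute)
    then have "lcm q k div k = q div gcd q k" "lcm q k div q = k div gcd q k"
      using False k by (metis nonzero_mult_div_cancel_left not_gr_zero)+
    then show ?thesis using False by (simp add: S_rep_def Let_def)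
  qed (use n in \<open>auto simp: S_rep_def\<close>)
  let ?A = "{C \<in> cycles f X. ?ty C \<in> S_rep k n m}"
  have "num_cycles (cyclic_cover k f L) (X \<times> {..<k}) (L \<times> {j}) n m = (\<Sum>C \<in> ?A. gcd (card (C \<inter> L)) k)"
    by (subst num_cycles_cyclic_cover[where f = f and X = X, OF fin closed self j]) (simp_all only: S Let_def)
  also have "\<dots> = (\<Sum>y \<in> S_rep k n m. \<Sum>C | C \<in> ?A \<and> ?ty C = y. gcd (card (C \<inter> L)) k)"
    by (rule sum.group[symmetric]) (use fin j finite_S_rep in auto)
  also have "\<dots> = (\<Sum>(q, l) \<in> S_rep k n m. gcd q k * num_cycles f X L q l)"
  proof (intro sum.cong refl, clarify)
    fix q l assume "(q, l) \<in> S_rep k n m"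
    then have "{C. C \<in> ?A \<and> ?ty C = (q, l)} = {C \<in> cycles f X. card (C \<inter> L) = q \<and> card (C - L) = l}"
      by auto
    then show "(\<Sum>C | C \<in> ?A \<and> ?ty C = (q, l). gcd (card (C \<inter> L)) k) = gcd q k * num_cycles f X L q l"
      by (simp add: num_cycles_def)
  qed
  finally show ?thesis .
qed

corollary num_cycles_cyclic_cover_0:
  assumes fin: "finite X" and closed: "\<And>x. x \<in> X \<Longrightarrow> f x \<in> X"
    and self: "\<And>x. x \<in> X \<Longrightarrow> x \<in> orbit f x" and j: "j < k"
  shows "num_cycles (cyclic_cover k f L) (X \<times> {..<k}) (L \<times> {j}) 0 l = k * num_cycles f X L 0 l"
proof -
  have "(let g = gcd q k in (0, l) = (q div g, (k div g) * l' + (q div g) * (k - 1))) \<longleftrightarrow> q = 0 \<and> l' = l" for q l'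
  proof (cases "q = 0")
    case False
    then have "\<not> q < gcd q k" by (metis gcd_le1_nat not_less)
    then show ?thesis using False by (simp add: Let_def div_eq_0_iff)
  qed (use j in auto)
  then show ?thesis
    by (subst num_cycles_cyclic_cover[where f = f and X = X, OF fin closed self j]) (simp_all add: num_cycles_def Let_def)
qed

section \<open>Ideals generated by paths of length two\<close>

lemma keys_pa_multE:
  assumes "z \<in> Poly_Mapping.keys (pa_mult Q f g)"
  obtains x y where "x \<in> Poly_Mapping.keys f" "y \<in> Poly_Mapping.keys g" "path_end Q x = fst y"
    "z = (fst x, snd x @ snd y)"
proof -
  have "Poly_Mapping.lookup (pa_mult Q f g) z \<noteq> 0" using assms by (simp add: in_keys_iff)
  then obtain x where x: "x \<in> Poly_Mapping.keys f" "Poly_Mapping.lookup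
      (\<Sum>y\<in>Poly_Mapping.keys g. if path_end Q x = fst y
        then Poly_Mapping.single (fst x, snd x @ snd y)
          (Poly_Mapping.lookup f x * Poly_Mapping.lookup g y) else 0) z \<noteq> 0"
    unfolding pa_mult_def lookup_sum by (meson sum.neutral)
  then obtain y where y: "y \<in> Poly_Mapping.keys g" "Poly_Mapping.lookup
      (if path_end Q x = fst y then Poly_Mapping.single (fst x, snd x @ snd y)
          (Poly_Mapping.lookup f x * Poly_Mapping.lookup g y) else 0) z \<noteq> 0"
    unfolding lookup_sum by (meson sum.neutral)
  then have "path_end Q x = fst y" "z = (fst x, snd x @ snd y)"
    by (auto simp: lookup_single when_def split: if_splits)
  then show thesis using that x(1) y(1) by blast
qed

lemma arrow_path_iff:
  assumes "wf_digraph Q"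
  shows "arrow_path Q p \<longleftrightarrow>
    p \<noteq> [] \<and> set p \<subseteq> arcs Q \<and> successively (\<lambda>a b. head Q a = tail Q b) p"
proof -
  interpret wf_digraph Q by fact
  have cas: "(\<exists>v. cas (tail Q (hd p)) p v) \<longleftrightarrow> successively (\<lambda>a b. head Q a = tail Q b) p"
    if "p \<noteq> []" for p
    using that
  proof (induction p rule: induct_list012)
    case (3 a b p)
    then show ?case by auto
  qed auto
  show ?thesis
  proof (cases "p = []")
    case False
    have "tail Q (hd p) \<in> verts Q" if "set p \<subseteq> arcs Q"
      using that False by (meson hd_in_set subsetD tail_in_verts)
    then show ?thesis using False cas[OF False] by (auto simp: arrow_path_def paths_def awalk_def)
  qed (simp add: arrow_path_def)
qed

lemma ideal_generated_ideal:
  fixes R :: "'a list set"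
  assumes "fin_digraph Q" "R \<subseteq> {p. arrow_path Q p \<and> length p = 2}"
  shows "ideal (generated_ideal Q R :: (('v, 'a) qpath \<Rightarrow>\<^sub>0 'k::field) set) (path_algebra Q)"
    and "arrows_elem Q ` R \<subseteq> (generated_ideal Q R :: (('v, 'a) qpath \<Rightarrow>\<^sub>0 'k::field) set)"
proof -
  interpret ring "path_algebra Q :: (('v, 'a) qpath \<Rightarrow>\<^sub>0 'k) ring"
    by (rule ring_path_algebra[OF assms(1)])
  have sub: "arrows_elem Q ` R \<subseteq> carrier (path_algebra Q :: (('v, 'a) qpath \<Rightarrow>\<^sub>0 'k) ring)"
    using assms(2) by (auto simp: arrows_elem_def path_algebra_def arrow_path_def)
  show "ideal (generated_ideal Q R :: (('v, 'a) qpath \<Rightarrow>\<^sub>0 'k::field) set) (path_algebra Q)"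
    unfolding generated_ideal_def by (rule genideal_ideal[OF sub])
  show "arrows_elem Q ` R \<subseteq> (generated_ideal Q R :: (('v, 'a) qpath \<Rightarrow>\<^sub>0 'k::field) set)"
    unfolding generated_ideal_def by (rule genideal_self[OF sub])
qed

text \<open>
  The elements supported on paths of length at least two, and in length two only on \<open>R\<close>, form an ideal:
  a product with a path of positive length has length at least three.
\<close>
lemma pair_in_generated_ideal_iff:
  fixes R :: "'a list set"
  assumes Q: "fin_digraph Q" and R: "R \<subseteq> {p. arrow_path Q p \<and> length p = 2}"
  shows "arrows_elem Q [a, b] \<in> (generated_ideal Q R :: (('v, 'a) qpath \<Rightarrow>\<^sub>0 'k::field) set)
    \<longleftrightarrow> [a, b] \<in> R"
proof
  assume "[a, b] \<in> R"
  then show "arrows_elem Q [a, b] \<in> (generated_ideal Q R :: (('v, 'a) qpath \<Rightarrow>\<^sub>0 'k) set)"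
    using ideal_generated_ideal(2)[OF Q R] by blast
next
  let ?A = "path_algebra Q :: (('v, 'a) qpath \<Rightarrow>\<^sub>0 'k) ring"
  interpret ring ?A by (rule ring_path_algebra[OF Q])
  define T :: "(('v, 'a) qpath \<Rightarrow>\<^sub>0 'k) set" where
    "T = {f. Poly_Mapping.keys f \<subseteq> paths Q \<and>
      (\<forall>x \<in> Poly_Mapping.keys f. 2 \<le> length (snd x) \<and> (length (snd x) = 2 \<longrightarrow> snd x \<in> R))}"
  have "ideal T ?A"
  proof (rule idealI)
    show "ring ?A" by (rule ring_axioms)
    show "subgroup T (add_monoid ?A)"
    proof (rule group.subgroupI)
      show "Group.group (add_monoid ?A)" by (rule a_group)
      show "T \<subseteq> carrier (add_monoid ?A)" by (auto simp: T_def path_algebra_def)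
      show "T \<noteq> {}" by (auto simp: T_def intro!: exI[of _ 0])
      show "inv\<^bsub>add_monoid ?A\<^esub> f \<in> T" if "f \<in> T" for f
      proof -
        have "\<ominus>\<^bsub>?A\<^esub> f = - f"
          by (rule minus_equality) (use that in \<open>auto simp: T_def path_algebra_def\<close>)
        then show ?thesis using that by (auto simp: a_inv_def T_def)
      qed
      show "f \<otimes>\<^bsub>add_monoid ?A\<^esub> g \<in> T" if "f \<in> T" "g \<in> T" for f g
        using that Poly_Mapping.keys_add[of f g] by (fastforce simp: T_def path_algebra_def)
    qed
    fix f g assume f: "f \<in> T" and g: "g \<in> carrier ?A"
    have len: "2 \<le> length (snd z) \<and> (length (snd z) = 2 \<longrightarrow> snd z \<in> R)"
      if z: "z \<in> Poly_Mapping.keys (pa_mult Q f g) \<or> z \<in> Poly_Mapping.keys (pa_mult Q g f)" for z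
    proof -
      obtain x y where xy: "snd z = snd x @ snd y" "x \<in> Poly_Mapping.keys f \<or> y \<in> Poly_Mapping.keys f"
        using z by (elim disjE keys_pa_multE) auto
      from xy(2) show ?thesis
      proof
        assume "x \<in> Poly_Mapping.keys f"
        then have "2 \<le> length (snd x)" "length (snd x) = 2 \<longrightarrow> snd x \<in> R" using f by (auto simp: T_def)
        then show ?thesis unfolding xy(1) by (cases "snd y") auto
      next
        assume "y \<in> Poly_Mapping.keys f"
        then have "2 \<le> length (snd y)" "length (snd y) = 2 \<longrightarrow> snd y \<in> R" using f by (auto simp: T_def)
        then show ?thesis unfolding xy(1) by (cases "snd x") auto
      qed
    qed
    have keys: "Poly_Mapping.keys f \<subseteq> paths Q" "Poly_Mapping.keys g \<subseteq> paths Q"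
      using f g by (auto simp: T_def path_algebra_def)
    show "g \<otimes>\<^bsub>?A\<^esub> f \<in> T"
      using pa_mult_closed[OF Q keys(2,1)] len by (simp add: T_def path_algebra_def)
    show "f \<otimes>\<^bsub>?A\<^esub> g \<in> T"
      using pa_mult_closed[OF Q keys] len by (simp add: T_def path_algebra_def)
  qed
  moreover have "arrows_elem Q ` R \<subseteq> T"
    using R by (auto simp: T_def arrows_elem_def arrow_path_def)
  ultimately have "generated_ideal Q R \<subseteq> T"
    unfolding generated_ideal_def by (rule genideal_minimal)
  moreover assume "arrows_elem Q [a, b] \<in> (generated_ideal Q R :: (('v, 'a) qpath \<Rightarrow>\<^sub>0 'k) set)"
  ultimately have "(arrows_elem Q [a, b] :: ('v, 'a) qpath \<Rightarrow>\<^sub>0 'k) \<in> T" by blast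
  then show "[a, b] \<in> R" by (simp add: T_def arrows_elem_def)
qed

text \<open>
  If a factor of length two lies in the ideal, then so does the whole path.
\<close>
lemma path_in_imp_successively:
  fixes J :: "(('v, 'a) qpath \<Rightarrow>\<^sub>0 'k::field) set"
  assumes Q: "fin_digraph Q" and J: "ideal J (path_algebra Q)" and w: "path_in Q J w"
  shows "w \<noteq> []" "set w \<subseteq> arcs Q"
    "successively (\<lambda>a b. head Q a = tail Q b \<and> arrows_elem Q [a, b] \<notin> J) w"
proof -
  interpret fin_digraph Q by fact
  interpret J: ideal J "path_algebra Q" by fact
  have ap: "arrow_path Q w" and notin: "arrows_elem Q w \<notin> J" using w by (auto simp: path_in_def)
  then have succ: "successively (\<lambda>a b. head Q a = tail Q b) w"
    and "w \<noteq> []" "set w \<subseteq> arcs Q" using arrow_path_iff[OF wf_digraph] by auto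
  then show "w \<noteq> []" "set w \<subseteq> arcs Q" by auto
  have "arrows_elem Q [w ! i, w ! Suc i] \<notin> J" if i: "Suc i < length w" for i
  proof
    let ?a = "w ! i" and ?b = "w ! Suc i" and ?u = "take i w" and ?v = "drop (Suc (Suc i)) w"
    assume in_J: "arrows_elem Q [?a, ?b] \<in> J"
    have split: "w = ?u @ [?a, ?b] @ ?v"
      using i by (simp add: Cons_nth_drop_Suc)
    obtain z where "awalk (tail Q (hd w)) w z" using ap by (auto simp: arrow_path_def paths_def)
    then have walk: "awalk (tail Q (hd w)) (?u @ [?a, ?b] @ ?v) z" using split by simp
    then obtain y where y: "awalk (tail Q (hd w)) ?u y" "awalk y ([?a, ?b] @ ?v) z"
      by (auto simp: awalk_append_iff)
    have y': "y = tail Q ?a" "awalk (head Q ?b) ?v z"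
      using y(2) by (auto simp: awalk_Cons_iff)
    let ?U = "Poly_Mapping.single (tail Q (hd w), ?u) (1::'k)"
    let ?V = "Poly_Mapping.single (head Q ?b, ?v) (1::'k)"
    have carr: "?U \<in> carrier (path_algebra Q)" "?V \<in> carrier (path_algebra Q)"
      using y(1) y'(2) by (auto simp: path_algebra_def paths_def)
    have end_u: "path_end Q (tail Q (hd w), ?u) = tail Q ?a"
      using y(1) y'(1) by (cases ?u rule: rev_cases) (auto simp: path_end_def awalk_Nil_iff)
    have "pa_mult Q ?U (pa_mult Q (arrows_elem Q [?a, ?b]) ?V) = arrows_elem Q w"
      unfolding arrows_elem_def using end_u
      by (simp add: pa_mult_single path_end_def[of Q "(_, [_, _])"] split[symmetric, simplified])
    moreover have "pa_mult Q ?U (pa_mult Q (arrows_elem Q [?a, ?b]) ?V) \<in> J"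
      using J.I_l_closed[OF J.I_r_closed[OF in_J carr(2)] carr(1)]
      by (simp add: path_algebra_def)
    ultimately show False using notin by simp
  qed
  with succ show "successively (\<lambda>a b. head Q a = tail Q b \<and> arrows_elem Q [a, b] \<notin> J) w"
    by (auto simp: successively_conv_nth)
qed


section \<open>The blossoming as a permutation\<close>

text \<open>
  A blossomed quiver without isolated vertices. At an isolated vertex two of the antipaths \<open>\<delta>\<^sub>p\<close> would
  be the same trivial path, and an AG-orbit, which is a set of antipaths, would have the wrong size.
\<close>
locale blossomed_quiver =
  fixes Q :: "('v, 'a) pre_digraph"
    and I :: "(('v, 'a) qpath \<Rightarrow>\<^sub>0 'k::field) set"
    and J :: "(('v bl_vertex, ('v, 'a) bl_arrow) qpath \<Rightarrow>\<^sub>0 'k) set"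
    and s t :: "nat \<Rightarrow> 'v bl_vertex"
  assumes blossoming: "blossoming Q I J s t"
    and not_isolated: "v \<in> verts Q \<Longrightarrow> \<exists>a \<in> arcs Q. tail Q a = v \<or> head Q a = v"
begin

abbreviation B where "B \<equiv> bl_quiver Q"
definition D where "D = {1..bl_number Q}"
abbreviation \<sigma> where "\<sigma> \<equiv> source_arrow Q s"
abbreviation \<tau> where "\<tau> \<equiv> sink_arrow Q t"

lemma locally_gentle_B: "locally_gentle B J"
  using blossoming by (simp add: blossoming_def bl_ideal_def)

lemma fin_B: "fin_digraph B"
  using locally_gentle_B by (simp add: locally_gentle_def)

sublocale B: fin_digraph B by (rule fin_B)

lemma ideal_J: "ideal J (path_algebra B)"
  using locally_gentle_B ideal_generated_ideal(1)[OF fin_B] unfolding locally_gentle_def by blast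

lemma B_simps [simp]:
  "OldA a \<in> arcs B \<longleftrightarrow> a \<in> arcs Q"
  "InA v i \<in> arcs B \<longleftrightarrow> v \<in> verts Q \<and> i < 2 - in_degree Q v"
  "OutA v i \<in> arcs B \<longleftrightarrow> v \<in> verts Q \<and> i < 2 - out_degree Q v"
  "OldV v \<in> verts B \<longleftrightarrow> v \<in> verts Q"
  "tail B (OldA a) = OldV (tail Q a)" "head B (OldA a) = OldV (head Q a)"
  "tail B (InA v i) = SrcV v i" "head B (InA v i) = OldV v"
  "tail B (OutA v i) = OldV v" "head B (OutA v i) = SnkV v i"
  by (auto simp: bl_quiver_def new_sources_def new_sinks_def)

sublocale Q: fin_digraph Q
proof
  show "tail Q e \<in> verts Q" "head Q e \<in> verts Q" if "e \<in> arcs Q" for e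
    using B.tail_in_verts[of "OldA e"] B.head_in_verts[of "OldA e"] that by auto
  have "finite (OldV ` verts Q)" "finite (OldA ` arcs Q :: ('v, 'a) bl_arrow set)"
    by (rule finite_subset[OF _ B.finite_verts] finite_subset[OF _ B.finite_arcs]; auto)+
  then show "finite (verts Q)" "finite (arcs Q)"
    by (auto dest!: finite_imageD simp: inj_on_def)
qed

text \<open>
  The blossoming adds arrows until both degrees are at least two, and local gentleness bounds them by
  two.
\<close>
lemma card_in_arcs: "card (in_arcs B (OldV v)) = 2" if "v \<in> verts Q"
proof -
  have "in_arcs B (OldV v) = OldA ` in_arcs Q v \<union> InA v ` {..<2 - in_degree Q v}"
  proof (intro equalityI subsetI)
    fix a assume "a \<in> in_arcs B (OldV v)"
    then show "a \<in> OldA ` in_arcs Q v \<union> InA v ` {..<2 - in_degree Q v}"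
      by (cases a) (auto simp: in_arcs_def)
  qed (auto simp: in_arcs_def that)
  also have "card \<dots> = card (OldA ` in_arcs Q v :: ('v, 'a) bl_arrow set) + card (InA v ` {..<2 - in_degree Q v} :: ('v, 'a) bl_arrow set)"
    by (rule card_Un_disjoint) (auto simp: in_arcs_def)
  also have "\<dots> = in_degree Q v + (2 - in_degree Q v)"
    by (simp add: card_image inj_on_def in_degree_def)
  finally have "card (in_arcs B (OldV v)) = in_degree Q v + (2 - in_degree Q v)" .
  moreover have "card (in_arcs B (OldV v)) \<le> 2"
    using locally_gentle_B that by (auto simp: locally_gentle_def in_degree_def)
  ultimately show ?thesis by simp
qed

lemma card_out_arcs: "card (out_arcs B (OldV v)) = 2" if "v \<in> verts Q"
proof -
  have "out_arcs B (OldV v) = OldA ` out_arcs Q v \<union> OutA v ` {..<2 - out_degree Q v}"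
  proof (intro equalityI subsetI)
    fix a assume "a \<in> out_arcs B (OldV v)"
    then show "a \<in> OldA ` out_arcs Q v \<union> OutA v ` {..<2 - out_degree Q v}"
      by (cases a) (auto simp: out_arcs_def)
  qed (auto simp: out_arcs_def that)
  also have "card \<dots> = card (OldA ` out_arcs Q v :: ('v, 'a) bl_arrow set) + card (OutA v ` {..<2 - out_degree Q v} :: ('v, 'a) bl_arrow set)"
    by (rule card_Un_disjoint) (auto simp: out_arcs_def)
  also have "\<dots> = out_degree Q v + (2 - out_degree Q v)"
    by (simp add: card_image inj_on_def out_degree_def)
  finally have "card (out_arcs B (OldV v)) = out_degree Q v + (2 - out_degree Q v)" .
  moreover have "card (out_arcs B (OldV v)) \<le> 2"
    using locally_gentle_B that by (auto simp: locally_gentle_def out_degree_def)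
  ultimately show ?thesis by simp
qed

lemma finite_D: "finite D" by (simp add: D_def)

lemma bij_s: "bij_betw s D (new_sources Q)" and bij_t: "bij_betw t D (new_sinks Q)"
  using blossoming by (auto simp: blossoming_def bl_labeling_def D_def)

lemmas inj_s = bij_betw_imp_inj_on[OF bij_s] and inj_t = bij_betw_imp_inj_on[OF bij_t]

lemma source_arrow:
  assumes "p \<in> D"
  shows "\<sigma> p \<in> arcs B" "tail B (\<sigma> p) = s p" "\<exists>v i. \<sigma> p = InA v i"
proof -
  have "s p \<in> new_sources Q" using assms bij_s by (auto simp: bij_betw_def)
  then obtain v i where vi: "s p = SrcV v i" "v \<in> verts Q" "i < 2 - in_degree Q v"
    by (auto simp: new_sources_def)
  have "a = InA v i" if "a \<in> arcs B" "tail B a = s p" for a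
    using that vi by (cases a) auto
  then have "\<sigma> p = InA v i" unfolding source_arrow_def by (intro the_equality) (auto simp: vi)
  then show "\<sigma> p \<in> arcs B" "tail B (\<sigma> p) = s p" "\<exists>v i. \<sigma> p = InA v i" using vi by auto
qed

lemma sink_arrow:
  assumes "p \<in> D"
  shows "\<tau> p \<in> arcs B" "head B (\<tau> p) = t p" "\<exists>v i. \<tau> p = OutA v i"
proof -
  have "t p \<in> new_sinks Q" using assms bij_t by (auto simp: bij_betw_def)
  then obtain v i where vi: "t p = SnkV v i" "v \<in> verts Q" "i < 2 - out_degree Q v"
    by (auto simp: new_sinks_def)
  have "a = OutA v i" if "a \<in> arcs B" "head B a = t p" for a
    using that vi by (cases a) auto
  then have "\<tau> p = OutA v i" unfolding sink_arrow_def by (intro the_equality) (auto simp: vi)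
  then show "\<tau> p \<in> arcs B" "head B (\<tau> p) = t p" "\<exists>v i. \<tau> p = OutA v i" using vi by auto
qed

lemma sigma_neq_OldA: "p \<in> D \<Longrightarrow> \<sigma> p \<noteq> OldA a" "p \<in> D \<Longrightarrow> OldA a \<noteq> \<sigma> p"
  using source_arrow(3)[of p] by auto

lemma inj_sigma: "inj_on \<sigma> D"
  by (rule inj_onI) (metis source_arrow(2) inj_onD inj_s)

lemma source_arrow_surj:
  assumes "InA v i \<in> arcs B"
  obtains p where "p \<in> D" "\<sigma> p = InA v i"
proof -
  have "SrcV v i \<in> s ` D"
    using assms bij_s by (auto simp: bij_betw_def new_sources_def)
  then obtain p where p: "p \<in> D" "s p = SrcV v i" by auto
  then have "\<sigma> p = InA v i" using source_arrow[OF p(1)] by auto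
  then show thesis using that p by blast
qed

lemma tau_neq_OldA: "p \<in> D \<Longrightarrow> \<tau> p \<noteq> OldA a" "p \<in> D \<Longrightarrow> OldA a \<noteq> \<tau> p"
  using sink_arrow(3)[of p] by auto

lemma inj_tau: "inj_on \<tau> D"
  by (rule inj_onI) (metis sink_arrow(2) inj_onD inj_t)

lemma sink_arrow_surj:
  assumes "OutA v i \<in> arcs B"
  obtains p where "p \<in> D" "\<tau> p = OutA v i"
proof -
  have "SnkV v i \<in> t ` D"
    using assms bij_t by (auto simp: bij_betw_def new_sinks_def)
  then obtain p where p: "p \<in> D" "t p = SnkV v i" by auto
  then have "\<tau> p = OutA v i" using sink_arrow[OF p(1)] by auto
  then show thesis using that p by blast
qed

text \<open>
  The elements of \<open>X\<close> are the arrows of the blossoming after gluing \<open>\<tau>\<^sub>p\<close> to \<open>\<sigma>\<^sub>p\<close>; the glued arrow is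
  \<open>Inr p\<close>. Where it enters a vertex it stands for \<open>\<sigma>\<^sub>p\<close> (\<open>in_arrow\<close>), where it leaves a vertex it
  stands for \<open>\<tau>\<^sub>p\<close> (\<open>out_arrow\<close>).
\<close>
definition X :: "('a + nat) set" where "X = arcs Q <+> D"
definition labels :: "('a + nat) set" where "labels = Inr ` D"
definition in_arrow :: "'a + nat \<Rightarrow> ('v, 'a) bl_arrow" where "in_arrow = case_sum OldA \<sigma>"
definition out_arrow :: "'a + nat \<Rightarrow> ('v, 'a) bl_arrow" where "out_arrow = case_sum OldA \<tau>"

lemma in_arrow_simps [simp]: "in_arrow (Inl a) = OldA a" "in_arrow (Inr p) = \<sigma> p"
  and out_arrow_simps [simp]: "out_arrow (Inl a) = OldA a" "out_arrow (Inr p) = \<tau> p"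
  by (auto simp: in_arrow_def out_arrow_def)

lemma X_iff [simp]: "Inl a \<in> X \<longleftrightarrow> a \<in> arcs Q" "Inr p \<in> X \<longleftrightarrow> p \<in> D"
  by (auto simp: X_def)

lemma finite_X: "finite X" by (simp add: X_def finite_D)

lemma bij_in_arrow: "bij_betw in_arrow X (\<Union>v\<in>verts Q. in_arcs B (OldV v))"
proof (rule bij_betw_imageI)
  show "inj_on in_arrow X"
  proof (rule inj_onI)
    fix x y assume xy: "x \<in> X" "y \<in> X" "in_arrow x = in_arrow y"
    then show "x = y"
      using inj_sigma sigma_neq_OldA by (cases x; cases y) (auto dest: inj_onD)
  qed
  show "in_arrow ` X = (\<Union>v\<in>verts Q. in_arcs B (OldV v))"
  proof (intro equalityI subsetI)
    fix a assume "a \<in> in_arrow ` X"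
    then obtain x where x: "x \<in> X" "a = in_arrow x" by auto
    then show "a \<in> (\<Union>v\<in>verts Q. in_arcs B (OldV v))"
      by (cases x) (use source_arrow in \<open>force simp: in_arcs_def\<close>)+
  next
    fix a assume a: "a \<in> (\<Union>v\<in>verts Q. in_arcs B (OldV v))"
    then show "a \<in> in_arrow ` X"
    proof (cases a)
      case (OldA b)
      then show ?thesis using a by (intro image_eqI[of _ _ "Inl b"]) (auto simp: in_arcs_def)
    next
      case (InA v i)
      then obtain p where "p \<in> D" "\<sigma> p = InA v i" using a source_arrow_surj[of v i] by (auto simp: in_arcs_def)
      then show ?thesis using InA by (intro image_eqI[of _ _ "Inr p"]) auto
    qed (auto simp: in_arcs_def)
  qed
qed

lemma bij_out_arrow: "bij_betw out_arrow X (\<Union>v\<in>verts Q. out_arcs B (OldV v))"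
proof (rule bij_betw_imageI)
  show "inj_on out_arrow X"
  proof (rule inj_onI)
    fix x y assume xy: "x \<in> X" "y \<in> X" "out_arrow x = out_arrow y"
    then show "x = y"
      using inj_tau tau_neq_OldA by (cases x; cases y) (auto dest: inj_onD)
  qed
  show "out_arrow ` X = (\<Union>v\<in>verts Q. out_arcs B (OldV v))"
  proof (intro equalityI subsetI)
    fix a assume "a \<in> out_arrow ` X"
    then obtain x where x: "x \<in> X" "a = out_arrow x" by auto
    then show "a \<in> (\<Union>v\<in>verts Q. out_arcs B (OldV v))"
      by (cases x) (use sink_arrow in \<open>force simp: out_arcs_def\<close>)+
  next
    fix a assume a: "a \<in> (\<Union>v\<in>verts Q. out_arcs B (OldV v))"
    then show "a \<in> out_arrow ` X"
    proof (cases a)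
      case (OldA b)
      then show ?thesis using a by (intro image_eqI[of _ _ "Inl b"]) (auto simp: out_arcs_def)
    next
      case (OutA v i)
      then obtain p where "p \<in> D" "\<tau> p = OutA v i" using a sink_arrow_surj[of v i] by (auto simp: out_arcs_def)
      then show ?thesis using OutA by (intro image_eqI[of _ _ "Inr p"]) auto
    qed (auto simp: out_arcs_def)
  qed
qed


lemma in_arrow_in_B: "x \<in> X \<Longrightarrow> in_arrow x \<in> arcs B" and out_arrow_in_B: "x \<in> X \<Longrightarrow> out_arrow x \<in> arcs B"
  using bij_betwE[OF bij_in_arrow] bij_betwE[OF bij_out_arrow] by (auto simp: in_arcs_def out_arcs_def)

definition ins :: "'v \<Rightarrow> ('a + nat) set" where "ins v = {x \<in> X. head B (in_arrow x) = OldV v}"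
definition outs :: "'v \<Rightarrow> ('a + nat) set" where "outs v = {x \<in> X. tail B (out_arrow x) = OldV v}"

lemma head_in_arrowE:
  assumes "x \<in> X" obtains v where "v \<in> verts Q" "head B (in_arrow x) = OldV v" "x \<in> ins v"
  using bij_betwE[OF bij_in_arrow] assms that by (fastforce simp: ins_def in_arcs_def)

lemma tail_out_arrowE:
  assumes "x \<in> X" obtains v where "v \<in> verts Q" "tail B (out_arrow x) = OldV v" "x \<in> outs v"
  using bij_betwE[OF bij_out_arrow] assms that by (fastforce simp: outs_def out_arcs_def)

lemma bij_ins: "bij_betw in_arrow (ins v) (in_arcs B (OldV v))" if "v \<in> verts Q"
proof (rule bij_betw_subset[OF bij_in_arrow])
  show "in_arrow ` ins v = in_arcs B (OldV v)"
  proof (intro equalityI subsetI)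
    fix a assume a: "a \<in> in_arcs B (OldV v)"
    then have "a \<in> in_arrow ` X" using bij_in_arrow that by (auto simp: bij_betw_def)
    then show "a \<in> in_arrow ` ins v" using a by (auto simp: ins_def in_arcs_def)
  qed (auto simp: ins_def in_arcs_def in_arrow_in_B)
qed (auto simp: ins_def)

lemma bij_outs: "bij_betw out_arrow (outs v) (out_arcs B (OldV v))" if "v \<in> verts Q"
proof (rule bij_betw_subset[OF bij_out_arrow])
  show "out_arrow ` outs v = out_arcs B (OldV v)"
  proof (intro equalityI subsetI)
    fix a assume a: "a \<in> out_arcs B (OldV v)"
    then have "a \<in> out_arrow ` X" using bij_out_arrow that by (auto simp: bij_betw_def)
    then show "a \<in> out_arrow ` outs v" using a by (auto simp: outs_def out_arcs_def)
  qed (auto simp: outs_def out_arcs_def out_arrow_in_B)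
qed (auto simp: outs_def)

lemma card_ins: "v \<in> verts Q \<Longrightarrow> card (ins v) = 2" and card_outs: "v \<in> verts Q \<Longrightarrow> card (outs v) = 2"
  using bij_betw_same_card[OF bij_ins] bij_betw_same_card[OF bij_outs] card_in_arcs card_out_arcs by auto

lemma finite_ins: "finite (ins v)" and finite_outs: "finite (outs v)"
  using finite_X by (auto simp: ins_def outs_def)

definition vanishes :: "'a + nat \<Rightarrow> 'a + nat \<Rightarrow> bool" where
  "vanishes x y \<longleftrightarrow> x \<in> X \<and> y \<in> X \<and> head B (in_arrow x) = tail B (out_arrow y) \<and> arrows_elem B [in_arrow x, out_arrow y] \<in> J"

definition survives :: "'a + nat \<Rightarrow> 'a + nat \<Rightarrow> bool" where
  "survives x y \<longleftrightarrow> x \<in> X \<and> y \<in> X \<and> head B (in_arrow x) = tail B (out_arrow y) \<and> arrows_elem B [in_arrow x, out_arrow y] \<notin> J"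

lemma uniq_B:
  assumes "a \<in> arcs B"
  shows "\<exists>\<^sub>\<le>\<^sub>1 b. b \<in> arcs B \<and> head B b = tail B a \<and> arrows_elem B [b, a] \<in> J"
    "\<exists>\<^sub>\<le>\<^sub>1 b. b \<in> arcs B \<and> head B b = tail B a \<and> arrows_elem B [b, a] \<notin> J"
    "\<exists>\<^sub>\<le>\<^sub>1 b. b \<in> arcs B \<and> tail B b = head B a \<and> arrows_elem B [a, b] \<in> J"
    "\<exists>\<^sub>\<le>\<^sub>1 b. b \<in> arcs B \<and> tail B b = head B a \<and> arrows_elem B [a, b] \<notin> J"
  using locally_gentle_B assms by (auto simp: locally_gentle_def)

lemma vanishes_unique: "vanishes x y \<Longrightarrow> vanishes x y' \<Longrightarrow> y = y'" "vanishes x y \<Longrightarrow> vanishes x' y \<Longrightarrow> x = x'"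
  and survives_unique: "survives x y \<Longrightarrow> survives x y' \<Longrightarrow> y = y'"
proof -
  note out_arrow_eq = inj_onD[OF bij_betw_imp_inj_on[OF bij_out_arrow]]
  note in_arrow_eq = inj_onD[OF bij_betw_imp_inj_on[OF bij_in_arrow]]
  show "y = y'" if "vanishes x y" "vanishes x y'"
    using that uniq_B(3)[OF in_arrow_in_B, of x] out_arrow_in_B
    by (intro out_arrow_eq) (auto simp: vanishes_def Uniq_def)
  show "x = x'" if "vanishes x y" "vanishes x' y"
    using that uniq_B(1)[OF out_arrow_in_B, of y] in_arrow_in_B
    by (intro in_arrow_eq) (auto simp: vanishes_def Uniq_def)
  show "y = y'" if "survives x y" "survives x y'"
    using that uniq_B(4)[OF in_arrow_in_B, of x] out_arrow_in_B
    by (intro out_arrow_eq) (auto simp: survives_def Uniq_def)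
qed

text \<open>
  Otherwise both arrows leaving the vertex would be nonvanishing continuations of \<open>x\<close>.
\<close>
lemma vanishes_exists:
  assumes x: "x \<in> X" shows "\<exists>y. vanishes x y"
proof (rule ccontr)
  assume none: "\<nexists>y. vanishes x y"
  obtain v where v: "v \<in> verts Q" "head B (in_arrow x) = OldV v" using head_in_arrowE[OF x] by blast
  have "survives x y" if "y \<in> outs v" for y
    using none that v x unfolding outs_def vanishes_def survives_def by auto
  then have "\<exists>y. outs v \<subseteq> {y}" using survives_unique by blast
  then have "card (outs v) \<le> 1" by (metis card.empty card_insert_le_m1 card_mono empty_iff finite.emptyI finite.insertI is_singletonI is_singleton_altdef)
  then show False using card_outs[OF v(1)] by simp
qed

text \<open>
  The vanishing continuation, extended by the identity outside \<open>X\<close> so that it is a permutation of the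
  whole type.
\<close>
definition Z :: "'a + nat \<Rightarrow> 'a + nat" where
  "Z x = (if x \<in> X then THE y. vanishes x y else x)"

lemma vanishes_iff: "x \<in> X \<Longrightarrow> vanishes x y \<longleftrightarrow> Z x = y"
  unfolding Z_def using vanishes_exists[of x] vanishes_unique(1)[of x] the1_equality[of "vanishes x" y]
  by (metis theI')

lemma Z_permutes: "Z permutes X"
proof (rule bij_imp_permutes)
  have Z: "vanishes x (Z x)" if "x \<in> X" for x using vanishes_iff that by blast
  then have "Z ` X \<subseteq> X" by (auto simp: vanishes_def)
  moreover have "inj_on Z X" by (rule inj_onI) (metis Z vanishes_unique(2))
  ultimately show "bij_betw Z X X" using finite_X by (simp add: bij_betw_def endo_inj_surj)
qed (simp add: Z_def)

lemma permutation_Z: "permutation Z"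
  using Z_permutes finite_X by (auto simp: permutation_permutes)

lemma Z_in_X [simp]: "Z x \<in> X \<longleftrightarrow> x \<in> X"
  using Z_permutes by (rule permutes_in_image)

lemma self_in_orbit: "x \<in> orbit Z x" by (rule permutation_self_in_orbit[OF permutation_Z])

lemma orbit_sub_X: "x \<in> X \<Longrightarrow> orbit Z x \<subseteq> X" by (rule permutes_orbit_subset[OF Z_permutes])

lemma orbit_eq: "y \<in> orbit Z x \<Longrightarrow> orbit Z y = orbit Z x"
  by (rule orbit_eq_if_mem[OF self_in_orbit])

end

text \<open>
  Chains of a relation with unique predecessors are determined by their last element, except for how
  far back they reach.
\<close>
lemma suffix_if_left_unique:
  assumes "xs \<noteq> []" "successively R xs" "successively R ys" "ys \<noteq> []" "last xs = last ys"
    and uniq: "\<And>a a' b. a \<in> set xs \<Longrightarrow> a' \<in> set ys \<Longrightarrow> b \<in> set xs \<Longrightarrow> R a b \<Longrightarrow> R a' b \<Longrightarrow> a = a'"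
    and "length xs \<le> length ys"
  shows "\<exists>zs. ys = zs @ xs"
  using assms
proof (induction xs arbitrary: ys rule: list_nonempty_induct)
  case (single x)
  then show ?case by (metis append_butlast_last_id last.simps)
next
  case (cons x xs)
  have "\<exists>zs. ys = zs @ xs"
    using cons.prems cons.hyps by (intro cons.IH) (auto simp: successively_Cons)
  then obtain zs where ys: "ys = zs @ xs" by blast
  have zs: "zs \<noteq> []" using cons.prems(6) ys by auto
  then have snoc: "zs = butlast zs @ [last zs]" by simp
  have "R (last zs) (hd xs)" "R x (hd xs)"
    using cons.prems(1,2) cons.hyps zs unfolding ys
    by (auto simp: successively_append_iff successively_Cons)
  then have "x = last zs" using cons.prems(5)[of x "last zs" "hd xs"] zs ys cons.hyps by simp
  then show ?case using snoc ys by (metis append.assoc append_Cons append_Nil)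
qed

context blossomed_quiver
begin

section \<open>Anticycles\<close>

lemma relation_iff:
  assumes "a \<in> arcs Q" "b \<in> arcs Q"
  shows "head Q a = tail Q b \<and> arrows_elem Q [a, b] \<in> I \<longleftrightarrow> Z (Inl a) = Inl b"
proof -
  have "head Q a = tail Q b \<Longrightarrow>
      arrows_elem Q [a, b] \<in> I \<longleftrightarrow> arrows_elem B [OldA a, OldA b] \<in> J"
    using blossoming assms by (auto simp: blossoming_def bl_ideal_def)
  then show ?thesis
    using assms by (subst vanishes_iff[symmetric]) (auto simp: vanishes_def)
qed

lemma anticycle_iff:
  "anticycle_in Q I p \<longleftrightarrow> p \<noteq> [] \<and> distinct p \<and> set p \<subseteq> arcs Q \<and>
     (\<forall>i < length p. Z (Inl (p ! i)) = Inl (p ! (Suc i mod length p)))"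
proof -
  have "(let \<alpha> = p ! i; \<beta> = p ! (Suc i mod length p) in
        head Q \<alpha> = tail Q \<beta> \<and> arrows_elem Q [\<alpha>, \<beta>] \<in> I) \<longleftrightarrow>
        Z (Inl (p ! i)) = Inl (p ! (Suc i mod length p))"
    if "p \<noteq> []" "set p \<subseteq> arcs Q" "i < length p" for i
  proof -
    have "p ! i \<in> arcs Q" using that by auto
    moreover have "p ! (Suc i mod length p) \<in> arcs Q" using that by (intro subsetD[OF that(2)] nth_mem) simp
    ultimately show ?thesis unfolding Let_def by (rule relation_iff)
  qed
  then show ?thesis unfolding anticycle_in_def by blast
qed

lemma anticycle_iterate:
  assumes "anticycle_in Q I p" "i < length p"
  shows "(Z ^^ j) (Inl (p ! i)) = Inl (p ! ((i + j) mod length p))"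
proof (induction j)
  case (Suc j)
  have "(i + j) mod length p < length p" using assms(2) by (intro mod_less_divisor) linarith
  then have "Z (Inl (p ! ((i + j) mod length p))) = Inl (p ! (Suc ((i + j) mod length p) mod length p))"
    using assms by (auto simp add: anticycle_iff)
  then show ?case using Suc by (simp add: mod_Suc_eq)
qed (use assms(2) in simp)

lemma anticycle_orbit:
  assumes "anticycle_in Q I p"
  shows "Inl ` set p = orbit Z (Inl (hd p))"
proof -
  have p: "p \<noteq> []" using assms by (simp add: anticycle_iff)
  have "orbit Z (Inl (hd p)) = {(Z ^^ j) (Inl (p ! 0)) | j. True}"
    using p by (simp add: hd_conv_nth orbit_altdef_permutation[OF permutation_Z])
  also have "\<dots> = {Inl (p ! (j mod length p)) | j. True}"
    using anticycle_iterate[OF assms, of 0] p by simp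
  also have "\<dots> = Inl ` set p"
  proof (intro equalityI subsetI)
    fix x :: "'a + nat" assume "x \<in> Inl ` set p"
    then obtain j where "j < length p" "x = Inl (p ! (j mod length p))" by (auto simp: in_set_conv_nth)
    then show "x \<in> {Inl (p ! (j mod length p)) | j. True}" by blast
  qed (use p in auto)
  finally show ?thesis ..
qed

lemma anticycle_rotate:
  assumes "anticycle_in Q I p"
  shows "anticycle_in Q I (rotate i p)"
  unfolding anticycle_iff
proof (intro conjI allI impI)
  show "rotate i p \<noteq> []" "distinct (rotate i p)" "set (rotate i p) \<subseteq> arcs Q"
    using assms by (auto simp: anticycle_iff)
  fix j assume j: "j < length (rotate i p)"
  have p: "0 < length p" using assms by (simp add: anticycle_iff)
  have "Z (Inl (p ! ((i + j) mod length p))) = Inl (p ! (Suc ((i + j) mod length p) mod length p))"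
    using assms p by (simp add: anticycle_iff)
  then show "Z (Inl (rotate i p ! j)) = Inl (rotate i p ! (Suc j mod length (rotate i p)))"
    using j p by (simp add: nth_rotate mod_simps)
qed

lemma rotate_if_same_set:
  assumes "anticycle_in Q I p" "anticycle_in Q I p'" "set p = set p'"
  shows "\<exists>i. p' = rotate i p"
proof -
  have ne: "p' \<noteq> []" and len: "length p' = length p"
    using assms by (auto simp: anticycle_iff dest!: distinct_card)
  have "p' ! 0 \<in> set p" using ne assms(3) by simp
  then obtain i where i: "i < length p" "p ! i = p' ! 0" by (auto simp: in_set_conv_nth)
  have "p' = rotate i p"
  proof (rule nth_equalityI)
    fix j assume j: "j < length p'"
    have "Inl (p' ! j) = (Z ^^ j) (Inl (p ! i))"
      using anticycle_iterate[OF assms(2), of 0 j] j i ne by simp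
    also have "\<dots> = Inl (rotate i p ! j)"
      using anticycle_iterate[OF assms(1) i(1), of j] j len by (simp add: nth_rotate)
    finally show "p' ! j = rotate i p ! j" by simp
  qed (simp add: len)
  then show ?thesis ..
qed

text \<open>
  Listing a cycle of \<open>Z\<close> without labels from one of its points gives an anticycle.
\<close>
lemma anticycle_of_cycle:
  assumes C: "C \<in> cycles Z X" "C \<inter> labels = {}"
  shows "\<exists>p. anticycle_in Q I p \<and> Inl ` set p = C"
proof -
  obtain x where x: "x \<in> X" "C = orbit Z x" using C(1) by auto
  have sub: "C \<subseteq> Inl ` arcs Q"
  proof
    fix y assume "y \<in> C"
    then have "y \<in> X" "y \<notin> labels" using orbit_sub_X[OF x(1)] C(2) x(2) by auto
    then show "y \<in> Inl ` arcs Q" by (cases y) (auto simp: labels_def)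
  qed
  define l where "l = card C"
  define p where "p = map (\<lambda>j. projl ((Z ^^ j) x)) [0..<l]"
  have l: "0 < l"
    using finite_orbit[OF self_in_orbit] orbit_nonempty[of Z x] x(2) by (auto simp: l_def card_gt_0_iff)
  have fixl: "(Z ^^ l) x = x"
    using funpow_fixed_iff_card_orbit_dvd[OF self_in_orbit, of l x] x(2) l_def by simp
  have in_C: "(Z ^^ j) x \<in> C" for j
    using x(2) by (auto simp: orbit_altdef_permutation[OF permutation_Z])
  have Inl: "Inl (projl ((Z ^^ j) x)) = (Z ^^ j) x" for j using in_C[of j] sub by auto
  have nth: "Inl (p ! j) = (Z ^^ j) x" if "j < l" for j using that Inl by (simp add: p_def)
  have set_p: "Inl ` set p = C"
  proof -
    have "Inl ` set p = (\<lambda>j. (Z ^^ j) x) ` {0..<l}"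
      by (auto simp: p_def image_image Inl)
    also have "\<dots> = C"
      unfolding x(2) using orbit_altdef_bounded[OF fixl l] by auto
    finally show ?thesis .
  qed
  have "card (set p) = length p"
  proof -
    have "card (set p) = card C" unfolding set_p[symmetric] by (simp add: card_image)
    then show ?thesis by (simp add: p_def l_def)
  qed
  then have "distinct p" by (rule card_distinct)
  moreover have "p \<noteq> []" using l by (simp add: p_def)
  moreover have "set p \<subseteq> arcs Q" using set_p sub by auto
  moreover have "Z (Inl (p ! i)) = Inl (p ! (Suc i mod length p))" if "i < length p" for i
  proof -
    have i: "i < l" using that by (simp add: p_def)
    have "Z (Inl (p ! i)) = (Z ^^ Suc i) x" using nth[OF i] by simp
    also have "\<dots> = (Z ^^ (Suc i mod l)) x" using funpow_mod_eq[OF fixl] by metis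
    also have "\<dots> = Inl (p ! (Suc i mod l))" using nth[of "Suc i mod l"] l by simp
    finally show ?thesis by (simp add: p_def)
  qed
  ultimately show ?thesis using set_p anticycle_iff by blast
qed

text \<open>
  The anticycles with a given set of arrows are the rotations of each other, so rotation classes of
  anticycles correspond to the cycles of \<open>Z\<close> that contain no label.
\<close>
lemma AG_phi_0: "AG_phi Q I J s t 0 l = num_cycles Z X labels 0 l"
proof -
  define rots where "rots C = {p. anticycle_in Q I p \<and> Inl ` set p = C}" for C :: "('a + nat) set"
  let ?S = "{C \<in> cycles Z X. card (C \<inter> labels) = 0 \<and> card (C - labels) = l}"
  have fin: "finite C" if "C \<in> cycles Z X" for C
    using that finite_orbit[OF self_in_orbit] by auto
  have rots: "rots (Inl ` set p) = {rotate i p | i. True}" if "anticycle_in Q I p" for p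
  proof (intro equalityI subsetI)
    fix p' assume "p' \<in> rots (Inl ` set p)"
    then have "anticycle_in Q I p'" "set p = set p'" by (auto simp: rots_def inj_image_eq_iff)
    then show "p' \<in> {rotate i p | i. True}" using rotate_if_same_set[OF that] by blast
  qed (auto simp: rots_def anticycle_rotate that)
  have "{{rotate i p | i. True} | p. anticycle_in Q I p \<and> length p = l} = rots ` ?S"
  proof (intro equalityI subsetI)
    fix R assume "R \<in> {{rotate i p | i. True} | p. anticycle_in Q I p \<and> length p = l}"
    then obtain p where p: "anticycle_in Q I p" "length p = l" "R = {rotate i p | i. True}" by blast
    let ?C = "Inl ` set p :: ('a + nat) set"
    have "hd p \<in> arcs Q" using p(1) by (auto simp: anticycle_iff)
    then have "?C \<in> cycles Z X" using anticycle_orbit[OF p(1)] by simp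
    moreover have "?C \<inter> labels = {}" by (auto simp: labels_def)
    moreover have "card (?C - labels) = l"
    proof -
      have "?C - labels = ?C" by (auto simp: labels_def)
      moreover have "card ?C = l"
        using p(1,2) by (simp add: card_image anticycle_iff distinct_card)
      ultimately show ?thesis by simp
    qed
    ultimately have "?C \<in> ?S" by simp
    moreover have "R = rots ?C" using rots p by simp
    ultimately show "R \<in> rots ` ?S" by blast
  next
    fix R assume "R \<in> rots ` ?S"
    then obtain C where C: "C \<in> ?S" "R = rots C" by blast
    have "C \<inter> labels = {}" using C(1) fin by auto
    then obtain p where p: "anticycle_in Q I p" "Inl ` set p = C" using anticycle_of_cycle C(1) by blast
    have "C - labels = C" using \<open>C \<inter> labels = {}\<close> by auto
    then have "l = card C" using C(1) by simp
    then have "length p = l"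
      using p distinct_card[of p] by (auto simp: anticycle_iff card_image)
    then show "R \<in> {{rotate i p | i. True} | p. anticycle_in Q I p \<and> length p = l}"
      using p rots[OF p(1)] C(2) by blast
  qed
  moreover have "inj_on rots ?S"
  proof (rule inj_onI)
    fix C C' assume C: "C \<in> ?S" "C' \<in> ?S" "rots C = rots C'"
    have "C \<inter> labels = {}" using C(1) fin by auto
    then obtain p where "anticycle_in Q I p" "Inl ` set p = C" using anticycle_of_cycle C(1) by blast
    then have "p \<in> rots C" by (simp add: rots_def)
    then show "C = C'" using C(3) by (auto simp: rots_def)
  qed
  ultimately show ?thesis by (simp add: AG_phi_def num_cycles_def card_image)
qed


section \<open>Maximal antipaths\<close>

definition zero_step :: "('v, 'a) bl_arrow \<Rightarrow> ('v, 'a) bl_arrow \<Rightarrow> bool" where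
  "zero_step a b \<longleftrightarrow> head B a = tail B b \<and> arrows_elem B [a, b] \<in> J"

lemma antipath_in_iff:
  "antipath_in B J w \<longleftrightarrow> w \<noteq> [] \<and> set w \<subseteq> arcs B \<and> successively zero_step w"
  unfolding antipath_in_def arrow_path_iff[OF B.wf_digraph] zero_step_def
  by (auto simp: successively_conv_nth)

abbreviation max_antipath where "max_antipath \<equiv> is_maximal B (antipath_in B J)"

text \<open>
  Reading backwards from the last arrow there is no choice, and a maximal antipath cannot be extended.
\<close>
lemma max_antipath_unique:
  assumes "max_antipath u" "max_antipath w" "last u = last w"
  shows "u = w"
proof -
  have *: "u = w" if "max_antipath u" "max_antipath w" "last u = last w" "length u \<le> length w" for u w
  proof -
    have u: "antipath_in B J u" and w: "antipath_in B J w" using that by (auto simp: is_maximal_def)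
    have "\<exists>zs. w = zs @ u"
    proof (rule suffix_if_left_unique[where R = zero_step])
      show "a = a'" if "a \<in> set u" "a' \<in> set w" "b \<in> set u" "zero_step a b" "zero_step a' b" for a a' b
        using uniq_B(1)[of b] that u w by (auto simp: zero_step_def antipath_in_iff Uniq_def)
    qed (use u w that in \<open>auto simp: antipath_in_iff\<close>)
    then obtain zs where zs: "w = zs @ u" by blast
    show "u = w"
    proof (cases "zs = []")
      case False
      then have "w = butlast zs @ last zs # u" using zs by simp
      then have "antipath_in B J (last zs # u)" "last zs \<in> arcs B"
        using w by (auto simp: antipath_in_iff successively_append_iff)
      then show ?thesis using that(1) by (auto simp: is_maximal_def)
    qed (use zs in simp)
  qed
  show ?thesis using *[of u w] *[of w u] assms by (cases "length u \<le> length w") auto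
qed

abbreviation Zinv where "Zinv \<equiv> inv_into UNIV Z"

text \<open>
  Go backwards along \<open>Z\<close> from \<open>y\<close>, stopping at the first label met; the assumption guarantees that
  there is one.
\<close>
lemma backward_chain:
  assumes "(Zinv ^^ n) y \<in> labels" "0 < n" "y \<in> X"
  shows "\<exists>r ds. r \<in> D \<and> set ds \<subseteq> arcs Q \<and> successively vanishes (Inr r # map Inl ds @ [y])"
  using assms
proof (induction n arbitrary: y)
  case (Suc n)
  let ?x = "Zinv y"
  have Zx: "Z ?x = y" by (rule permutes_inverses(1)[OF Z_permutes])
  have x: "?x \<in> X" using Suc.prems(3) Z_in_X[of ?x] Zx by simp
  have van: "vanishes ?x y" using Zx x vanishes_iff by blast
  show ?case
  proof (cases ?x)
    case (Inr r)
    then show ?thesis using van x by (intro exI[of _ r] exI[of _ "[]"]) auto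
  next
    case (Inl a)
    then have "n \<noteq> 0" using Suc.prems(1) by (cases "n = 0") (auto simp: labels_def)
    moreover have "(Zinv ^^ n) ?x \<in> labels" using Suc.prems(1) by (simp add: funpow_swap1)
    ultimately obtain r ds where r: "r \<in> D" "set ds \<subseteq> arcs Q"
        and chain: "successively vanishes (Inr r # map Inl ds @ [?x])"
      using Suc.IH[of ?x] x by auto
    have "successively vanishes ((Inr r # map Inl ds @ [?x]) @ [y])"
      using chain van by (subst successively_append_iff) simp
    then show ?thesis using r Inl x by (intro exI[of _ r] exI[of _ "ds @ [a]"]) auto
  qed
qed simp

lemma vanishing_chain_imp_antipath:
  "successively vanishes (x # map Inl ds @ [y]) \<Longrightarrow>
    successively zero_step (in_arrow x # map OldA ds @ [out_arrow y])"
proof (induction ds arbitrary: x)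
  case (Cons d ds)
  then have "vanishes x (Inl d)" "successively vanishes (Inl d # map Inl ds @ [y])" by auto
  then show ?case using Cons.IH[of "Inl d"] by (auto simp: vanishes_def zero_step_def)
qed (auto simp: vanishes_def zero_step_def)

abbreviation \<Phi> where "\<Phi> \<equiv> AG_perm Q J s t"
abbreviation \<delta> where "\<delta> \<equiv> AG_delta Q J s t"

text \<open>
  The backward chain from the label \<open>p\<close> to the previous label \<open>r\<close> on its cycle is a maximal antipath
  ending at \<open>t p\<close>: nothing precedes \<open>\<sigma> r\<close> and nothing follows \<open>\<tau> p\<close>. So \<open>\<Phi> p = r\<close>, and \<open>\<delta> p\<close>
  is the stretch of arrows in between.
\<close>
lemma AG_perm_delta:
  assumes p: "p \<in> D"
  shows "\<Phi> p \<in> D" "set (snd (\<delta> p)) \<subseteq> arcs Q"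
    and "successively vanishes (Inr (\<Phi> p) # map Inl (snd (\<delta> p)) @ [Inr p])"
    and "head B (\<sigma> (\<Phi> p)) = OldV (fst (\<delta> p))"
proof -
  have "Inr p \<in> orbit Zinv (Inr p)"
    using permutation_inverse[OF permutation_Z] by (rule permutation_self_in_orbit)
  then obtain n where "(Zinv ^^ n) (Inr p) = Inr p" "0 < n"
    by (auto simp: orbit_altdef) metis
  then obtain r ds where r: "r \<in> D" "set ds \<subseteq> arcs Q"
      and chain: "successively vanishes (Inr r # map Inl ds @ [Inr p])"
    using backward_chain[of n "Inr p"] p by (auto simp: labels_def)
  define w where "w = \<sigma> r # map OldA ds @ [\<tau> p]"
  have anti: "antipath_in B J w"
    using vanishing_chain_imp_antipath[OF chain] r source_arrow(1)[OF r(1)] sink_arrow(1)[OF p]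
    by (auto simp: antipath_in_iff w_def)
  have max: "max_antipath w"
    unfolding is_maximal_def
  proof (intro conjI notI anti)
    assume "\<exists>a\<in>arcs B. antipath_in B J (a # w) \<or> antipath_in B J (w @ [a])"
    then obtain a where a: "a \<in> arcs B" "antipath_in B J (a # w) \<or> antipath_in B J (w @ [a])" by blast
    obtain v i v' i' where "\<sigma> r = InA v i" "\<tau> p = OutA v' i'"
      using source_arrow(3)[OF r(1)] sink_arrow(3)[OF p] by auto
    then have "head B a = SrcV v i \<or> tail B a = SnkV v' i'"
      using a(2) by (auto simp: antipath_in_iff w_def zero_step_def successively_append_iff successively_Cons)
    then show False using a(1) by (cases a) auto
  qed
  have w: "max_antipath_to Q J (t p) = w"
    unfolding max_antipath_to_def
  proof (rule the_equality)
    show "max_antipath w \<and> head B (last w) = t p" using max sink_arrow(2)[OF p] by (simp add: w_def)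
    fix u assume u: "max_antipath u \<and> head B (last u) = t p"
    then have "last u \<in> arcs B" by (auto simp: is_maximal_def antipath_in_iff)
    moreover obtain v i where vi: "\<tau> p = OutA v i" using sink_arrow(3)[OF p] by auto
    moreover have "t p = SnkV v i" using sink_arrow(2)[OF p] vi by simp
    ultimately have "last u = \<tau> p" using u by (cases "last u") auto
    then show "u = w" using max_antipath_unique[of u w] u max by (simp add: w_def)
  qed
  have \<Phi>: "\<Phi> p = r"
    unfolding AG_perm_def w D_def[symmetric]
    using source_arrow(2) r inj_s by (intro the_equality) (auto simp: w_def dest: inj_onD)
  obtain v where v: "v \<in> verts Q" "head B (\<sigma> r) = OldV v"
    using head_in_arrowE[of "Inr r"] r(1) by auto
  have succ: "successively (\<lambda>a b. head Q a = tail Q b) ds"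
    "ds \<noteq> [] \<Longrightarrow> tail Q (hd ds) = v"
  proof -
    have c: "successively zero_step (\<sigma> r # map OldA ds @ [\<tau> p])"
      using vanishing_chain_imp_antipath[OF chain] by simp
    then have "successively zero_step (map OldA ds)"
      by (auto simp: successively_append_iff successively_Cons)
    then show "successively (\<lambda>a b. head Q a = tail Q b) ds"
      by (auto simp: successively_map zero_step_def elim!: successively_mono)
    show "tail Q (hd ds) = v" if "ds \<noteq> []"
      using c that v(2) by (cases ds) (auto simp: zero_step_def)
  qed
  have path: "(v, ds) \<in> paths Q"
  proof (cases "ds = []")
    case True
    then show ?thesis using v by (auto simp: paths_def Q.awalk_Nil_iff)
  next
    case False
    then have "arrow_path Q ds" using succ r(2) by (simp add: arrow_path_iff[OF Q.wf_digraph])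
    then show ?thesis using succ(2)[OF False] by (simp add: arrow_path_def)
  qed
  have \<delta>: "\<delta> p = (v, ds)"
    unfolding AG_delta_def w \<Phi>
  proof (rule the_equality)
    show "(v, ds) \<in> paths Q \<and> head B (\<sigma> r) = OldV (fst (v, ds)) \<and>
      w = \<sigma> r # map OldA (snd (v, ds)) @ [\<tau> p]"
      using path v by (simp add: w_def)
    fix x assume x: "x \<in> paths Q \<and> head B (\<sigma> r) = OldV (fst x) \<and>
      w = \<sigma> r # map OldA (snd x) @ [\<tau> p]"
    then have "map OldA (snd x) = (map OldA ds :: ('v, 'a) bl_arrow list)" by (simp add: w_def)
    then have "snd x = ds" by (auto dest!: map_injective simp: inj_def)
    then show "x = (v, ds)" using x v by (cases x) auto
  qed
  show "\<Phi> p \<in> D" "set (snd (\<delta> p)) \<subseteq> arcs Q"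
    "successively vanishes (Inr (\<Phi> p) # map Inl (snd (\<delta> p)) @ [Inr p])"
    "head B (\<sigma> (\<Phi> p)) = OldV (fst (\<delta> p))"
    unfolding \<Phi> \<delta> using r chain v by auto
qed

text \<open>
  A nontrivial \<open>\<delta> p\<close> determines \<open>p\<close> as the continuation of its last arrow. Two labels with the same
  trivial path would use up all arrows arriving at and leaving its vertex in the blossoming, which
  would make the vertex isolated in \<open>Q\<close>.
\<close>
lemma inj_delta: "inj_on \<delta> D"
proof (rule inj_onI, rule ccontr)
  fix p p' assume p: "p \<in> D" "p' \<in> D" "\<delta> p = \<delta> p'" "p \<noteq> p'"
  note ch = AG_perm_delta(3)[OF p(1)] AG_perm_delta(3)[OF p(2), folded p(3)]
  let ?ds = "snd (\<delta> p)" and ?v = "fst (\<delta> p)"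
  show False
  proof (cases "?ds = []")
    case False
    then have "vanishes (Inl (last ?ds)) (Inr p)" "vanishes (Inl (last ?ds)) (Inr p')"
      using ch by (auto simp: successively_append_iff successively_Cons last_map split: if_splits)
    then show False using vanishes_unique(1) p(4) by blast
  next
    case True
    then have van: "vanishes (Inr (\<Phi> p)) (Inr p)" "vanishes (Inr (\<Phi> p')) (Inr p')" using ch by auto
    then have neq: "\<Phi> p \<noteq> \<Phi> p'" using vanishes_unique(1) p(4) by (metis sum.inject(2))
    have "head B (\<sigma> (\<Phi> p)) = OldV ?v" "head B (\<sigma> (\<Phi> p')) = OldV ?v"
      using AG_perm_delta(4)[OF p(1)] AG_perm_delta(4)[OF p(2)] p(3) by simp_all
    then have ins: "{Inr (\<Phi> p), Inr (\<Phi> p')} \<subseteq> ins ?v" and outs: "{Inr p, Inr p'} \<subseteq> outs ?v"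
      using van AG_perm_delta(1) p(1,2) by (auto simp: ins_def outs_def vanishes_def)
    obtain v where v: "v \<in> verts Q" "OldV v = OldV ?v"
      using head_in_arrowE[of "Inr (\<Phi> p)"] AG_perm_delta(1)[OF p(1)] ins by (auto simp: ins_def)
    then have v: "?v \<in> verts Q" by simp
    have "{Inr (\<Phi> p), Inr (\<Phi> p')} = ins ?v"
      by (rule card_seteq[OF finite_ins ins]) (use card_ins[OF v] neq in simp)
    moreover have "{Inr p, Inr p'} = outs ?v"
      by (rule card_seteq[OF finite_outs outs]) (use card_outs[OF v] p(4) in simp)
    moreover obtain a where "a \<in> arcs Q" "tail Q a = ?v \<or> head Q a = ?v" using not_isolated[OF v] by blast
    then have "Inl a \<in> ins ?v \<or> Inl a \<in> outs ?v" by (auto simp: ins_def outs_def)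
    ultimately show False by auto
  qed
qed


section \<open>AG-orbits\<close>

lemma chain_Zinv_iterate:
  assumes "successively vanishes xs" "j < length xs"
  shows "(Zinv ^^ j) (last xs) = xs ! (length xs - Suc j)"
  using assms(2)
proof (induction j)
  case 0
  then show ?case by (cases xs rule: rev_cases) auto
next
  case (Suc j)
  let ?i = "length xs - Suc (Suc j)"
  have i: "Suc ?i = length xs - Suc j" "Suc ?i < length xs" using Suc.prems by auto
  then have "vanishes (xs ! ?i) (xs ! (length xs - Suc j))"
    using assms(1) by (metis successively_conv_nth)
  then have "Z (xs ! ?i) = xs ! (length xs - Suc j)" using vanishes_iff vanishes_def by blast
  then have "Zinv (xs ! (length xs - Suc j)) = xs ! ?i" using permutes_inverses(2)[OF Z_permutes] by metis
  then show ?case using Suc by simp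
qed

text \<open>
  Thus \<open>\<Phi>\<close> is the first return map of the inverse of \<open>Z\<close> to the labels, and the return time counts
  the arrows of \<open>\<delta> p\<close> and the label.
\<close>
sublocale first_return: first_return Zinv labels "map_sum id \<Phi>" "\<lambda>x. Suc (length (snd (\<delta> (projr x))))"
proof
  show "inj Zinv" using permutes_inv[OF Z_permutes] by (rule permutes_inj)
  show "finite labels" by (simp add: labels_def finite_D)
  show "map_sum id \<Phi> x \<in> labels" if "x \<in> labels" for x
    using that AG_perm_delta(1) by (auto simp: labels_def)
  fix x assume "x \<in> labels"
  then obtain p where p: "p \<in> D" "x = Inr p" by (auto simp: labels_def)
  let ?xs = "Inr (\<Phi> p) # map Inl (snd (\<delta> p)) @ [Inr p]"
  have iter: "(Zinv ^^ j) x = ?xs ! (length ?xs - Suc j)" if "j < length ?xs" for j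
    using chain_Zinv_iterate[OF AG_perm_delta(3)[OF p(1)] that] p(2) by simp
  show "(Zinv ^^ Suc (length (snd (\<delta> (projr x))))) x = map_sum id \<Phi> x"
    using iter[of "Suc (length (snd (\<delta> p)))"] p(2) by simp
  show "(Zinv ^^ j) x \<notin> labels" if "0 < j" "j < Suc (length (snd (\<delta> (projr x))))" for j
  proof -
    have "(Zinv ^^ j) x = Inl (snd (\<delta> p) ! (length (snd (\<delta> p)) - j))"
      using iter[of j] that p(2) by (simp add: nth_Cons' nth_append)
    then show ?thesis by (auto simp: labels_def)
  qed
qed simp

lemma orbit_label:
  assumes p: "p \<in> D"
  defines "P \<equiv> {(\<Phi> ^^ j) p | j. True}"
  shows "orbit Z (Inr p) \<inter> labels = Inr ` P"
    and "card (orbit Z (Inr p) - labels) = (\<Sum>r\<in>P. length (snd (\<delta> r)))"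
    and "P \<subseteq> D"
proof -
  have iter: "(map_sum id \<Phi> ^^ j) (Inr p) = Inr ((\<Phi> ^^ j) p)" for j
    by (induction j) auto
  have labs: "{(map_sum id \<Phi> ^^ j) (Inr p) | j. True} = Inr ` P"
    unfolding iter P_def by auto
  have C: "orbit Z (Inr p) = {(Zinv ^^ n) (Inr p) | n. True}"
    by (metis orbit_inv_eq orbit_altdef_permutation permutation_inverse permutation_Z)
  have L: "Inr p \<in> labels" using p by (simp add: labels_def)
  show int: "orbit Z (Inr p) \<inter> labels = Inr ` P"
    unfolding C using first_return.inter_iterates[OF L] labs by simp
  show "P \<subseteq> D" using int by (auto simp: labels_def)
  then have finP: "finite P" using finite_D finite_subset by blast
  have "card (orbit Z (Inr p)) = (\<Sum>x\<in>(Inr ` P :: ('a + nat) set). Suc (length (snd (\<delta> (projr x)))))"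
    unfolding C first_return.card_iterates[OF L] labs ..
  also have "\<dots> = (\<Sum>r\<in>P. Suc (length (snd (\<delta> r))))" by (simp add: sum.reindex)
  also have "\<dots> = card P + (\<Sum>r\<in>P. length (snd (\<delta> r)))"
    by (simp add: sum_Suc)
  finally have "card (orbit Z (Inr p)) = card P + (\<Sum>r\<in>P. length (snd (\<delta> r)))" .
  moreover have "card (orbit Z (Inr p)) = card (orbit Z (Inr p) \<inter> labels) + card (orbit Z (Inr p) - labels)"
    by (rule card_Int_Diff[OF finite_orbit[OF self_in_orbit]])
  ultimately show "card (orbit Z (Inr p) - labels) = (\<Sum>r\<in>P. length (snd (\<delta> r)))"
    unfolding int by (simp add: card_image)
qed

text \<open>
  The antipaths \<open>\<delta> p\<close> for the labels \<open>p\<close> on a cycle of \<open>Z\<close> form an AG-orbit, of the same type as the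
  cycle, and every AG-orbit arises from exactly one cycle.
\<close>
lemma AG_phi_pos:
  assumes q: "0 < q"
  shows "AG_phi Q I J s t q l = num_cycles Z X labels q l"
proof -
  let ?S = "{C \<in> cycles Z X. card (C \<inter> labels) = q \<and> card (C - labels) = l}"
  define \<Theta> where "\<Theta> C = \<delta> ` {p \<in> D. Inr p \<in> C}" for C :: "('a + nat) set"
  let ?P = "\<lambda>p. {(\<Phi> ^^ j) p | j. True}"
  have lab: "{r \<in> D. Inr r \<in> orbit Z (Inr p)} = ?P p" if "p \<in> D" for p
    using orbit_label(1)[OF that] by (fastforce simp: labels_def)
  have \<Theta>: "\<Theta> (orbit Z (Inr p)) = {\<delta> ((\<Phi> ^^ j) p) | j. True}" if "p \<in> D" for p
    unfolding \<Theta>_def lab[OF that] by auto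
  have type: "AG_type (\<Theta> (orbit Z (Inr p)))
      = (card (orbit Z (Inr p) \<inter> labels), card (orbit Z (Inr p) - labels))" if p: "p \<in> D" for p
  proof -
    have inj: "inj_on \<delta> (?P p)" by (rule inj_on_subset[OF inj_delta orbit_label(3)[OF p]])
    have "card (orbit Z (Inr p) \<inter> labels) = card (?P p)"
      unfolding orbit_label(1)[OF p] by (simp add: card_image)
    then show ?thesis
      unfolding \<Theta>_def lab[OF p] AG_type_def orbit_label(2)[OF p]
      using inj by (simp add: card_image sum.reindex)
  qed
  have lab_cycle: "\<exists>p \<in> D. C = orbit Z (Inr p)" if C: "C \<in> cycles Z X" "C \<inter> labels \<noteq> {}" for C
  proof -
    obtain x where x: "C = orbit Z x" using C by auto
    obtain p where "p \<in> D" "Inr p \<in> C" using C(2) by (auto simp: labels_def)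
    then show ?thesis using orbit_eq[of "Inr p" x] x by auto
  qed
  have "{Y \<in> AG_orbits Q J s t. AG_type Y = (q, l)} = \<Theta> ` ?S"
  proof (intro equalityI subsetI)
    fix Y assume Y: "Y \<in> {Y \<in> AG_orbits Q J s t. AG_type Y = (q, l)}"
    then obtain p where p: "p \<in> D" "Y = \<Theta> (orbit Z (Inr p))"
      using \<Theta> unfolding AG_orbits_def D_def by blast
    then have "orbit Z (Inr p) \<in> ?S" using Y type[OF p(1)] by auto
    then show "Y \<in> \<Theta> ` ?S" using p(2) by blast
  next
    fix Y assume "Y \<in> \<Theta> ` ?S"
    then obtain C where C: "C \<in> cycles Z X" "card (C \<inter> labels) = q" "card (C - labels) = l" "Y = \<Theta> C" by blast
    then have "C \<inter> labels \<noteq> {}" using q by auto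
    then obtain p where p: "p \<in> D" "C = orbit Z (Inr p)" using lab_cycle[OF C(1)] by blast
    then have "Y \<in> AG_orbits Q J s t" using \<Theta> C(4) unfolding AG_orbits_def D_def by blast
    then show "Y \<in> {Y \<in> AG_orbits Q J s t. AG_type Y = (q, l)}" using C type[OF p(1)] p(2) by simp
  qed
  moreover have "inj_on \<Theta> ?S"
  proof (rule inj_onI)
    fix C C' assume C: "C \<in> ?S" "C' \<in> ?S" "\<Theta> C = \<Theta> C'"
    have "{p \<in> D. Inr p \<in> C} = {p \<in> D. Inr p \<in> C'}"
      by (rule inj_on_image_eq_iff[THEN iffD1, OF inj_delta]) (use C(3) in \<open>auto simp: \<Theta>_def\<close>)
    moreover have "C \<inter> labels \<noteq> {}" using C(1) q by auto
    then obtain p where "p \<in> D" "Inr p \<in> C" by (auto simp: labels_def)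
    ultimately have "Inr p \<in> C" "Inr p \<in> C'" by auto
    then show "C = C'" using C(1,2) orbit_eq by blast
  qed
  ultimately show ?thesis using q by (simp add: AG_phi_def num_cycles_def card_image)
qed

end

section \<open>Extending partial matchings\<close>

lemma extend_inj_on_to_bij_betw:
  assumes "finite A" "finite A'" "card A = card A'" "C \<subseteq> A" "inj_on h C" "h ` C \<subseteq> A'"
  shows "\<exists>f. bij_betw f A A' \<and> (\<forall>a \<in> C. f a = h a)"
proof -
  have "card (A - C) = card (A' - h ` C)"
    using assms by (simp add: card_Diff_subset finite_subset card_image)
  then obtain g where g: "bij_betw g (A - C) (A' - h ` C)"
    using assms(1,2) by (metis finite_Diff finite_same_card_bij)
  let ?f = "\<lambda>a. if a \<in> C then h a else g a"
  have "bij_betw ?f (C \<union> (A - C)) (h ` C \<union> (A' - h ` C))"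
  proof (rule bij_betw_combine)
    show "bij_betw ?f C (h ` C)" using assms(5) by (auto simp: bij_betw_def inj_on_def)
    have "bij_betw ?f (A - C) (A' - h ` C) \<longleftrightarrow> bij_betw g (A - C) (A' - h ` C)"
      by (rule bij_betw_cong) simp
    then show "bij_betw ?f (A - C) (A' - h ` C)" using g by simp
  qed auto
  moreover have "C \<union> (A - C) = A" "h ` C \<union> (A' - h ` C) = A'" using assms(4,6) by auto
  ultimately have "bij_betw ?f A A'" by simp
  then show ?thesis by (intro exI[of _ ?f]) simp
qed

text \<open>
  The bijections \<open>z\<close> and \<open>z'\<close> match \<open>A\<close> with \<open>B\<close> and \<open>A'\<close> with \<open>B'\<close>. A pair of partial maps that
  respects the matchings is a partial injection from the matched pairs \<open>(a, z a)\<close> to the matched pairs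
  \<open>(a', z' a')\<close>, and such an injection extends to a bijection.
\<close>
lemma extend_partial_matching:
  assumes fin: "finite A" "finite A'" and card: "card A = card A'"
    and z: "bij_betw z A B" and z': "bij_betw z' A' B'"
    and pf: "PA \<subseteq> A" "inj_on pf PA" "pf ` PA \<subseteq> A'"
    and pg: "PB \<subseteq> B" "inj_on pg PB" "pg ` PB \<subseteq> B'"
    and compat: "\<And>a b. a \<in> PA \<Longrightarrow> b \<in> PB \<Longrightarrow> z a = b \<longleftrightarrow> z' (pf a) = pg b"
  shows "\<exists>f. bij_betw f A A' \<and> (\<forall>a \<in> PA. f a = pf a) \<and> (\<forall>a \<in> A. z a \<in> PB \<longrightarrow> z' (f a) = pg (z a))"
proof -
  define g1 where "g1 a = inv_into A' z' (pg (z a))" for a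
  define h where "h a = (if a \<in> PA then pf a else g1 a)" for a
  let ?A1 = "{a \<in> A. z a \<in> PB}"
  have g1: "g1 a \<in> A'" "z' (g1 a) = pg (z a)" if "a \<in> ?A1" for a
  proof -
    have "pg (z a) \<in> z' ` A'" using that pg(3) z' by (auto simp: bij_betw_def)
    then show "g1 a \<in> A'" "z' (g1 a) = pg (z a)" unfolding g1_def by (auto intro: inv_into_into f_inv_into_f)
  qed
  \<comment> \<open>Where both prescriptions apply they agree, by compatibility.\<close>
  have both: "pf a = g1 a" if "a \<in> PA" "a \<in> ?A1" for a
  proof (rule inj_onD[OF bij_betw_imp_inj_on[OF z']])
    show "z' (pf a) = z' (g1 a)" using g1(2)[OF that(2)] compat[OF that(1), of "z a"] that(2) by simp
  qed (use that pf g1 in auto)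
  have h1: "h a = g1 a" if "a \<in> ?A1" for a using both that by (simp add: h_def)
  have h_in: "h a \<in> A'" if "a \<in> PA \<union> ?A1" for a
    using that pf(3) g1(1) by (auto simp: h_def)
  have "inj_on h (PA \<union> ?A1)"
  proof (rule inj_onI)
    fix a b assume a: "a \<in> PA \<union> ?A1" and b: "b \<in> PA \<union> ?A1" and eq: "h a = h b"
    have z_eq: "z a = z b \<Longrightarrow> a = b" using inj_onD[OF bij_betw_imp_inj_on[OF z]] a b pf(1) by auto
    have mixed: "c = e" if "c \<in> PA" "e \<in> ?A1" "h c = h e" for c e
    proof -
      have "z' (pf c) = pg (z e)" using that h1[of e] g1(2)[of e] by (simp add: h_def)
      then have "z c = z e" using compat[OF that(1), of "z e"] that(2) by auto
      then show ?thesis using inj_onD[OF bij_betw_imp_inj_on[OF z]] that pf(1) by auto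
    qed
    show "a = b"
    proof (cases "a \<in> PA")
      case aA: True
      show ?thesis
      proof (cases "b \<in> PA")
        case True
        then show ?thesis using aA eq pf(2) by (simp add: h_def inj_on_def)
      qed (use mixed[of a b] aA b eq in auto)
    next
      case aA: False
      show ?thesis
      proof (cases "b \<in> PA")
        case True
        then show ?thesis using mixed[of b a] a aA eq by auto
      next
        case False
        then have ab: "a \<in> ?A1" "b \<in> ?A1" using a b aA by auto
        then have "pg (z a) = pg (z b)" using eq h1 g1(2) by metis
        then have "z a = z b" using pg(2) ab by (auto dest: inj_onD)
        then show ?thesis by (rule z_eq)
      qed
    qed
  qed
  then have "\<exists>f. bij_betw f A A' \<and> (\<forall>a \<in> PA \<union> ?A1. f a = h a)"
    using fin card pf(1) h_in by (intro extend_inj_on_to_bij_betw) blast+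
  then obtain f where f: "bij_betw f A A'" "\<And>a. a \<in> PA \<union> ?A1 \<Longrightarrow> f a = h a" by blast
  have "f a = pf a" if "a \<in> PA" for a using f(2)[of a] that by (simp add: h_def)
  moreover have "z' (f a) = pg (z a)" if "a \<in> A" "z a \<in> PB" for a
    using f(2)[of a] h1[of a] g1(2)[of a] that by simp
  ultimately show ?thesis using f(1) by blast
qed


context blossomed_quiver
begin

section \<open>Nonvanishing paths between labels\<close>

lemma bij_Z: "bij_betw Z (ins v) (outs v)"
proof (rule bij_betw_subset[OF permutes_imp_bij[OF Z_permutes]])
  show "ins v \<subseteq> X" by (auto simp: ins_def)
  have step: "x \<in> ins v \<longleftrightarrow> Z x \<in> outs v" if "x \<in> X" for x
    using vanishes_iff[OF that, of "Z x"] by (auto simp: ins_def outs_def vanishes_def)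
  show "Z ` ins v = outs v"
  proof (intro equalityI subsetI)
    fix y assume y: "y \<in> outs v"
    then have "y \<in> Z ` X" using permutes_image[OF Z_permutes] by (auto simp: outs_def)
    then show "y \<in> Z ` ins v" using step y by auto
  qed (use step in \<open>auto simp: ins_def\<close>)
qed

definition survive_step :: "('v, 'a) bl_arrow \<Rightarrow> ('v, 'a) bl_arrow \<Rightarrow> bool" where
  "survive_step a b \<longleftrightarrow> head B a = tail B b \<and> arrows_elem B [a, b] \<notin> J"

lemma surviving_chainI:
  "x \<in> X \<Longrightarrow> y \<in> X \<Longrightarrow> set ds \<subseteq> arcs Q \<Longrightarrow>
    successively survive_step (in_arrow x # map OldA ds @ [out_arrow y]) \<Longrightarrow>
    successively survives (x # map Inl ds @ [y])"
proof (induction ds arbitrary: x)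
  case (Cons d ds)
  then show ?case using Cons.IH[of "Inl d"] by (auto simp: survives_def survive_step_def)
qed (auto simp: survives_def survive_step_def)

text \<open>
  This is where the labeling convention enters. Inner arrows of the path from \<open>s p\<close> to \<open>t p\<close> are arrows
  of \<open>Q\<close>, since nothing precedes an arrow from a new source and nothing follows an arrow to a new sink.
\<close>
lemma label_chain:
  assumes p: "p \<in> D"
  shows "\<exists>ds. set ds \<subseteq> arcs Q \<and> successively survives (Inr p # map Inl ds @ [Inr p])"
proof -
  obtain w where w: "path_in B J w" "tail B (hd w) = s p" "head B (last w) = t p"
    using blossoming p unfolding blossoming_def bl_labeling_def D_def is_maximal_def by blast
  note path = path_in_imp_successively[OF fin_B ideal_J w(1)]
  have succ: "successively survive_step w" using path(3) by (simp add: survive_step_def[abs_def])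
  obtain v i v' i' where \<sigma>\<tau>: "\<sigma> p = InA v i" "\<tau> p = OutA v' i'"
    using source_arrow(3)[OF p] sink_arrow(3)[OF p] by auto
  have st: "s p = SrcV v i" "t p = SnkV v' i'"
    using source_arrow(2)[OF p] sink_arrow(2)[OF p] \<sigma>\<tau> by auto
  have "hd w \<in> arcs B" "last w \<in> arcs B" using path(1,2) by auto
  then have hd: "hd w = \<sigma> p" and last: "last w = \<tau> p"
    using w(2,3) st \<sigma>\<tau> by (cases "hd w"; cases "last w"; auto)+
  obtain mid where mid: "w = \<sigma> p # mid @ [\<tau> p]"
  proof -
    obtain u where u: "w = u @ [\<tau> p]" using last path(1) by (metis append_butlast_last_id)
    then have "u \<noteq> []" using hd \<sigma>\<tau> by auto
    then obtain mid where "u = \<sigma> p # mid" using hd u by (cases u) auto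
    then show thesis using that u by simp
  qed
  have "\<exists>a. m = OldA a" if m_mid: "m \<in> set mid" for m
  proof -
    obtain us vs where m: "mid = us @ m # vs" using m_mid by (auto simp: in_set_conv_decomp)
    have "survive_step (last (\<sigma> p # us)) m" "survive_step m (hd (vs @ [\<tau> p]))"
      using succ unfolding mid m
      by (cases us rule: rev_cases; cases vs; auto simp: successively_append_iff successively_Cons)+
    then have "head B (last (\<sigma> p # us)) = tail B m" "head B m = tail B (hd (vs @ [\<tau> p]))"
      by (auto simp: survive_step_def)
    moreover have "last (\<sigma> p # us) \<in> arcs B" "m \<in> arcs B" "hd (vs @ [\<tau> p]) \<in> arcs B"
      using path(2) unfolding mid m by (cases us rule: rev_cases; cases vs; auto)+
    ultimately show ?thesis
      by (cases m; cases "last (\<sigma> p # us)"; cases "hd (vs @ [\<tau> p])") auto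
  qed
  then obtain ds where ds: "mid = map OldA ds" by (metis ex_map_conv)
  have "set ds \<subseteq> arcs Q" using path(2) unfolding mid ds by auto
  moreover have "successively survives (Inr p # map Inl ds @ [Inr p])"
    by (rule surviving_chainI) (use p succ calculation in \<open>auto simp: mid ds\<close>)
  ultimately show ?thesis by blast
qed

text \<open>
  Nonvanishing continuations are unique, so the first label met from \<open>x\<close> is determined by \<open>x\<close>.
\<close>
lemma surviving_chain_unique:
  "successively survives (x # map Inl ds @ [Inr p]) \<Longrightarrow>
    successively survives (x # map Inl es @ [Inr r]) \<Longrightarrow> p = r"
proof (induction ds arbitrary: x es)
  case Nil
  then show ?case using survives_unique by (cases es) fastforce+
next
  case (Cons d ds)
  then show ?case
  proof (cases es)
    case es: (Cons e es')
    then have "e = d" using Cons.prems survives_unique by fastforce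
    then show ?thesis using Cons es by auto
  qed (use survives_unique in fastforce)
qed

end

section \<open>The repetition as a cyclic cover\<close>

locale gentle_repetition = blossomed_quiver Q I J s t
  for Q :: "('v, 'a) pre_digraph"
    and I :: "(('v, 'a) qpath \<Rightarrow>\<^sub>0 'k::field) set"
    and J :: "(('v bl_vertex, ('v, 'a) bl_arrow) qpath \<Rightarrow>\<^sub>0 'k) set"
    and s t :: "nat \<Rightarrow> 'v bl_vertex" +
  fixes k :: nat
    and J' :: "((('v \<times> nat) bl_vertex, ('v \<times> nat, 'a rep_arrow) bl_arrow) qpath \<Rightarrow>\<^sub>0 'k) set"
    and s' t' :: "nat \<Rightarrow> ('v \<times> nat) bl_vertex"
  assumes k: "0 < k"
    and rep_blossoming: "blossoming (rep_quiver Q s t k) (rep_ideal Q I J s t k) J' s' t'"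
begin

abbreviation Q' where "Q' \<equiv> rep_quiver Q s t k"
abbreviation I' where "I' \<equiv> rep_ideal Q I J s t k"

definition vin :: "'a + nat \<Rightarrow> 'v" where "vin x = old_vertex (head B (in_arrow x))"
definition vout :: "'a + nat \<Rightarrow> 'v" where "vout x = old_vertex (tail B (out_arrow x))"

lemma ins_iff: "x \<in> ins v \<longleftrightarrow> x \<in> X \<and> vin x = v"
proof (cases "x \<in> X")
  case True
  then show ?thesis by (rule head_in_arrowE) (auto simp: ins_def vin_def)
qed (simp add: ins_def)

lemma outs_iff: "x \<in> outs v \<longleftrightarrow> x \<in> X \<and> vout x = v"
proof (cases "x \<in> X")
  case True
  then show ?thesis by (rule tail_out_arrowE) (auto simp: outs_def vout_def)
qed (simp add: outs_def)

lemma vin_vout_verts: "x \<in> X \<Longrightarrow> vin x \<in> verts Q" "x \<in> X \<Longrightarrow> vout x \<in> verts Q"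
  by (auto simp: vin_def vout_def elim: head_in_arrowE tail_out_arrowE)

lemma vin_eq_vout_iff:
  assumes "x \<in> X" "y \<in> X"
  shows "vin x = vout y \<longleftrightarrow> head B (in_arrow x) = tail B (out_arrow y)"
  by (rule head_in_arrowE[OF assms(1)], rule tail_out_arrowE[OF assms(2)]) (auto simp: vin_def vout_def)

text \<open>
  The arrow of the repetition that leaves its vertex at level \<open>i\<close> as a copy of \<open>x\<close>; the level of the
  vertex where it ends is \<open>target_level x i\<close>.
\<close>
fun rep_arr :: "'a + nat \<Rightarrow> nat \<Rightarrow> 'a rep_arrow" where
  "rep_arr (Inl a) i = Copy a i"
| "rep_arr (Inr p) i = Conn p i"

fun target_level :: "'a + nat \<Rightarrow> nat \<Rightarrow> nat" where
  "target_level (Inl a) i = i"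
| "target_level (Inr p) i = Suc i"

lemma verts_Q': "verts Q' = verts Q \<times> {1..k}" by (simp add: rep_quiver_def)

lemma rep_arr_in_arcs_iff: "rep_arr x i \<in> arcs Q' \<longleftrightarrow> x \<in> X \<and> 1 \<le> i \<and> target_level x i \<le> k"
  by (cases x) (auto simp: rep_quiver_def D_def)

lemma arcs_Q'E:
  assumes "e \<in> arcs Q'"
  obtains x i where "e = rep_arr x i" "x \<in> X" "1 \<le> i" "target_level x i \<le> k"
proof -
  have "\<exists>x i. e = rep_arr x i"
    by (cases e) (metis rep_arr.simps)+
  then show thesis using that assms rep_arr_in_arcs_iff by blast
qed

lemma rep_arr_inject: "rep_arr x i = rep_arr y j \<longleftrightarrow> x = y \<and> i = j"
  by (cases x; cases y) auto

lemma ends_rep_arr: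
  assumes "x \<in> X"
  shows "tail Q' (rep_arr x i) = (vout x, i)" "head Q' (rep_arr x i) = (vin x, target_level x i)"
  by (cases x; simp add: rep_quiver_def vout_def vin_def)+

lemma rep_relations_sub: "rep_relations Q I J s t k \<subseteq> {[rep_arr x i, rep_arr y (target_level x i)] | x y i.
    rep_arr x i \<in> arcs Q' \<and> rep_arr y (target_level x i) \<in> arcs Q' \<and> vanishes x y}"
proof
  fix r assume "r \<in> rep_relations Q I J s t k"
  then consider
    (aa) a b i where "r = [Copy a i, Copy b i]" "a \<in> arcs Q" "b \<in> arcs Q" "i \<in> {1..k}"
      "head Q a = tail Q b" "arrows_elem Q [a, b] \<in> I"
  | (ac) a p i where "r = [Copy a i, Conn p i]" "a \<in> arcs Q" "p \<in> D" "i \<in> {1..<k}"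
      "head B (OldA a) = tail B (\<tau> p)" "arrows_elem B [OldA a, \<tau> p] \<in> J"
  | (ca) p b i where "r = [Conn p i, Copy b (Suc i)]" "b \<in> arcs Q" "p \<in> D" "i \<in> {1..<k}"
      "head B (\<sigma> p) = tail B (OldA b)" "arrows_elem B [\<sigma> p, OldA b] \<in> J"
  | (cc) p p' i where "r = [Conn p i, Conn p' (Suc i)]" "p \<in> D" "p' \<in> D" "i \<in> {1..<k}" "Suc i \<in> {1..<k}"
      "head B (\<sigma> p) = tail B (\<tau> p')" "arrows_elem B [\<sigma> p, \<tau> p'] \<in> J"
    unfolding rep_relations_def Let_def D_def by blast
  then have "\<exists>x y i. r = [rep_arr x i, rep_arr y (target_level x i)] \<and> x \<in> X \<and> y \<in> X \<and> 1 \<le> i \<and> target_level x i \<le> k \<and>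
      target_level y (target_level x i) \<le> k \<and> vanishes x y"
  proof cases
    case aa
    then show ?thesis using relation_iff[of a b] vanishes_iff[of "Inl a" "Inl b"]
      by (intro exI[of _ "Inl a"] exI[of _ "Inl b"] exI[of _ i]) auto
  next
    case ac
    then show ?thesis
      by (intro exI[of _ "Inl a"] exI[of _ "Inr p"] exI[of _ i]) (auto simp: vanishes_def)
  next
    case ca
    then show ?thesis
      by (intro exI[of _ "Inr p"] exI[of _ "Inl b"] exI[of _ i]) (auto simp: vanishes_def)
  next
    case cc
    then show ?thesis
      by (intro exI[of _ "Inr p"] exI[of _ "Inr p'"] exI[of _ i]) (auto simp: vanishes_def)
  qed
  then obtain x y i where r: "r = [rep_arr x i, rep_arr y (target_level x i)]" "vanishes x y"
      and "x \<in> X" "y \<in> X" "1 \<le> i" "target_level x i \<le> k" "target_level y (target_level x i) \<le> k" by blast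
  moreover have "i \<le> target_level x i" by (cases x) auto
  ultimately have "rep_arr x i \<in> arcs Q'" "rep_arr y (target_level x i) \<in> arcs Q'" by (auto simp: rep_arr_in_arcs_iff)
  with r show "r \<in> {[rep_arr x i, rep_arr y (target_level x i)] | x y i.
      rep_arr x i \<in> arcs Q' \<and> rep_arr y (target_level x i) \<in> arcs Q' \<and> vanishes x y}" by blast
qed

lemma rep_relationsI:
  assumes "rep_arr x i \<in> arcs Q'" "rep_arr y (target_level x i) \<in> arcs Q'" "vanishes x y"
  shows "[rep_arr x i, rep_arr y (target_level x i)] \<in> rep_relations Q I J s t k"
proof -
  have x: "x \<in> X" "1 \<le> i" "target_level x i \<le> k" and y: "y \<in> X" "target_level y (target_level x i) \<le> k"
    using assms(1,2) by (auto simp: rep_arr_in_arcs_iff)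
  show ?thesis
  proof (cases x; cases y)
    fix a b assume xy: "x = Inl a" "y = Inl b"
    then have "head Q a = tail Q b \<and> arrows_elem Q [a, b] \<in> I"
      using relation_iff[of a b] vanishes_iff[of x y] assms(3) x y by auto
    then show ?thesis using x y xy unfolding rep_relations_def Let_def by auto
  qed (use x y assms(3) in \<open>auto simp: rep_relations_def Let_def D_def vanishes_def\<close>)
qed

lemma not_isolated_Q': "v \<in> verts Q' \<Longrightarrow> \<exists>a \<in> arcs Q'. tail Q' a = v \<or> head Q' a = v"
proof -
  assume "v \<in> verts Q'"
  then obtain u i where v: "v = (u, i)" "u \<in> verts Q" "i \<in> {1..k}" by (auto simp: verts_Q')
  then obtain a where "a \<in> arcs Q" "tail Q a = u \<or> head Q a = u" using not_isolated by blast
  then show ?thesis using v by (intro bexI[of _ "Copy a i"]) (auto simp: rep_quiver_def)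
qed

sublocale R: blossomed_quiver Q' I' J' s' t'
  by unfold_locales (rule rep_blossoming not_isolated_Q', assumption?)+

text \<open>
  The four families of relations defining the repetition say uniformly that two composable arrows
  compose to zero exactly if the elements of \<open>X\<close> that they copy do.
\<close>
lemma R_vanishes_iff:
  assumes "rep_arr x i \<in> arcs Q'" "rep_arr y j \<in> arcs Q'"
  shows "R.vanishes (Inl (rep_arr x i)) (Inl (rep_arr y j)) \<longleftrightarrow> j = target_level x i \<and> vanishes x y"
proof -
  have X: "x \<in> X" "y \<in> X" using assms by (auto simp: rep_arr_in_arcs_iff)
  have heads: "head Q' (rep_arr x i) = tail Q' (rep_arr y j) \<longleftrightarrow> j = target_level x i \<and> vin x = vout y"
    using ends_rep_arr X by auto
  have R: "rep_relations Q I J s t k \<subseteq> {p. arrow_path Q' p \<and> length p = 2}"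
  proof
    fix r assume "r \<in> rep_relations Q I J s t k"
    then obtain x y i where r: "r = [rep_arr x i, rep_arr y (target_level x i)]" "rep_arr x i \<in> arcs Q'"
        "rep_arr y (target_level x i) \<in> arcs Q'" "vanishes x y"
      using rep_relations_sub by blast
    have "vin x = vout y" using r(4) vin_eq_vout_iff by (auto simp: vanishes_def)
    then have "head Q' (rep_arr x i) = tail Q' (rep_arr y (target_level x i))"
      using r by (simp add: rep_arr_in_arcs_iff ends_rep_arr)
    then show "r \<in> {p. arrow_path Q' p \<and> length p = 2}"
      using r by (simp add: arrow_path_iff[OF R.Q.wf_digraph])
  qed
  have "arrows_elem Q' [rep_arr x i, rep_arr y j] \<in> I' \<longleftrightarrow> [rep_arr x i, rep_arr y j] \<in> rep_relations Q I J s t k"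
    unfolding rep_ideal_def by (rule pair_in_generated_ideal_iff[OF R.Q.fin_digraph R])
  also have "\<dots> \<longleftrightarrow> j = target_level x i \<and> vanishes x y"
    using rep_relationsI[of x i y] rep_relations_sub assms by (auto simp: rep_arr_inject)
  finally have "arrows_elem Q' [rep_arr x i, rep_arr y j] \<in> I' \<longleftrightarrow> j = target_level x i \<and> vanishes x y" .
  moreover have "vanishes x y \<Longrightarrow> vin x = vout y" using vin_eq_vout_iff X by (simp add: vanishes_def)
  ultimately show ?thesis
    using R.relation_iff[OF assms] R.vanishes_iff[of "Inl (rep_arr x i)"] assms heads by auto
qed

text \<open>
  The arrow of the repetition that enters its vertex at level \<open>i\<close> as a copy of \<open>x\<close>; for a label it
  comes from the level below.
\<close>
fun inarr :: "'a + nat \<Rightarrow> nat \<Rightarrow> 'a rep_arrow" where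
  "inarr (Inl a) i = Copy a i"
| "inarr (Inr p) i = Conn p (i - 1)"

text \<open>
  The elements of \<open>X\<close> arriving at \<open>v\<close> whose copy at level \<open>i\<close> is an arrow of the repetition. Only the
  labels at level \<open>1\<close> are missing; there a new arrow of the blossoming arrives. Dually for \<open>old_outs\<close>.
\<close>
definition old_ins :: "'v \<Rightarrow> nat \<Rightarrow> ('a + nat) set" where
  "old_ins v i = {x \<in> ins v. isl x \<or> 1 < i}"

definition old_outs :: "'v \<Rightarrow> nat \<Rightarrow> ('a + nat) set" where
  "old_outs v i = {y \<in> outs v. isl y \<or> i < k}"

lemma inarr_eq:
  assumes "x \<in> old_ins v i" "i \<in> {1..k}"
  obtains j where "inarr x i = rep_arr x j" "target_level x j = i" "1 \<le> j"
  using assms by (cases x) (auto simp: old_ins_def intro!: that[of "i - 1"])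

lemma old_in_arc_iff:
  assumes v: "v \<in> verts Q" and i: "i \<in> {1..k}"
  shows "Inl e \<in> R.ins (v, i) \<longleftrightarrow> (\<exists>x \<in> old_ins v i. e = inarr x i)"
proof
  assume "Inl e \<in> R.ins (v, i)"
  then have e: "e \<in> arcs Q'" "head Q' e = (v, i)" by (auto simp: R.ins_def)
  obtain x j where x: "e = rep_arr x j" "x \<in> X" "1 \<le> j" using e(1) by (rule arcs_Q'E)
  have "vin x = v" "target_level x j = i" using e(2) ends_rep_arr[OF x(2)] x(1) by auto
  then have "x \<in> old_ins v i" "e = inarr x i"
    using x by (cases x; auto simp: old_ins_def ins_iff)+
  then show "\<exists>x \<in> old_ins v i. e = inarr x i" by blast
next
  assume "\<exists>x \<in> old_ins v i. e = inarr x i"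
  then obtain x where x: "x \<in> old_ins v i" "e = inarr x i" by blast
  obtain j where j: "e = rep_arr x j" "target_level x j = i" "1 \<le> j" using inarr_eq[OF x(1) i] x(2) by metis
  have "x \<in> X" "vin x = v" using x(1) by (auto simp: old_ins_def ins_iff)
  then show "Inl e \<in> R.ins (v, i)"
    using j i by (auto simp: R.ins_def rep_arr_in_arcs_iff ends_rep_arr)
qed

lemma old_out_arc_iff:
  assumes v: "v \<in> verts Q" and i: "i \<in> {1..k}"
  shows "Inl e \<in> R.outs (v, i) \<longleftrightarrow> (\<exists>y \<in> old_outs v i. e = rep_arr y i)"
proof
  assume "Inl e \<in> R.outs (v, i)"
  then have e: "e \<in> arcs Q'" "tail Q' e = (v, i)" by (auto simp: R.outs_def)
  obtain y j where y: "e = rep_arr y j" "y \<in> X" "1 \<le> j" "target_level y j \<le> k" using e(1) by (rule arcs_Q'E)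
  have "vout y = v" "j = i" using e(2) ends_rep_arr[OF y(2)] y(1) by auto
  then have "y \<in> old_outs v i" "e = rep_arr y i"
    using y by (cases y; auto simp: old_outs_def outs_iff)+
  then show "\<exists>y \<in> old_outs v i. e = rep_arr y i" by blast
next
  assume "\<exists>y \<in> old_outs v i. e = rep_arr y i"
  then obtain y where y: "y \<in> old_outs v i" "e = rep_arr y i" by blast
  have "y \<in> X" "vout y = v" using y(1) by (auto simp: old_outs_def outs_iff)
  then show "Inl e \<in> R.outs (v, i)"
    using y i by (cases y) (auto simp: R.outs_def rep_arr_in_arcs_iff[symmetric] ends_rep_arr old_outs_def
        rep_arr_in_arcs_iff[of "Inl _", simplified] rep_arr_in_arcs_iff[of "Inr _", simplified]
        ends_rep_arr[of "Inl _", simplified] ends_rep_arr[of "Inr _", simplified])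
qed

text \<open>
  The names of the arrows of the repetition are prescribed; the bijection is extended to the new arrows
  so that it respects vanishing, also where the relations between new arrows of \<open>J'\<close> are not the ones
  of \<open>J\<close> under the obvious renaming.
\<close>
lemma exists_local_isomorphism:
  assumes v: "v \<in> verts Q" and i: "i \<in> {1..k}"
  shows "\<exists>f. bij_betw f (ins v) (R.ins (v, i)) \<and> (\<forall>x \<in> old_ins v i. f x = Inl (inarr x i)) \<and>
    (\<forall>x \<in> ins v. Z x \<in> old_outs v i \<longrightarrow> R.Z (f x) = Inl (rep_arr (Z x) i))"
proof (rule extend_partial_matching[where pg = "\<lambda>y. Inl (rep_arr y i)"])
  have vi: "(v, i) \<in> verts Q'" using v i by (simp add: verts_Q')
  show "finite (ins v)" "finite (R.ins (v, i))" by (rule finite_ins R.finite_ins)+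
  show "card (ins v) = card (R.ins (v, i))" using card_ins[OF v] R.card_ins[OF vi] by simp
  show "bij_betw Z (ins v) (outs v)" by (rule bij_Z)
  show "bij_betw R.Z (R.ins (v, i)) (R.outs (v, i))" by (rule R.bij_Z)
  show "old_ins v i \<subseteq> ins v" "old_outs v i \<subseteq> outs v" by (auto simp: old_ins_def old_outs_def)
  show "inj_on (\<lambda>x. Inl (inarr x i)) (old_ins v i)"
    by (rule inj_onI) (metis rep_arr_inject inarr_eq[OF _ i] sum.inject(1))
  show "inj_on (\<lambda>y. Inl (rep_arr y i)) (old_outs v i)"
    by (rule inj_onI) (simp add: rep_arr_inject)
  show "(\<lambda>x. Inl (inarr x i)) ` old_ins v i \<subseteq> R.ins (v, i)"
    using old_in_arc_iff[OF v i] by blast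
  show "(\<lambda>y. Inl (rep_arr y i)) ` old_outs v i \<subseteq> R.outs (v, i)"
    using old_out_arc_iff[OF v i] by blast
  fix x y assume x: "x \<in> old_ins v i" and y: "y \<in> old_outs v i"
  obtain j where j: "inarr x i = rep_arr x j" "target_level x j = i" using inarr_eq[OF x i] by blast
  have "Inl (inarr x i) \<in> R.ins (v, i)" "Inl (rep_arr y i) \<in> R.outs (v, i)"
    using old_in_arc_iff[OF v i] old_out_arc_iff[OF v i] x y by blast+
  then have "rep_arr x j \<in> arcs Q'" "rep_arr y i \<in> arcs Q'"
    using j by (auto simp: R.ins_def R.outs_def)
  then have "R.vanishes (Inl (inarr x i)) (Inl (rep_arr y i)) \<longleftrightarrow> vanishes x y"
    "Inl (inarr x i) \<in> R.X"
    using R_vanishes_iff[of x j y i] j by auto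
  moreover have "x \<in> X" using x by (simp add: old_ins_def ins_def)
  ultimately show "Z x = y \<longleftrightarrow> R.Z (Inl (inarr x i)) = Inl (rep_arr y i)"
    using vanishes_iff R.vanishes_iff by metis
qed

definition local_iso :: "'v \<Rightarrow> nat \<Rightarrow> 'a + nat \<Rightarrow> 'a rep_arrow + nat" where
  "local_iso v i = (SOME f. bij_betw f (ins v) (R.ins (v, i)) \<and>
    (\<forall>x \<in> old_ins v i. f x = Inl (inarr x i)) \<and>
    (\<forall>x \<in> ins v. Z x \<in> old_outs v i \<longrightarrow> R.Z (f x) = Inl (rep_arr (Z x) i)))"

text \<open>
  The copy of \<open>x\<close> that arrives at level \<open>i\<close>. The copy that leaves at level \<open>i\<close> (\<open>out_copy\<close>) is
  defined from it as the vanishing continuation of the appropriate arriving copy, so that vanishing is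
  respected by definition.
\<close>
definition in_copy :: "'a + nat \<Rightarrow> nat \<Rightarrow> 'a rep_arrow + nat" where
  "in_copy x i = local_iso (vin x) i x"

definition out_copy :: "'a + nat \<Rightarrow> nat \<Rightarrow> 'a rep_arrow + nat" where
  "out_copy y i = R.Z (in_copy (Zinv y) i)"

lemma bij_in_copy_local: "v \<in> verts Q \<Longrightarrow> i \<in> {1..k} \<Longrightarrow> bij_betw (\<lambda>x. in_copy x i) (ins v) (R.ins (v, i))"
  and in_copy_old: "x \<in> X \<Longrightarrow> i \<in> {1..k} \<Longrightarrow> isl x \<or> 1 < i \<Longrightarrow> in_copy x i = Inl (inarr x i)"
  and Z_in_copy_old: "x \<in> X \<Longrightarrow> i \<in> {1..k} \<Longrightarrow> isl (Z x) \<or> i < k \<Longrightarrow> R.Z (in_copy x i) = Inl (rep_arr (Z x) i)"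
proof -
  note iso = someI_ex[OF exists_local_isomorphism, folded local_iso_def]
  show "bij_betw (\<lambda>x. in_copy x i) (ins v) (R.ins (v, i))" if "v \<in> verts Q" "i \<in> {1..k}"
  proof -
    have "bij_betw (\<lambda>x. in_copy x i) (ins v) (R.ins (v, i)) \<longleftrightarrow> bij_betw (local_iso v i) (ins v) (R.ins (v, i))"
      by (rule bij_betw_cong) (simp add: in_copy_def ins_iff)
    then show ?thesis using iso[OF that] by blast
  qed
  show "in_copy x i = Inl (inarr x i)" if "x \<in> X" "i \<in> {1..k}" "isl x \<or> 1 < i"
    using iso[OF vin_vout_verts(1)[OF that(1)] that(2)] that by (auto simp: in_copy_def old_ins_def ins_iff)
  show "R.Z (in_copy x i) = Inl (rep_arr (Z x) i)" if "x \<in> X" "i \<in> {1..k}" "isl (Z x) \<or> i < k"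
  proof -
    have "x \<in> ins (vin x)" using that(1) by (simp add: ins_iff)
    then have "Z x \<in> old_outs (vin x) i"
      using bij_betwE[OF bij_Z] that(3) by (auto simp: old_outs_def)
    then show ?thesis using iso[OF vin_vout_verts(1)[OF that(1)] that(2)] \<open>x \<in> ins (vin x)\<close>
      by (auto simp: in_copy_def)
  qed
qed

lemma Zinv_in_X: "Zinv y \<in> X \<longleftrightarrow> y \<in> X" and Z_Zinv: "Z (Zinv y) = y" and Zinv_Z: "Zinv (Z y) = y"
proof -
  show "Z (Zinv y) = y" "Zinv (Z y) = y"
    by (rule permutes_inverses[OF Z_permutes])+
  then show "Zinv y \<in> X \<longleftrightarrow> y \<in> X" using Z_in_X by metis
qed

lemma Z_in_copy: "R.Z (in_copy x i) = out_copy (Z x) i" by (simp add: out_copy_def Zinv_Z)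

lemma out_copy_old: "y \<in> X \<Longrightarrow> i \<in> {1..k} \<Longrightarrow> isl y \<or> i < k \<Longrightarrow> out_copy y i = Inl (rep_arr y i)"
  using Z_in_copy_old[of "Zinv y" i] by (simp add: out_copy_def Zinv_in_X Z_Zinv)

lemma bij_in_copy: "bij_betw (\<lambda>(x, i). in_copy x i) (X \<times> {1..k}) R.X"
proof (rule bij_betw_imageI)
  have in_copy_in: "in_copy x i \<in> R.ins (vin x, i)" if "x \<in> X" "i \<in> {1..k}" for x i
    using bij_betwE[OF bij_in_copy_local] that vin_vout_verts ins_iff by blast
  show "inj_on (\<lambda>(x, i). in_copy x i) (X \<times> {1..k})"
  proof (rule inj_onI, clarify)
    fix x i y j assume *: "x \<in> X" "i \<in> {1..k}" "y \<in> X" "j \<in> {1..k}" "in_copy x i = in_copy y j"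
    have "(vin x, i) = (vin y, j)"
      using in_copy_in[OF *(1,2)] in_copy_in[OF *(3,4)] *(5) by (auto simp: R.ins_def)
    moreover from this have "x = y"
      using inj_onD[OF bij_betw_imp_inj_on[OF bij_in_copy_local]] * vin_vout_verts(1)[OF *(1)]
      by (auto simp: ins_iff)
    ultimately show "x = y \<and> i = j" by simp
  qed
  show "(\<lambda>(x, i). in_copy x i) ` (X \<times> {1..k}) = R.X"
  proof (intro equalityI subsetI)
    fix y assume "y \<in> (\<lambda>(x, i). in_copy x i) ` (X \<times> {1..k})"
    then show "y \<in> R.X" using in_copy_in by (auto simp: R.ins_def)
  next
    fix y assume "y \<in> R.X"
    then obtain w where w: "w \<in> verts Q'" "y \<in> R.ins w" by (rule R.head_in_arrowE)
    then obtain v i where vi: "w = (v, i)" "v \<in> verts Q" "i \<in> {1..k}" by (auto simp: verts_Q')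
    then obtain x where "x \<in> ins v" "y = in_copy x i"
      using bij_in_copy_local[OF vi(2,3)] w(2) by (auto simp: bij_betw_def)
    then show "y \<in> (\<lambda>(x, i). in_copy x i) ` (X \<times> {1..k})" using vi by (auto simp: ins_def)
  qed
qed

lemma bij_out_copy: "bij_betw (\<lambda>(x, i). out_copy x i) (X \<times> {1..k}) R.X"
proof -
  have inv: "bij_betw (\<lambda>(x, i). (Zinv x, i)) (X \<times> {1..k}) (X \<times> {1..k})"
    by (rule bij_betw_byWitness[where f' = "\<lambda>(x, i). (Z x, i)"]) (auto simp: Zinv_in_X Z_Zinv Zinv_Z)
  have "bij_betw (R.Z \<circ> ((\<lambda>(x, i). in_copy x i) \<circ> (\<lambda>(x, i). (Zinv x, i)))) (X \<times> {1..k}) R.X"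
    by (rule bij_betw_trans[OF bij_betw_trans[OF inv bij_in_copy] permutes_imp_bij[OF R.Z_permutes]])
  moreover have "R.Z \<circ> ((\<lambda>(x, i). in_copy x i) \<circ> (\<lambda>(x, i). (Zinv x, i))) = (\<lambda>(x, i). out_copy x i)"
    by (auto simp: fun_eq_iff out_copy_def)
  ultimately show ?thesis by simp
qed

text \<open>
  Every arrow of the repetition that arrives at level \<open>1\<close> or leaves at level \<open>k\<close> is already taken as
  the copy of an arrow of \<open>Q\<close>, so by injectivity the copy of a label is a new arrow there.
\<close>
lemma new_labels:
  assumes p: "p \<in> D"
  shows "\<exists>r. in_copy (Inr p) 1 = Inr r" "\<exists>r. out_copy (Inr p) k = Inr r"
proof -
  have X: "Inr p \<in> X" using p by simp
  have k1: "1 \<in> {1..k}" "k \<in> {1..k}" using k by auto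
  show "\<exists>r. in_copy (Inr p) 1 = Inr r"
  proof (cases "in_copy (Inr p) 1")
    case (Inl e)
    let ?v = "vin (Inr p)"
    have v: "?v \<in> verts Q" by (rule vin_vout_verts(1)[OF X])
    have "Inl e \<in> R.ins (?v, 1)"
      using bij_betwE[OF bij_in_copy_local[OF v k1(1)]] Inl X ins_iff by metis
    then obtain x where x: "x \<in> old_ins ?v 1" "e = inarr x 1" using old_in_arc_iff[OF v k1(1)] by blast
    then have "x \<in> X" "isl x" by (auto simp: old_ins_def ins_def)
    then have "in_copy x 1 = in_copy (Inr p) 1" using in_copy_old[of x 1] k1 x Inl by simp
    then have "x = Inr p"
      using inj_onD[OF bij_betw_imp_inj_on[OF bij_in_copy], of "(x, 1)" "(Inr p, 1)"] \<open>x \<in> X\<close> X k1 by auto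
    then show ?thesis using \<open>isl x\<close> by simp
  qed auto
  show "\<exists>r. out_copy (Inr p) k = Inr r"
  proof (cases "out_copy (Inr p) k")
    case (Inl e)
    let ?v = "vout (Inr p)"
    have v: "?v \<in> verts Q" by (rule vin_vout_verts(2)[OF X])
    have "Zinv (Inr p) \<in> ins ?v"
      using bij_Z[of ?v] X Z_Zinv[of "Inr p"] inj_onD[OF permutes_inj_on[OF Z_permutes]]
      by (metis bij_betw_def imageE outs_iff Zinv_Z)
    then have "Inl e \<in> R.outs (?v, k)"
      using bij_betwE[OF bij_in_copy_local[OF v k1(2)]] bij_betwE[OF R.bij_Z] Inl unfolding out_copy_def by metis
    then obtain y where y: "y \<in> old_outs ?v k" "e = rep_arr y k" using old_out_arc_iff[OF v k1(2)] by blast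
    then have "y \<in> X" "isl y" by (auto simp: old_outs_def outs_def)
    then have "out_copy y k = out_copy (Inr p) k" using out_copy_old[of y k] k1 y Inl by simp
    then have "y = Inr p"
      using inj_onD[OF bij_betw_imp_inj_on[OF bij_out_copy], of "(y, k)" "(Inr p, k)"] \<open>y \<in> X\<close> X k1 by auto
    then show ?thesis using \<open>isl y\<close> by simp
  qed auto
qed

text \<open>
  At each vertex the copies respect vanishing, hence also its complement.
\<close>
lemma R_survives:
  assumes "survives x y" "i \<in> {1..k}"
  shows "R.survives (in_copy x i) (out_copy y i)"
proof -
  have X: "x \<in> X" "y \<in> X" and heads: "vin x = vout y" and nv: "\<not> vanishes x y"
    using assms(1) vin_eq_vout_iff by (auto simp: survives_def vanishes_def)
  let ?v = "vin x"
  have v: "?v \<in> verts Q" by (rule vin_vout_verts(1)[OF X(1)])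
  have zi: "Zinv y \<in> ins ?v"
    using bij_Z[of ?v] X heads by (metis bij_betw_def imageE outs_iff Zinv_Z)
  have x: "x \<in> ins ?v" using X by (simp add: ins_iff)
  have in_copy_in: "in_copy x i \<in> R.ins (?v, i)" and in_copy_in': "in_copy (Zinv y) i \<in> R.ins (?v, i)"
    using bij_betwE[OF bij_in_copy_local[OF v assms(2)]] x zi by auto
  have out_copy_in: "out_copy y i \<in> R.outs (?v, i)" unfolding out_copy_def using bij_betwE[OF R.bij_Z] in_copy_in' by blast
  have "\<not> R.vanishes (in_copy x i) (out_copy y i)"
  proof
    assume "R.vanishes (in_copy x i) (out_copy y i)"
    then have "R.Z (in_copy x i) = R.Z (in_copy (Zinv y) i)"
      using R.vanishes_iff[of "in_copy x i"] in_copy_in by (auto simp: R.ins_def out_copy_def)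
    then have "in_copy x i = in_copy (Zinv y) i" using permutes_inj[OF R.Z_permutes] by (auto dest: injD)
    then have "x = Zinv y"
      using inj_onD[OF bij_betw_imp_inj_on[OF bij_in_copy_local[OF v assms(2)]]] x zi by blast
    then show False using nv vanishes_iff[OF X(1)] Z_Zinv by metis
  qed
  then show ?thesis using in_copy_in out_copy_in by (auto simp: R.survives_def R.vanishes_def R.ins_def R.outs_def)
qed

text \<open>
  Arrows of \<open>Q\<close> have the same copy on arrival and on departure, so a chain without inner labels lifts
  within its level.
\<close>
lemma lift_chain:
  assumes i: "i \<in> {1..k}"
  shows "x \<in> X \<Longrightarrow> set ds \<subseteq> arcs Q \<Longrightarrow> successively survives (x # map Inl ds @ [y]) \<Longrightarrow>
    successively R.survives (in_copy x i # map Inl (map (\<lambda>d. Copy d i) ds) @ [out_copy y i])"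
proof (induction ds arbitrary: x)
  case (Cons d ds)
  have "in_copy (Inl d) i = Inl (Copy d i)" "out_copy (Inl d) i = Inl (Copy d i)"
    using in_copy_old[of "Inl d" i] out_copy_old[of "Inl d" i] i Cons.prems by auto
  then show ?case using Cons.IH[of "Inl d"] Cons.prems R_survives[of x "Inl d" i] i by auto
qed (use R_survives i in auto)

text \<open>
  Lift the nonvanishing chain from \<open>p\<close> to \<open>p\<close> to the levels \<open>1, \<dots>, k\<close>. At a level \<open>i < k\<close> the end
  of the lift and the start of the next one are the connecting arrow \<open>Conn p i\<close>, so the lifts
  concatenate to a chain from \<open>in_copy (Inr p) 1\<close> to \<open>out_copy (Inr p) k\<close> without inner labels. In the
  repetition, the first label met from a label is that label itself.
\<close>
lemma out_copy_label_eq_in_copy: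
  assumes p: "p \<in> D"
  shows "out_copy (Inr p) k = in_copy (Inr p) 1"
proof -
  have X: "Inr p \<in> X" using p by simp
  obtain ds where ds: "set ds \<subseteq> arcs Q" "successively survives (Inr p # map Inl ds @ [Inr p])"
    using label_chain[OF p] by blast
  have "\<exists>es. successively R.survives (in_copy (Inr p) 1 # map Inl es @ [out_copy (Inr p) i])" if "1 \<le> i" "i \<le> k" for i
    using that
  proof (induction i rule: dec_induct)
    case base
    then show ?case
      using lift_chain[of 1, OF _ X ds] by (intro exI[of _ "map (\<lambda>d. Copy d 1) ds"]) simp
  next
    case (step i)
    then obtain es where es: "successively R.survives (in_copy (Inr p) 1 # map Inl es @ [out_copy (Inr p) i])" by auto
    have "out_copy (Inr p) i = Inl (Conn p i)" "in_copy (Inr p) (Suc i) = Inl (Conn p i)"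
      using out_copy_old[of "Inr p" i] in_copy_old[of "Inr p" "Suc i"] X step by auto
    moreover have "successively R.survives (in_copy (Inr p) (Suc i) # map Inl (map (\<lambda>d. Copy d (Suc i)) ds) @ [out_copy (Inr p) (Suc i)])"
      using lift_chain[of "Suc i", OF _ X ds] step by auto
    ultimately have "successively R.survives
        ((in_copy (Inr p) 1 # map Inl es) @ Inl (Conn p i) # map Inl (map (\<lambda>d. Copy d (Suc i)) ds) @ [out_copy (Inr p) (Suc i)])"
      using es by (subst successively_append_iff) (auto simp: successively_append_iff successively_Cons split: if_splits)
    then show ?case by (intro exI[of _ "es @ Conn p i # map (\<lambda>d. Copy d (Suc i)) ds"]) simp
  qed
  then obtain es where es: "successively R.survives (in_copy (Inr p) 1 # map Inl es @ [out_copy (Inr p) k])"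
    using k by (metis One_nat_def Suc_leI order_refl)
  obtain r r' where r: "in_copy (Inr p) 1 = Inr r" "out_copy (Inr p) k = Inr r'" using new_labels[OF p] by auto
  have "in_copy (Inr p) 1 \<in> R.X" using bij_betwE[OF bij_in_copy] X k by force
  then have "r \<in> R.D" using r by simp
  then obtain es' where "successively R.survives (Inr r # map Inl es' @ [Inr r])"
    using R.label_chain by blast
  then have "r' = r" using R.surviving_chain_unique es r by metis
  then show ?thesis using r by simp
qed

text \<open>
  Leaving at level \<open>i + 1\<close> as a label means arriving at the next level, cyclically; levels
  \<open>1, \<dots>, k\<close> are written as successors of the levels \<open>0, \<dots>, k - 1\<close> of the cover.
\<close>
lemma out_copy_eq_in_copy:
  assumes "x \<in> X" "i < k"
  shows "out_copy x (Suc i) = in_copy x (Suc (if x \<in> labels then Suc i mod k else i))"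
proof (cases x)
  case (Inl a)
  then show ?thesis using assms out_copy_old[of x "Suc i"] in_copy_old[of x "Suc i"] by (auto simp: labels_def)
next
  case (Inr p)
  then have p: "p \<in> D" "x \<in> labels" using assms by (auto simp: labels_def)
  show ?thesis
  proof (cases "Suc i < k")
    case True
    then show ?thesis
      using Inr p assms out_copy_old[of x "Suc i"] in_copy_old[of x "Suc (Suc i)"] by auto
  next
    case False
    then have "Suc i = k" using assms by simp
    then show ?thesis using out_copy_label_eq_in_copy[OF p(1)] p Inr by simp
  qed
qed

text \<open>
  The map \<open>(x, i) \<mapsto> out_copy x (i + 1)\<close> conjugates the cyclic cover of \<open>Z\<close> to the permutation of the
  repetition. The labels of the repetition are the copies of labels at the last level.
\<close>
lemma num_cycles_rep:
  "num_cycles R.Z R.X R.labels q l = num_cycles (cyclic_cover k Z labels) (X \<times> {..<k}) (labels \<times> {k - 1}) q l"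
proof (rule num_cycles_conjugate[where h = "\<lambda>(x, i). out_copy x (Suc i)"])
  have "bij_betw (\<lambda>(x, i). (x, Suc i)) (X \<times> {..<k}) (X \<times> {1..k})"
    by (rule bij_betw_byWitness[where f' = "\<lambda>(x, i). (x, i - 1)"]) auto
  from bij_betw_trans[OF this bij_out_copy]
  show "bij_betw (\<lambda>(x, i). out_copy x (Suc i)) (X \<times> {..<k}) R.X" by (simp add: comp_def case_prod_beta')
  fix y assume "y \<in> X \<times> {..<k}"
  then obtain x i where y: "y = (x, i)" "x \<in> X" "i < k" by auto
  show "cyclic_cover k Z labels y \<in> X \<times> {..<k}" using y by (auto simp: cyclic_cover_def)
  show "R.Z (case y of (x, i) \<Rightarrow> out_copy x (Suc i)) = (case cyclic_cover k Z labels y of (x, i) \<Rightarrow> out_copy x (Suc i))"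
    using y by (simp add: cyclic_cover_def out_copy_eq_in_copy Z_in_copy)
  show "y \<in> orbit (cyclic_cover k Z labels) y"
    using cyclic_cover_cycle(1)[OF self_in_orbit y(3) refl] y(1) by simp
  have in_RX: "out_copy x (Suc i) \<in> R.X" using bij_betwE[OF bij_out_copy] y by force
  show "(case y of (x, i) \<Rightarrow> out_copy x (Suc i)) \<in> R.labels \<longleftrightarrow> y \<in> labels \<times> {k - 1}"
  proof (cases "isl x \<or> Suc i < k")
    case True
    then have "out_copy x (Suc i) = Inl (rep_arr x (Suc i))" using out_copy_old y by auto
    then show ?thesis using True y by (auto simp: labels_def R.labels_def)
  next
    case False
    then obtain p where p: "x = Inr p" "p \<in> D" "Suc i = k" using y by (cases x) auto
    obtain r where r: "out_copy x (Suc i) = Inr r" using new_labels(2)[OF p(2)] p by auto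
    then have "Inr r \<in> R.labels" using in_RX by (simp add: R.labels_def)
    moreover have "i = k - 1" using p(3) by simp
    ultimately show ?thesis using r p y by (simp add: labels_def)
  qed
qed

theorem AG_phi_rep_pos:
  assumes "0 < n"
  shows "AG_phi Q' I' J' s' t' n m = (\<Sum>(q, l) \<in> S_rep k n m. gcd q k * AG_phi Q I J s t q l)"
proof -
  have "AG_phi Q' I' J' s' t' n m = (\<Sum>(q, l) \<in> S_rep k n m. gcd q k * num_cycles Z X labels q l)"
    unfolding R.AG_phi_pos[OF assms] num_cycles_rep
    by (rule num_cycles_cyclic_cover_S_rep[OF finite_X _ self_in_orbit _ assms]) (use k in auto)
  also have "\<dots> = (\<Sum>(q, l) \<in> S_rep k n m. gcd q k * AG_phi Q I J s t q l)"
    by (intro sum.cong refl) (auto simp: AG_phi_pos S_rep_def)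
  finally show ?thesis .
qed

theorem AG_phi_rep_0: "AG_phi Q' I' J' s' t' 0 l = k * AG_phi Q I J s t 0 l"
  unfolding R.AG_phi_0 AG_phi_0 num_cycles_rep
  by (rule num_cycles_cyclic_cover_0[OF finite_X _ self_in_orbit]) (use k in auto)

end


section \<open>The AG-invariants of a repetition\<close>

lemma connected_not_isolated:
  assumes "Digraph_Component.connected Q" "wf_digraph Q" "arcs Q \<noteq> {}" "v \<in> verts Q"
  shows "\<exists>a \<in> arcs Q. tail Q a = v \<or> head Q a = v"
proof -
  interpret wf_digraph Q by fact
  interpret S: pair_wf_digraph "mk_symmetric Q" by (rule wellformed_mk_symmetric)
  obtain e where e: "e \<in> arcs Q" using assms(3) by auto
  have "v \<rightarrow>\<^sup>*\<^bsub>mk_symmetric Q\<^esub> tail Q e"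
    using assms(1,4) e unfolding connected_def strongly_connected_def by auto
  then have "(v, tail Q e) \<in> rtrancl_on (verts Q) (parcs (mk_symmetric Q))"
    by (simp add: reachable_def)
  then show ?thesis
  proof (cases rule: converse_rtrancl_on_cases)
    case (step c)
    then show ?thesis by (auto simp: parcs_mk_symmetric)
  qed (use e in auto)
qed

theorem proposition4p2:
  fixes Q :: "('v, 'a) pre_digraph"
    and I :: "(('v, 'a) qpath \<Rightarrow>\<^sub>0 'k::alg_closed_field) set"
    and J :: "(('v bl_vertex, ('v, 'a) bl_arrow) qpath \<Rightarrow>\<^sub>0 'k) set"
    and s t :: "nat \<Rightarrow> 'v bl_vertex"
    and k :: nat
    and J' :: "((('v \<times> nat) bl_vertex, ('v \<times> nat, 'a rep_arrow) bl_arrow) qpath \<Rightarrow>\<^sub>0 'k) set"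
    and s' t' :: "nat \<Rightarrow> ('v \<times> nat) bl_vertex"
  assumes "gentle Q I"
    and "Digraph_Component.connected Q"
    and "arcs Q \<noteq> {}"
    and "blossoming Q I J s t"
    and "0 < k"
    and "blossoming (rep_quiver Q s t k) (rep_ideal Q I J s t k) J' s' t'"
  shows "(\<forall>n m :: nat. 0 < n \<longrightarrow>
            AG_phi (rep_quiver Q s t k) (rep_ideal Q I J s t k) J' s' t' n m =
              (\<Sum>(q, l) \<in> S_rep k n m. gcd q k * AG_phi Q I J s t q l)) \<and>
         (\<forall>l :: nat. 0 < l \<longrightarrow>
            AG_phi (rep_quiver Q s t k) (rep_ideal Q I J s t k) J' s' t' 0 l =
              k * AG_phi Q I J s t 0 l)"
proof -
  have "wf_digraph Q"
    using assms(1) by (auto simp: gentle_def locally_gentle_def fin_digraph_def)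
  then interpret gentle_repetition Q I J s t k J' s' t'
    using assms connected_not_isolated[of Q] by unfold_locales auto
  show ?thesis using AG_phi_rep_pos AG_phi_rep_0 by blast
qed

end
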